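(* Let $d\geq 1$ be an integer, let $0<\lambda<\infty$ and $0\leq m<\infty$, with $m>0$ if $d\in\{1,2\}$. Let $d\mu_\lambda(\Phi)$ be the measure on $\mathcal S'(\mathbb R^d)$ given by stochastic quantization of the free scalar field of mass $m$ at stochastic time $\lambda$ with zero initial data (defined in the context). (1) If $d\geq 2$, then $d\mu_\lambda(\Phi)$ is not reflection positive with respect to time reflection. (2) If $d=1$ and $1<2\lambda m^2<\infty$, then $d\mu_\lambda(\Phi)$ is not reflection positive with respect to time reflection. (3) Under the same conditions on $d,\lambda,m$ (that is, $d\geq 2$, or $d=1$ and $1<2\lambda m^2<\infty$), reflection positivity with respect to time reflection also fails when space-time $\mathbb R^d$ is replaced by its toroidal compactification in any subset of the coordinates: for every subset $J$ of the $d$ coordinates (possibly including the time coordinate) and all circumferences $\ell_j>0$, $j\in J$, the analogously defined measure $d\mu_\lambda(\Phi)$ on $\mathcal S'(M)$ is not reflection positive, where $M$ is obtained from $\mathbb R^d$ by replacing the $j$-th factor $\mathbb R$ by the circle $\mathbb R/\ell_j\mathbb Z$ for each $j\in J$.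
   Context: Space-time. Let $M$ be $\mathbb R^d$ or one of its toroidal compactifications, i.e. a product of $d$ factors, each equal to $\mathbb R$ or to a circle $\mathbb R/\ell_j\mathbb Z$. Points are written $x=(\vec x,t)$, where $t$ is the time coordinate and $\vec x$ the remaining $d-1$ coordinates. $\mathcal S(M)$ denotes the smooth functions on $M$ that are rapidly decreasing with all derivatives in the non-compact directions (so $\mathcal S(\mathbb R^d)$ is Schwartz space), and $\mathcal S'(M)$ is its dual; real distributions $\Phi\in\mathcal S'(M)$ are extended complex-linearly to complex test functions. $\Delta$ is the Laplacian on $M$ (in all $d$ variables, including $t$). The measure. Consider the linear stochastic PDE $$\frac{\partial\Phi_\lambda(x)}{\partial\lambda}=-\tfrac12(-\Delta+m^2)\Phi_\lambda(x)+\xi_\lambda(x),\qquad \Phi_0=0,$$ where $\xi$ is Gaussian white noise with law $d\nu(\xi)$, mean zero and covariance $\int \xi_\lambda(x)\xi_{\lambda'}(x')\,d\nu(\xi)=\delta(\lambda-\lambda')\delta(x-x')$. Its solution is $\Phi_\lambda=\int_0^\lambda \mathfrak K_{\lambda-\alpha}\,\xi_\alpha\,d\alpha$ with $\mathfrak K_\lambda=e^{-\frac{\lambda}{2}(-\Delta+m^2)}$. The measure $d\mu_\lambda(\Phi)$ on $\mathcal S'(M)$ is the law of $\Phi_\lambda$ for fixed $\lambda$, i.e. $\int\Phi(f)^n\,d\mu_\lambda(\Phi)=\int\Phi_\lambda(f)^n\,d\nu(\xi)$ for all $n$ and all $f\in\mathcal S(M)$. Equivalently, $d\mu_\lambda$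 is the Gaussian measure with mean zero and covariance operator $$D_\lambda=\int_0^\lambda e^{-\alpha(-\Delta+m^2)}\,d\alpha ,$$ which equals $(I-e^{-\lambda C^{-1}})C$ with $C=(-\Delta+m^2)^{-1}$; that is, $\int\Phi(f)\Phi(g)\,d\mu_\lambda(\Phi)=\langle f,D_\lambda g\rangle_{L^2(M)}$ for real $f,g\in\mathcal S(M)$. Reflection positivity (RP). Time reflection is $\vartheta(\vec x,t)=(\vec x,-t)$, acting on functions by $(\vartheta f)(x)=f(\vartheta x)$. The positive-time region $M_+$ is $\{t\geq 0\}$ if the time coordinate is non-compact, and $\{0\leq t\leq \ell/2 \bmod \ell\}$ if the time coordinate lies in $\mathbb R/\ell\mathbb Z$. Let $\mathcal E_+$ be the algebra of complex polynomials in the random variables $\Phi(f)$ with $f\in\mathcal S(M)$ supported in $M_+$, and let $\Theta$ be the algebra homomorphism determined by $\Theta(\Phi(f))=\Phi(\vartheta f)$. A measure $d\mu(\Phi)$ on $\mathcal S'(M)$ is reflection positive if $$\int \overline{A(\Phi)}\,(\Theta A)(\Phi)\,d\mu(\Phi)\geq 0\qquad\text{for all }A\in\mathcal E_+ .$$ "RP fails" (the measure is "not reflection positive") means that there is some $A\in\mathcal E_+$ for which this integral is strictly negative. *)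

theory Defs
  imports "HOL-Probability.Probability" "HOL-Library.Complex_Order"
begin

section \<open>Space-time\<close>

text \<open>
  A space-time \<open>M\<close> of dimension \<open>CARD('n)\<close> is given by a partial function \<open>L\<close> on the set of
  coordinates: \<open>L j = None\<close> means that the \<open>j\<close>-th factor is the real line, \<open>L j = Some l\<close> that it
  is a circle of circumference \<open>l\<close>.  Thus \<open>Map.empty\<close> is Euclidean space.  Functions and subsets
  of \<open>M\<close> are represented by their lifts to the universal cover \<open>real ^ 'n\<close>, that is, by functions
  and subsets that are periodic in the compact coordinates.
\<close>

definition periodic :: "('n \<rightharpoonup> real) \<Rightarrow> (real ^ 'n \<Rightarrow> real) \<Rightarrow> bool" where
  "periodic L f \<longleftrightarrow> (\<forall>j l. L j = Some l \<longrightarrow> (\<forall>x. f (x + axis j l) = f x))"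

text \<open>A fundamental domain; integration over \<open>M\<close> is integration over this set.\<close>

definition fundamental_cell :: "('n \<rightharpoonup> real) \<Rightarrow> (real ^ 'n) set" where
  "fundamental_cell L = {x. \<forall>j l. L j = Some l \<longrightarrow> 0 \<le> x $ j \<and> x $ j < l}"


section \<open>Test functions and distributions\<close>

definition partial_deriv :: "'n \<Rightarrow> (real ^ 'n \<Rightarrow> real) \<Rightarrow> real ^ 'n \<Rightarrow> real" where
  "partial_deriv i f x = deriv (\<lambda>s. f (x + s *\<^sub>R axis i 1)) 0"

primrec partial_derivs :: "'n list \<Rightarrow> (real ^ 'n \<Rightarrow> real) \<Rightarrow> real ^ 'n \<Rightarrow> real" where
  "partial_derivs [] f = f"
| "partial_derivs (i # js) f = partial_deriv i (partial_derivs js f)"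

definition smooth :: "(real ^ 'n \<Rightarrow> real) \<Rightarrow> bool" where
  "smooth f \<longleftrightarrow> (\<forall>js. continuous_on UNIV (partial_derivs js f) \<and>
     (\<forall>i x. (\<lambda>s. partial_derivs js f (x + s *\<^sub>R axis i 1)) differentiable (at 0)))"

definition weight :: "('n \<rightharpoonup> real) \<Rightarrow> real ^ 'n \<Rightarrow> real" where
  "weight L x = 1 + (\<Sum>i\<in>- dom L. (x $ i)\<^sup>2)"

text \<open>The real part of the space \<open>S(M)\<close>.\<close>

definition schwartz :: "('n \<rightharpoonup> real) \<Rightarrow> (real ^ 'n \<Rightarrow> real) set" where
  "schwartz L = {f. periodic L f \<and> smooth f \<and>
     (\<forall>k js. bdd_above (range (\<lambda>x. weight L x ^ k * \<bar>partial_derivs js f x\<bar>)))}"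

definition schwartz_seminorm ::
    "('n \<rightharpoonup> real) \<Rightarrow> nat \<times> 'n list \<Rightarrow> (real ^ 'n \<Rightarrow> real) \<Rightarrow> real" where
  "schwartz_seminorm L = (\<lambda>(k, js) f. SUP x. weight L x ^ k * \<bar>partial_derivs js f x\<bar>)"

definition schwartz_complex :: "('n \<rightharpoonup> real) \<Rightarrow> (real ^ 'n \<Rightarrow> complex) set" where
  "schwartz_complex L = {f. (\<lambda>x. Re (f x)) \<in> schwartz L \<and> (\<lambda>x. Im (f x)) \<in> schwartz L}"

type_synonym 'n distribution = "(real ^ 'n \<Rightarrow> real) \<Rightarrow> real"

text \<open>
  The real part of the dual \<open>S'(M)\<close>: linear functionals on test functions that are continuous for
  the locally convex topology defined by the seminorms above.
\<close>

definition tempered :: "('n \<rightharpoonup> real) \<Rightarrow> ('n::finite) distribution set" where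
  "tempered L = {\<Phi> \<in> extensional (schwartz L).
     (\<forall>f\<in>schwartz L. \<forall>g\<in>schwartz L. \<forall>a b. \<Phi> (\<lambda>x. a * f x + b * g x) = a * \<Phi> f + b * \<Phi> g) \<and>
     (\<exists>P C. finite P \<and> (\<forall>f\<in>schwartz L. \<bar>\<Phi> f\<bar> \<le> C * (\<Sum>p\<in>P. schwartz_seminorm L p f)))}"

text \<open>The \<open>\<sigma>\<close>-algebra generated by the evaluations \<open>\<Phi> \<mapsto> \<Phi>(f)\<close>.\<close>

definition tempered_sigma :: "('n \<rightharpoonup> real) \<Rightarrow> ('n::finite) distribution measure" where
  "tempered_sigma L = sigma (tempered L)
     {{\<Phi> \<in> tempered L. \<Phi> f \<in> B} | f B. f \<in> schwartz L \<and> B \<in> sets borel}"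

definition eval_complex :: "('n::finite) distribution \<Rightarrow> (real ^ 'n \<Rightarrow> complex) \<Rightarrow> complex" where
  "eval_complex \<Phi> f = Complex (\<Phi> (\<lambda>x. Re (f x))) (\<Phi> (\<lambda>x. Im (f x)))"


section \<open>The heat semigroup\<close>

text \<open>
  \<open>heat m \<tau> = exp (- \<tau> (- \<Delta> + m\<^sup>2))\<close> for \<open>\<tau> \<ge> 0\<close>.  The heat kernel of \<open>exp (\<tau> \<Delta>)\<close> on Euclidean space
  is \<open>(4\<pi>\<tau>)\<close> to the power \<open>- d/2\<close> times \<open>exp (- |x - y|\<^sup>2 / (4\<tau>))\<close>, a product of normal densities of
  variance \<open>2\<tau>\<close>.  It commutes with translations, so applied to the lift of a function on \<open>M\<close> the same
  formula is the heat semigroup of \<open>M\<close>: summing the kernel over the period lattice gives the heat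
  kernel of \<open>M\<close>.
\<close>

definition heat :: "real \<Rightarrow> real \<Rightarrow> (real ^ 'n \<Rightarrow> real) \<Rightarrow> real ^ 'n \<Rightarrow> real" where
  "heat m \<tau> f x = (if \<tau> = 0 then f x
     else exp (- \<tau> * m\<^sup>2) *
       (\<integral>y. (\<Prod>i\<in>UNIV. normal_density 0 (sqrt (2 * \<tau>)) (x $ i - y $ i)) * f y \<partial>lborel))"

text \<open>
  On the eigenfunctions \<open>cos (p \<bullet> x + a)\<close> of \<open>- \<Delta> + m\<^sup>2\<close>, with eigenvalue \<open>|p|\<^sup>2 + m\<^sup>2\<close>, the operator
  \<open>heat m \<tau>\<close> acts as it should. (These functions live on \<open>M\<close> if \<open>p\<close> is in the dual lattice.)
\<close>

lemma integral_prod_components: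
  fixes h :: "'n::finite \<Rightarrow> real \<Rightarrow> complex"
  assumes h: "\<And>i. integrable lborel (h i)"
  shows "integrable lborel (\<lambda>y :: real ^ 'n. \<Prod>i\<in>UNIV. h i (y $ i))"
    and "(\<integral>y. (\<Prod>i\<in>UNIV. h i (y $ i)) \<partial>lborel) = (\<Prod>i\<in>UNIV. \<integral>s. h i s \<partial>lborel)"
proof -
  define e where "e = (\<lambda>i :: 'n. axis i 1 :: real ^ 'n)"
  define P where "P = (\<Pi>\<^sub>M b\<in>(Basis :: (real ^ 'n) set). (lborel :: real measure))"
  define T where "T = (\<lambda>f. \<Sum>b\<in>(Basis :: (real ^ 'n) set). f b *\<^sub>R b)"
  interpret product_sigma_finite "\<lambda>_ :: real ^ 'n. lborel :: real measure" ..
  have inj: "inj e"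
    by (auto simp: e_def inj_on_def axis_eq_axis)
  have rng: "range e = Basis"
    by (auto simp: e_def Basis_vec_def)
  have T: "T \<in> P \<rightarrow>\<^sub>M borel"
    unfolding T_def P_def by measurable
  have lb: "lborel = distr P borel T"
    unfolding P_def T_def by (rule lborel_eq)
  have comp: "T f $ i = f (e i)" for f i
    by (simp add: T_def e_def cart_eq_inner_axis inner_sum_left inner_Basis axis_in_Basis_iff if_distrib
        sum.delta cong: if_cong)
  have hm [measurable]: "h i \<in> borel_measurable borel" for i
    using borel_measurable_integrable[OF h[of i]] by simp
  have meas: "(\<lambda>y :: real ^ 'n. \<Prod>i\<in>UNIV. h i (y $ i)) \<in> borel_measurable borel"
    by measurable
  have re: "(\<Prod>i\<in>UNIV. h i (T f $ i)) = (\<Prod>b\<in>Basis. h (inv e b) (f b))" for f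
    unfolding comp rng[symmetric] using inj by (simp add: prod.reindex)
  show "integrable lborel (\<lambda>y :: real ^ 'n. \<Prod>i\<in>UNIV. h i (y $ i))"
    unfolding lb integrable_distr_eq[OF T meas] re unfolding P_def
    by (rule product_integrable_prod) (use h in auto)
  have "(\<integral>y. (\<Prod>i\<in>UNIV. h i (y $ i)) \<partial>lborel)
      = (\<integral>f. (\<Prod>b\<in>Basis. h (inv e b) (f b)) \<partial>P)"
    unfolding lb integral_distr[OF T meas] re ..
  also have "\<dots> = (\<Prod>b\<in>Basis. \<integral>s. h (inv e b) s \<partial>lborel)"
    unfolding P_def by (rule product_integral_prod) (use h in auto)
  also have "\<dots> = (\<Prod>i\<in>UNIV. \<integral>s. h i s \<partial>lborel)"
    unfolding rng[symmetric] using inj by (simp add: prod.reindex)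
  finally show "(\<integral>y. (\<Prod>i\<in>UNIV. h i (y $ i)) \<partial>lborel) = (\<Prod>i\<in>UNIV. \<integral>s. h i s \<partial>lborel)" .
qed

lemma normal_density_cis:
  fixes p r \<sigma> :: real
  assumes "0 < \<sigma>"
  shows "integrable lborel (\<lambda>s. normal_density 0 \<sigma> (r - s) * cis (p * s))"
    and "(\<integral>s. normal_density 0 \<sigma> (r - s) * cis (p * s) \<partial>lborel) = exp (- (\<sigma> * p)\<^sup>2 / 2) * cis (p * r)"
proof -
  let ?g = "\<lambda>s. normal_density 0 \<sigma> (r - s) * cis (p * s)"
  have shift: "?g (r + (- \<sigma>) * z)
      = (1 / \<sigma>) * (cis (p * r) * (std_normal_density z *\<^sub>R cis (- (\<sigma> * p) * z)))" for z
  proof -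
    have "normal_density 0 \<sigma> (r - (r + (- \<sigma>) * z)) = 1 / \<sigma> * std_normal_density z"
      using assms by (simp add: normal_density_def real_sqrt_mult power_mult_distrib field_simps)
    moreover have "cis (p * (r + (- \<sigma>) * z)) = cis (p * r) * cis (- (\<sigma> * p) * z)"
      by (simp add: cis_mult algebra_simps)
    ultimately show ?thesis
      by (simp add: scaleR_conv_of_real)
  qed
  have dens: "integrable lborel (\<lambda>z. std_normal_density z *\<^sub>R cis (- (\<sigma> * p) * z))"
    by (rule Bochner_Integration.integrable_bound[OF integrable_normal_density[of 1 0]])
       (auto simp: cis_conv_exp)
  have "(\<integral>z. std_normal_density z *\<^sub>R cis (- (\<sigma> * p) * z) \<partial>lborel)
      = char std_normal_distribution (- (\<sigma> * p))"
    unfolding char_def by (subst integral_density) (auto simp: cis_conv_exp)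
  also have "\<dots> = exp (- (\<sigma> * p)\<^sup>2 / 2)"
    by (simp add: char_std_normal_distribution)
  finally have ch: "(\<integral>z. std_normal_density z *\<^sub>R cis (- (\<sigma> * p) * z) \<partial>lborel) = exp (- (\<sigma> * p)\<^sup>2 / 2)" .
  have "integrable lborel (\<lambda>z. ?g (r + (- \<sigma>) * z))"
    unfolding shift by (intro integrable_mult_right dens)
  then show "integrable lborel ?g"
    using lborel_integrable_real_affine_iff[of "- \<sigma>" ?g r] assms by simp
  have "(\<integral>s. ?g s \<partial>lborel) = \<bar>- \<sigma>\<bar> *\<^sub>R (\<integral>z. ?g (r + (- \<sigma>) * z) \<partial>lborel)"
    using assms by (intro lborel_integral_real_affine) auto
  also have "\<dots> = exp (- (\<sigma> * p)\<^sup>2 / 2) * cis (p * r)"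
    unfolding shift integral_mult_right_zero ch using assms by (simp add: scaleR_conv_of_real)
  finally show "(\<integral>s. ?g s \<partial>lborel) = exp (- (\<sigma> * p)\<^sup>2 / 2) * cis (p * r)" .
qed

lemma heat_plane_wave:
  fixes p :: "real ^ 'n::finite"
  assumes "0 \<le> \<tau>"
  shows "heat m \<tau> (\<lambda>y. cos (p \<bullet> y + a)) x = exp (- \<tau> * (p \<bullet> p + m\<^sup>2)) * cos (p \<bullet> x + a)"
proof (cases "\<tau> = 0")
  case False
  define \<sigma> where "\<sigma> = sqrt (2 * \<tau>)"
  have \<sigma>: "0 < \<sigma>" "\<sigma>\<^sup>2 = 2 * \<tau>"
    using False assms by (auto simp: \<sigma>_def)
  define h where "h = (\<lambda>i s. normal_density 0 \<sigma> (x $ i - s) * cis (p $ i * s))"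
  have sq: "(\<sigma> * p $ i)\<^sup>2 / 2 = \<tau> * (p $ i * p $ i)" for i
    unfolding power_mult_distrib \<sigma>(2) by (simp add: power2_eq_square)
  have hi: "integrable lborel (h i)" for i
    by (simp add: h_def normal_density_cis(1)[OF \<sigma>(1)])
  have cis_inner: "(\<Prod>i\<in>UNIV. cis (p $ i * y $ i)) = cis (p \<bullet> y)" for y
    by (simp add: cis_conv_exp exp_sum sum_distrib_left inner_vec_def)
  have h_eq: "cis a * (\<Prod>i\<in>UNIV. h i (y $ i))
      = complex_of_real (\<Prod>i\<in>UNIV. normal_density 0 \<sigma> (x $ i - y $ i)) * cis (p \<bullet> y + a)" for y
    by (simp add: h_def prod.distrib cis_inner cis_mult[symmetric])
  have int: "integrable lborel (\<lambda>y :: real ^ 'n. cis a * (\<Prod>i\<in>UNIV. h i (y $ i)))"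
    by (intro integrable_mult_right integral_prod_components(1) hi)
  have "(\<integral>y. cis a * (\<Prod>i\<in>UNIV. h i (y $ i)) \<partial>lborel)
      = cis a * (\<Prod>i\<in>UNIV. \<integral>s. h i s \<partial>lborel)"
    by (simp only: integral_mult_right_zero integral_prod_components(2)[OF hi])
  also have "\<dots> = cis a * (\<Prod>i\<in>UNIV. exp (- (\<sigma> * p $ i)\<^sup>2 / 2) * cis (p $ i * x $ i))"
    by (simp add: h_def normal_density_cis(2)[OF \<sigma>(1)])
  also have "\<dots> = complex_of_real (\<Prod>i\<in>UNIV. exp (- (\<sigma> * p $ i)\<^sup>2 / 2)) * cis (p \<bullet> x + a)"
    by (simp add: prod.distrib cis_inner cis_mult[symmetric])
  also have "(\<Prod>i\<in>UNIV. exp (- (\<sigma> * p $ i)\<^sup>2 / 2)) = exp (- \<tau> * (p \<bullet> p))"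
    by (simp add: exp_sum[symmetric] sq inner_vec_def sum_distrib_left sum_negf)
  finally have eq: "(\<integral>y. cis a * (\<Prod>i\<in>UNIV. h i (y $ i)) \<partial>lborel)
      = complex_of_real (exp (- \<tau> * (p \<bullet> p))) * cis (p \<bullet> x + a)" .
  have "(\<integral>y. (\<Prod>i\<in>UNIV. normal_density 0 \<sigma> (x $ i - y $ i)) * cos (p \<bullet> y + a) \<partial>lborel)
      = Re (\<integral>y. cis a * (\<Prod>i\<in>UNIV. h i (y $ i)) \<partial>lborel)"
    using integral_Re[OF int] by (simp add: h_eq del: of_real_prod)
  also have "\<dots> = exp (- \<tau> * (p \<bullet> p)) * cos (p \<bullet> x + a)"
    unfolding eq by (simp del: of_real_exp)
  finally have int_eq: "(\<integral>y. (\<Prod>i\<in>UNIV. normal_density 0 \<sigma> (x $ i - y $ i)) * cos (p \<bullet> y + a) \<partial>lborel)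
      = exp (- \<tau> * (p \<bullet> p)) * cos (p \<bullet> x + a)" .
  have "exp (- \<tau> * (p \<bullet> p + m\<^sup>2)) = exp (- \<tau> * m\<^sup>2) * exp (- \<tau> * (p \<bullet> p))"
    unfolding exp_add[symmetric] by (simp add: algebra_simps)
  then show ?thesis
    using False int_eq unfolding heat_def \<sigma>_def by simp
qed (simp add: heat_def)

section \<open>Stochastic quantization\<close>

text \<open>The measure space on which white noise lives: stochastic time \<open>[0,\<infinity>)\<close> times \<open>M\<close>.\<close>

definition noise_space :: "('n \<rightharpoonup> real) \<Rightarrow> (real \<times> (real ^ 'n)) measure" where
  "noise_space L = restrict_space lborel ({0..} \<times> fundamental_cell L)"

definition L2 :: "'a measure \<Rightarrow> ('a \<Rightarrow> real) set" where
  "L2 N = {F \<in> borel_measurable N. integrable N (\<lambda>z. (F z)\<^sup>2)}"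

definition centered_gaussian :: "'w measure \<Rightarrow> ('w \<Rightarrow> real) \<Rightarrow> bool" where
  "centered_gaussian \<nu> X \<longleftrightarrow> X \<in> borel_measurable \<nu> \<and>
     ((AE \<omega> in \<nu>. X \<omega> = 0) \<or> (\<exists>\<sigma>>0. distributed \<nu> lborel X (normal_density 0 \<sigma>)))"

text \<open>
  \<open>\<nu>\<close> is the law of Gaussian white noise \<open>\<xi>\<close>; the point \<open>\<xi>\<close> of the probability space is the functional
  \<open>F \<mapsto> \<integral> F(\<alpha>,x) \<xi>\<^sub>\<alpha>(x) d\<alpha> dx\<close> on square-integrable \<open>F\<close>. The pairings are jointly Gaussian with mean
  zero, and the last clause is the covariance \<open>\<delta>(\<alpha> - \<alpha>') \<delta>(x - x')\<close> in smeared form.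
\<close>

definition white_noise :: "('n \<rightharpoonup> real) \<Rightarrow> ((real \<times> (real ^ 'n) \<Rightarrow> real) \<Rightarrow> real) measure \<Rightarrow> bool" where
  "white_noise L \<nu> \<longleftrightarrow> prob_space \<nu> \<and>
     (\<forall>S c. finite S \<and> S \<subseteq> L2 (noise_space L) \<longrightarrow>
        centered_gaussian \<nu> (\<lambda>\<xi>. \<Sum>F\<in>S. c F * \<xi> F)) \<and>
     (\<forall>F\<in>L2 (noise_space L). \<forall>G\<in>L2 (noise_space L).
        (\<integral>\<xi>. \<xi> F * \<xi> G \<partial>\<nu>) = (\<integral>z. F z * G z \<partial>noise_space L))"

text \<open>
  The solution \<open>\<Phi>\<^sub>\<lambda> = \<integral>\<^sub>0\<^sup>\<lambda> K\<^bsub>\<lambda>-\<alpha>\<^esub> \<xi>\<^sub>\<alpha> d\<alpha>\<close> with \<open>K\<^sub>\<lambda> = exp (- (\<lambda>/2) (- \<Delta> + m\<^sup>2))\<close> of the linear stochastic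
  partial differential equation, paired with a test function \<open>f\<close>. The self-adjoint operator \<open>K\<close> is
  moved to \<open>f\<close>, that is, \<open>\<xi>\<close> is paired with \<open>(K\<^bsub>\<lambda>-\<alpha>\<^esub> f)(x)\<close> for \<open>0 \<le> \<alpha> \<le> \<lambda>\<close>.
\<close>

definition solution ::
    "real \<Rightarrow> real \<Rightarrow> ((real \<times> (real ^ 'n) \<Rightarrow> real) \<Rightarrow> real) \<Rightarrow> ('n::finite) distribution" where
  "solution m lam \<xi> f =
     \<xi> (\<lambda>(\<alpha>, x). indicator {0..lam} \<alpha> * heat m ((lam - \<alpha>) / 2) f x)"

text \<open>
  \<open>\<mu>\<close> is the law of \<open>\<Phi>\<^sub>\<lambda>\<close> on \<open>S'(M)\<close>. The moments fix \<open>\<mu>\<close> uniquely, since Gaussian distributions are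
  determined by their moments.
\<close>

definition stochastic_quantization ::
    "('n \<rightharpoonup> real) \<Rightarrow> real \<Rightarrow> real \<Rightarrow> ('n::finite) distribution measure \<Rightarrow> bool" where
  "stochastic_quantization L m lam \<mu> \<longleftrightarrow> prob_space \<mu> \<and> sets \<mu> = sets (tempered_sigma L) \<and>
     (\<exists>\<nu>. white_noise L \<nu> \<and>
        (\<forall>f\<in>schwartz L. \<forall>n::nat. integrable \<mu> (\<lambda>\<Phi>. \<Phi> f ^ n) \<and>
           (\<integral>\<Phi>. \<Phi> f ^ n \<partial>\<mu>) = (\<integral>\<xi>. solution m lam \<xi> f ^ n \<partial>\<nu>)))"


section \<open>Reflection positivity\<close>

text \<open>Throughout, \<open>t\<close> is the index of the time coordinate.\<close>

definition reflect :: "'n \<Rightarrow> real ^ 'n \<Rightarrow> real ^ 'n" where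
  "reflect t x = (\<chi> i. if i = t then - x $ i else x $ i)"

definition positive_time :: "('n \<rightharpoonup> real) \<Rightarrow> 'n \<Rightarrow> (real ^ 'n) set" where
  "positive_time L t = (case L t of
       None \<Rightarrow> {x. 0 \<le> x $ t}
     | Some l \<Rightarrow> {x. \<exists>k::int. 0 \<le> x $ t + of_int k * l \<and> x $ t + of_int k * l \<le> l / 2})"

inductive_set positive_algebra ::
    "('n \<rightharpoonup> real) \<Rightarrow> 'n \<Rightarrow> (('n::finite) distribution \<Rightarrow> complex) set" for L t where
  const: "(\<lambda>\<Phi>. c) \<in> positive_algebra L t"
| field: "f \<in> schwartz_complex L \<Longrightarrow> closure {x. f x \<noteq> 0} \<subseteq> positive_time L t \<Longrightarrow>
    (\<lambda>\<Phi>. eval_complex \<Phi> f) \<in> positive_algebra L t"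
| add: "A \<in> positive_algebra L t \<Longrightarrow> B \<in> positive_algebra L t \<Longrightarrow>
    (\<lambda>\<Phi>. A \<Phi> + B \<Phi>) \<in> positive_algebra L t"
| mult: "A \<in> positive_algebra L t \<Longrightarrow> B \<in> positive_algebra L t \<Longrightarrow>
    (\<lambda>\<Phi>. A \<Phi> * B \<Phi>) \<in> positive_algebra L t"

text \<open>
  The algebra homomorphism \<open>\<Theta>\<close>, realized on all functionals of \<open>\<Phi>\<close> by substituting the reflected
  distribution; the following lemma shows that it has the defining property.
\<close>

definition Theta ::
    "'n \<Rightarrow> (('n::finite) distribution \<Rightarrow> complex) \<Rightarrow> 'n distribution \<Rightarrow> complex" where
  "Theta t A \<Phi> = A (\<lambda>f. \<Phi> (f \<circ> reflect t))"

lemma Theta_homomorphism: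
  "Theta t (\<lambda>\<Phi>. c) = (\<lambda>\<Phi>. c)"
  "Theta t (\<lambda>\<Phi>. eval_complex \<Phi> h) = (\<lambda>\<Phi>. eval_complex \<Phi> (h \<circ> reflect t))"
  "Theta t (\<lambda>\<Phi>. A \<Phi> + B \<Phi>) = (\<lambda>\<Phi>. Theta t A \<Phi> + Theta t B \<Phi>)"
  "Theta t (\<lambda>\<Phi>. A \<Phi> * B \<Phi>) = (\<lambda>\<Phi>. Theta t A \<Phi> * Theta t B \<Phi>)"
  by (simp_all add: Theta_def eval_complex_def o_def fun_eq_iff)

text \<open>
  In the order on the complex numbers used here, \<open>z < 0\<close> means that \<open>z\<close> is real and negative, and
  \<open>0 \<le> z\<close> that it is real and nonnegative. Failure of reflection positivity means a negative
  expectation.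
\<close>

definition reflection_positive ::
    "('n \<rightharpoonup> real) \<Rightarrow> 'n \<Rightarrow> ('n::finite) distribution measure \<Rightarrow> bool" where
  "reflection_positive L t \<mu> \<longleftrightarrow>
     (\<forall>A\<in>positive_algebra L t. 0 \<le> (\<integral>\<Phi>. cnj (A \<Phi>) * Theta t A \<Phi> \<partial>\<mu>))"

definition reflection_positivity_fails ::
    "('n \<rightharpoonup> real) \<Rightarrow> 'n \<Rightarrow> ('n::finite) distribution measure \<Rightarrow> bool" where
  "reflection_positivity_fails L t \<mu> \<longleftrightarrow>
     (\<exists>A\<in>positive_algebra L t. (\<integral>\<Phi>. cnj (A \<Phi>) * Theta t A \<Phi> \<partial>\<mu>) < 0)"

lemma reflection_positivity_fails_imp:
  "reflection_positivity_fails L t \<mu> \<Longrightarrow> \<not> reflection_positive L t \<mu>"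
  unfolding reflection_positivity_fails_def reflection_positive_def by (meson leD)

end

theory Submission
  imports Defs "HOL-Real_Asymp.Real_Asymp"
begin

text \<open>
  Only the two-point function is needed: for real \<open>f\<close> supported at positive times, the expectation of
  \<open>\<Phi>(f) \<Phi>(\<theta> f)\<close>, where \<open>\<theta>\<close> is time reflection, is \<open>\<langle>\<theta> f, D f\<rangle>\<close> with \<open>D\<close> the integral of \<open>exp (- s H)\<close> over
  \<open>0 \<le> s \<le> \<lambda>\<close> and \<open>H = - \<Delta> + m\<^sup>2\<close>. In one dimension take \<open>f = H g\<close> with a bump \<open>g\<close> supported at strictly
  positive times. Then \<open>D f = g - exp (- \<lambda> H) g\<close>, and the first term does not contribute since the supports
  of \<open>\<theta> f\<close> and \<open>g\<close> are disjoint. What remains is \<open>- \<langle>\<theta> g, H exp (- \<lambda> H) g\<rangle>\<close>, which depends only on the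
  smooth kernel \<open>q\<close> of \<open>H exp (- \<lambda> H)\<close> near twice the position of the bump. On the line, \<open>q > 0\<close> near
  \<open>0\<close>. On a circle with smallest frequency \<open>p\<close>, the integral of \<open>q(z) (1 + cos (p z))\<close> is
  \<open>m\<^sup>2 + (m\<^sup>2 + p\<^sup>2) exp (- \<lambda> p\<^sup>2) > 0\<close>, up to the factor \<open>exp (- \<lambda> m\<^sup>2)\<close>, so \<open>q > 0\<close>
  somewhere, and the bump is put there.

  In higher dimension multiply the one-dimensional \<open>f\<close> by constants in the compact directions and by
  normalized Gaussians in the others. As the width of the Gaussians tends to infinity they become
  invariant under the heat flow, and the two-point function tends to a positive multiple of the
  one-dimensional one.
\<close>

section \<open>Functions of one coordinate\<close>

text \<open>Taking f = H g makes the integral over s telescope, and the minus sign in front of exp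
  (- \<lambda> H) is the source of the negative value. Time reflection turns pairings into
  convolutions: the pairing of the reflected f with exp (- s H) f is exp (- s m^2) times the mean of
  f * f under the normal law of variance 2 s. Everything thus becomes a statement about functions of
  one variable z, the sum of two times, and positivity of q near one point suffices: with g placed
  at half of that point, g * g is nonnegative and supported near it.

  On a circle the weight 1 + cos (p z) is nonnegative and has only the two lowest frequencies. The
  constant mode alone would yield m^2, which may vanish; the next mode adds a strictly positive
  term.

  Constants in the non-compact transverse directions would remove the transverse Laplacian, but they
  are not Schwartz functions. Gaussians replace them because their norms along the heat flow are
  explicit. Since moments are prescribed for one test function at a time, the pairing of f with its
  reflection is obtained by polarization.\<close>

definition cell1 :: "real option \<Rightarrow> real set" where
  "cell1 c = (case c of None \<Rightarrow> UNIV | Some l \<Rightarrow> {0..<l})"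

definition weight1 :: "real option \<Rightarrow> real \<Rightarrow> real" where
  "weight1 c x = (case c of None \<Rightarrow> 1 + x\<^sup>2 | Some l \<Rightarrow> 1)"

definition periodic1 :: "real option \<Rightarrow> (real \<Rightarrow> 'a) \<Rightarrow> bool" where
  "periodic1 c h \<longleftrightarrow> (\<forall>l x. c = Some l \<longrightarrow> h (x + l) = h x)"

text \<open>Kept apart from \<open>schwartz_family\<close>, which is also used with the degenerate
  circumference 0.\<close>

definition pos_circ :: "real option \<Rightarrow> bool" where
  "pos_circ c \<longleftrightarrow> (\<forall>l. c = Some l \<longrightarrow> 0 < l)"

text \<open>
  \<open>F\<close> is the sequence of derivatives of \<open>F 0\<close>. For \<open>c = Some 0\<close> both the periodicity and the weight are
  void, and the condition says that all derivatives are bounded.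
\<close>

definition schwartz_family :: "real option \<Rightarrow> (nat \<Rightarrow> real \<Rightarrow> real) \<Rightarrow> bool" where
  "schwartz_family c F \<longleftrightarrow> (\<forall>n x. (F n has_real_derivative F (Suc n) x) (at x)) \<and> (\<forall>n. periodic1 c (F n)) \<and>
     (\<forall>n k. \<exists>B. \<forall>x. weight1 c x ^ k * \<bar>F n x\<bar> \<le> B)"

abbreviation cint :: "real option \<Rightarrow> (real \<Rightarrow> real) \<Rightarrow> real" where
  "cint c h \<equiv> \<integral>t. indicator (cell1 c) t * h t \<partial>lborel"

lemma cell1_borel [measurable, simp]: "cell1 c \<in> sets borel"
  by (auto simp: cell1_def split: option.split)

lemma weight1_ge_1: "1 \<le> weight1 c x"
  by (auto simp: weight1_def split: option.split)

lemma weight1_minus [simp]: "weight1 c (- x) = weight1 c x"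
  by (auto simp: weight1_def split: option.split)

lemma periodic1_minus: "periodic1 c h \<Longrightarrow> periodic1 c (\<lambda>x. h (z - x))"
  unfolding periodic1_def by (metis add.commute add_diff_eq diff_add_cancel diff_diff_eq2)

lemma schwartz_family_deriv: "schwartz_family c F \<Longrightarrow> (F n has_real_derivative F (Suc n) x) (at x)"
  by (simp add: schwartz_family_def)

lemma schwartz_family_periodic1: "schwartz_family c F \<Longrightarrow> periodic1 c (F n)"
  by (simp add: schwartz_family_def)

lemma schwartz_family_decay:
  assumes "schwartz_family c F"
  obtains B where "0 \<le> B" "\<And>x. \<bar>F n x\<bar> \<le> B / weight1 c x ^ k"
proof -
  from assms obtain B where B: "\<And>x. weight1 c x ^ k * \<bar>F n x\<bar> \<le> B"
    unfolding schwartz_family_def by blast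
  have w: "0 < weight1 c x ^ k" for x
    using weight1_ge_1[of c x] by simp
  have "0 \<le> B"
    using B[of 0] w[of 0] by (smt (verit) zero_le_mult_iff)
  moreover have "\<bar>F n x\<bar> \<le> B / weight1 c x ^ k" for x
    using B[of x] w[of x] by (simp add: field_simps)
  ultimately show ?thesis using that by blast
qed

lemma schwartz_family_bounded:
  assumes "schwartz_family c F"
  obtains B where "0 \<le> B" "\<And>x. \<bar>F n x\<bar> \<le> B"
  using schwartz_family_decay[OF assms, of n 0] by auto

lemma schwartz_family_continuous: "schwartz_family c F \<Longrightarrow> continuous_on S (F n)"
  by (meson DERIV_isCont continuous_at_imp_continuous_on schwartz_family_deriv)

lemma schwartz_family_measurable: "schwartz_family c F \<Longrightarrow> F n \<in> borel_measurable borel"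
  by (intro borel_measurable_continuous_onI schwartz_family_continuous)

lemma schwartz_family_shift: "schwartz_family c F \<Longrightarrow> schwartz_family c (\<lambda>n. F (n + k))"
  by (simp add: schwartz_family_def)

lemma schwartz_family_lincomb:
  assumes F: "schwartz_family c F" and G: "schwartz_family c G"
  shows "schwartz_family c (\<lambda>n x. a * F n x + b * G n x)"
  unfolding schwartz_family_def
proof (intro conjI allI)
  fix n x
  show "((\<lambda>x. a * F n x + b * G n x) has_real_derivative a * F (Suc n) x + b * G (Suc n) x) (at x)"
    by (intro DERIV_add DERIV_cmult schwartz_family_deriv[OF F] schwartz_family_deriv[OF G])
next
  fix n show "periodic1 c (\<lambda>x. a * F n x + b * G n x)"
    using schwartz_family_periodic1[OF F, of n] schwartz_family_periodic1[OF G, of n] by (simp add: periodic1_def)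
next
  fix n k
  obtain B where B: "\<And>x. \<bar>F n x\<bar> \<le> B / weight1 c x ^ k" by (metis schwartz_family_decay[OF F])
  obtain D where D: "\<And>x. \<bar>G n x\<bar> \<le> D / weight1 c x ^ k" by (metis schwartz_family_decay[OF G])
  have "weight1 c x ^ k * \<bar>a * F n x + b * G n x\<bar> \<le> \<bar>a\<bar> * B + \<bar>b\<bar> * D" for x
  proof -
    have w: "0 < weight1 c x ^ k" using weight1_ge_1[of c x] by simp
    have "\<bar>a * F n x + b * G n x\<bar> \<le> \<bar>a\<bar> * \<bar>F n x\<bar> + \<bar>b\<bar> * \<bar>G n x\<bar>"
      by (metis abs_mult abs_triangle_ineq)
    also have "\<dots> \<le> \<bar>a\<bar> * (B / weight1 c x ^ k) + \<bar>b\<bar> * (D / weight1 c x ^ k)"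
      by (intro add_mono mult_left_mono B D) auto
    also have "\<dots> = (\<bar>a\<bar> * B + \<bar>b\<bar> * D) / weight1 c x ^ k"
      by (simp add: add_divide_distrib)
    finally show ?thesis using w by (simp add: pos_le_divide_eq mult.commute)
  qed
  then show "\<exists>B. \<forall>x. weight1 c x ^ k * \<bar>a * F n x + b * G n x\<bar> \<le> B" by blast
qed

lemma schwartz_family_reflect:
  assumes F: "schwartz_family c F"
  shows "schwartz_family c (\<lambda>n x. (- 1) ^ n * F n (- x))"
  unfolding schwartz_family_def
proof (intro conjI allI)
  fix n x
  have "((\<lambda>x. F n (- x)) has_real_derivative F (Suc n) (- x) * (- 1)) (at x)"
    by (rule DERIV_chain2[OF schwartz_family_deriv[OF F]]) (auto intro!: derivative_eq_intros)
  from DERIV_cmult[OF this, of "(- 1) ^ n"]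
  show "((\<lambda>x. (- 1) ^ n * F n (- x)) has_real_derivative (- 1) ^ Suc n * F (Suc n) (- x)) (at x)"
    by (simp add: mult.commute)
next
  fix n show "periodic1 c (\<lambda>x. (- 1) ^ n * F n (- x))"
    using periodic1_minus[OF schwartz_family_periodic1[OF F, of n], of 0] by (simp add: periodic1_def)
next
  fix n k
  obtain B where B: "\<And>x. weight1 c x ^ k * \<bar>F n x\<bar> \<le> B" using F unfolding schwartz_family_def by blast
  have "weight1 c x ^ k * \<bar>(- 1) ^ n * F n (- x)\<bar> \<le> B" for x
    using B[of "- x"] by (simp add: abs_mult power_abs)
  then show "\<exists>B. \<forall>x. weight1 c x ^ k * \<bar>(- 1) ^ n * F n (- x)\<bar> \<le> B" by blast
qed

lemma integrable_inverse_weight1: "integrable lborel (\<lambda>x. indicator (cell1 c) x / weight1 c x)"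
proof (cases c)
  case None
  have "integrable lborel (\<lambda>x::real. 1 / (1 + x\<^sup>2))"
    using integrable_inverse_1_plus_square by (simp add: set_integrable_def inverse_eq_divide)
  then show ?thesis using None by (simp add: cell1_def weight1_def)
next
  case (Some l)
  have "emeasure lborel {0..<l} < \<infinity>"
    by (cases "0 \<le> l") auto
  then show ?thesis using Some by (simp add: cell1_def weight1_def integrable_indicator_iff)
qed

lemma integrable_cell:
  assumes [measurable]: "h \<in> borel_measurable borel" and "\<And>x. \<bar>h x\<bar> \<le> B / weight1 c x"
  shows "integrable lborel (\<lambda>x. indicator (cell1 c) x * h x)"
proof (rule Bochner_Integration.integrable_bound)
  show "integrable lborel (\<lambda>x. B * (indicator (cell1 c) x / weight1 c x))"
    by (intro integrable_mult_right integrable_inverse_weight1)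
  show "AE x in lborel. norm (indicator (cell1 c) x * h x) \<le> norm (B * (indicator (cell1 c) x / weight1 c x))"
  proof (rule AE_I2)
    fix x
    show "norm (indicator (cell1 c) x * h x) \<le> norm (B * (indicator (cell1 c) x / weight1 c x))"
      using order_trans[OF assms(2)[of x] abs_ge_self] by (simp add: indicator_def)
  qed
qed simp

lemma integrable_cell_schwartz_family:
  assumes "schwartz_family c F" shows "integrable lborel (\<lambda>x. indicator (cell1 c) x * F n x)"
proof -
  obtain B where "\<And>x. \<bar>F n x\<bar> \<le> B / weight1 c x ^ 1" by (metis schwartz_family_decay[OF assms])
  then show ?thesis by (intro integrable_cell[of _ B] schwartz_family_measurable[OF assms]) auto
qed

lemma integrable_cell_schwartz_family_mult:
  assumes F: "schwartz_family c F" and [measurable]: "h \<in> borel_measurable borel" and h: "\<And>x. \<bar>h x\<bar> \<le> B"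
  shows "integrable lborel (\<lambda>x. indicator (cell1 c) x * (F n x * h x))"
proof -
  obtain D where D: "\<And>x. \<bar>F n x\<bar> \<le> D / weight1 c x ^ 1" by (metis schwartz_family_decay[OF F])
  note [measurable] = schwartz_family_measurable[OF F]
  have "\<bar>F n x * h x\<bar> \<le> D * B / weight1 c x" for x
  proof -
    have "\<bar>F n x * h x\<bar> \<le> (D / weight1 c x) * B"
      unfolding abs_mult using D[of x] h[of x] by (intro mult_mono) auto
    then show ?thesis by simp
  qed
  then show ?thesis by (intro integrable_cell) auto
qed

lemma cint_Some:
  assumes "continuous_on UNIV h" "0 < l"
  shows "cint (Some l) h = integral {0..l} h"
proof -
  have "set_integrable lborel {0..l} h"
    using assms by (intro borel_integrable_atLeastAtMost') (auto intro: continuous_on_subset)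
  then have "(LINT t:{0..l}|lborel. h t) = integral {0..l} h"
    by (intro set_borel_integral_eq_integral)
  moreover have "cint (Some l) h = (LINT t:{0..l}|lborel. h t)"
    unfolding set_lebesgue_integral_def
  proof (rule integral_cong_AE)
    have [measurable]: "h \<in> borel_measurable borel"
      using assms by (intro borel_measurable_continuous_onI)
    show "(\<lambda>x. indicator (cell1 (Some l)) x * h x) \<in> borel_measurable lborel"
      "(\<lambda>x. indicator {0..l} x *\<^sub>R h x) \<in> borel_measurable lborel"
      by simp_all
    show "AE x in lborel. indicator (cell1 (Some l)) x * h x = indicator {0..l} x *\<^sub>R h x"
      using AE_lborel_singleton[of l] by eventually_elim (auto simp: cell1_def indicator_def)
  qed
  ultimately show ?thesis by simp
qed

text \<open>On a circle both integrals are increments of an antiderivative of h over an interval of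
  length l, and such increments do not depend on the base point because h is periodic.\<close>

lemma cint_shift:
  assumes c: "pos_circ c" and h: "continuous_on UNIV h" and periodic1: "periodic1 c h"
  shows "cint c (\<lambda>t. h (x + t)) = cint c h" and "cint c (\<lambda>t. h (x - t)) = cint c h"
proof -
  have "cint c (\<lambda>t. h (x + t)) = cint c h \<and> cint c (\<lambda>t. h (x - t)) = cint c h"
  proof (cases c)
    case None
    show ?thesis
      using lborel_integral_real_affine[of 1 h x] lborel_integral_real_affine[of "- 1" h x] None
      by (simp add: cell1_def)
  next
    case (Some l)
    then have l: "0 < l" using c by (simp add: pos_circ_def)
    obtain F where F: "\<And>y. (F has_real_derivative h y) (at y)"
    proof -
      have "\<And>y. isCont h y" using h continuous_on_eq_continuous_at by blast
      then obtain F where "\<forall>y. - \<infinity> < ereal y \<longrightarrow> ereal y < \<infinity> \<longrightarrow> (F has_vector_derivative h y) (at y)"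
        using einterval_antiderivative[of "- \<infinity>" "\<infinity>" h] by auto
      with that[of F] show ?thesis by (simp add: has_real_derivative_iff_has_vector_derivative)
    qed
    have 1: "continuous_on UNIV (\<lambda>t. h (x + t))" "continuous_on UNIV (\<lambda>t. h (x - t))"
      by (rule continuous_on_compose2[OF h]; auto intro!: continuous_intros)+
    have der: "((\<lambda>y. F (y + l) - F y) has_real_derivative 0) (at y)" for y
    proof -
      have "((\<lambda>y. F (y + l)) has_real_derivative h (y + l) * 1) (at y)"
        by (rule DERIV_chain2[OF F]) (auto intro!: derivative_eq_intros)
      from DERIV_diff[OF this F[of y]] show ?thesis
        using periodic1 Some by (simp add: periodic1_def)
    qed
    have const: "F (y + l) - F y = F l - F 0" for y
      using DERIV_isconst_all[of "\<lambda>y. F (y + l) - F y" y 0] der by simp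
    have d1: "((\<lambda>t. F (x + t)) has_real_derivative h (x + t) * 1) (at t within {0..l})" for t
      by (rule has_field_derivative_at_within, rule DERIV_chain2[OF F]) (auto intro!: derivative_eq_intros)
    have d2: "((\<lambda>t. - F (x - t)) has_real_derivative - (h (x - t) * (- 1))) (at t within {0..l})" for t
      by (rule has_field_derivative_at_within, rule DERIV_minus, rule DERIV_chain2[OF F])
        (auto intro!: derivative_eq_intros)
    have FTC: "(k has_integral K l - K 0) {0..l}"
      if "\<And>t. (K has_real_derivative k t) (at t within {0..l})" for K k :: "real \<Rightarrow> real"
      using that l by (intro fundamental_theorem_of_calculus)
        (auto simp: has_real_derivative_iff_has_vector_derivative)
    have "((\<lambda>t. h (x + t)) has_integral F (x + l) - F (x + 0)) {0..l}"
      using FTC[OF d1] by simp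
    moreover have "((\<lambda>t. h (x - t)) has_integral - F (x - l) - - F (x - 0)) {0..l}"
      using FTC[OF d2] by simp
    moreover have "(h has_integral F l - F 0) {0..l}"
      by (rule FTC[OF has_field_derivative_at_within[OF F]])
    ultimately have "integral {0..l} (\<lambda>t. h (x + t)) = integral {0..l} h"
      "integral {0..l} (\<lambda>t. h (x - t)) = integral {0..l} h"
      using const[of x] const[of "x - l"] by (auto dest!: integral_unique)
    then show ?thesis
      using cint_Some[OF 1(1) l] cint_Some[OF 1(2) l] cint_Some[OF h l] Some by metis
  qed
  then show "cint c (\<lambda>t. h (x + t)) = cint c h" and "cint c (\<lambda>t. h (x - t)) = cint c h" by auto
qed

section \<open>Differentiation under the integral and vanishing boundary terms\<close>

lemma has_real_derivative_integral:
  fixes f :: "real \<Rightarrow> 'a \<Rightarrow> real"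
  assumes der: "\<And>z t. ((\<lambda>z. f z t) has_real_derivative f' z t) (at z)"
    and int: "\<And>z. integrable M (f z)" and g: "integrable M g"
    and bound: "\<And>z t. \<bar>f' z t\<bar> \<le> g t"
    and [measurable]: "\<And>z. f' z \<in> borel_measurable M"
  shows "((\<lambda>z. \<integral>t. f z t \<partial>M) has_real_derivative (\<integral>t. f' z t \<partial>M)) (at z)"
  unfolding DERIV_def tendsto_at_iff_sequentially comp_def
proof (intro allI impI)
  fix X :: "nat \<Rightarrow> real" assume X: "\<forall>i. X i \<in> UNIV - {0}" "X \<longlonglongrightarrow> 0"
  note [measurable] = borel_measurable_integrable[OF int] borel_measurable_integrable[OF g]
  have "(\<lambda>n. \<integral>t. (f (z + X n) t - f z t) / X n \<partial>M) \<longlonglongrightarrow> (\<integral>t. f' z t \<partial>M)"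
  proof (rule integral_dominated_convergence[where w = g])
    show "AE t in M. (\<lambda>n. (f (z + X n) t - f z t) / X n) \<longlonglongrightarrow> f' z t"
      using der[of _ z] X unfolding DERIV_def tendsto_at_iff_sequentially comp_def by auto
    show "AE t in M. norm ((f (z + X n) t - f z t) / X n) \<le> g t" for n
    proof (rule AE_I2)
      fix t
      have "norm (f (z + X n) t - f z t) \<le> g t * norm (z + X n - z)"
        by (rule field_differentiable_bound[of UNIV "\<lambda>z. f z t" "\<lambda>z. f' z t"])
           (use der bound in \<open>auto intro: has_field_derivative_at_within\<close>)
      then show "norm ((f (z + X n) t - f z t) / X n) \<le> g t"
        using X(1) by (simp add: field_simps)
    qed
  qed (use g in auto)
  moreover have "(\<integral>t. (f (z + X n) t - f z t) / X n \<partial>M)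
      = ((\<integral>t. f (z + X n) t \<partial>M) - (\<integral>t. f z t \<partial>M)) / X n" for n
    unfolding integral_divide_zero Bochner_Integration.integral_diff[OF int int] ..
  ultimately show "(\<lambda>n. ((\<integral>t. f (z + X n) t \<partial>M) - (\<integral>t. f z t \<partial>M)) / X n) \<longlonglongrightarrow> (\<integral>t. f' z t \<partial>M)"
    by (simp only:)
qed

text \<open>The source of every integration by parts below: it is applied to products of a Gaussian
  density with bounded functions, possibly with a linear factor.\<close>

lemma integral_derivative_eq_0:
  fixes F \<phi> :: "real \<Rightarrow> real"
  assumes "\<And>x. (F has_real_derivative \<phi> x) (at x)" "continuous_on UNIV \<phi>" "integrable lborel \<phi>"
    and "(F \<longlongrightarrow> 0) at_top" "(F \<longlongrightarrow> 0) at_bot"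
  shows "(\<integral>x. \<phi> x \<partial>lborel) = 0"
proof -
  have "(LBINT x=-\<infinity>..\<infinity>. \<phi> x) = 0 - 0"
    using assms by (intro interval_integral_FTC_integrable[of _ _ F])
      (auto simp: has_real_derivative_iff_has_vector_derivative set_integrable_def
         continuous_on_eq_continuous_at ereal_tendsto_simps)
  then show ?thesis
    by (simp add: interval_lebesgue_integral_def set_lebesgue_integral_def)
qed

section \<open>The heat flow in one coordinate\<close>

text \<open>The form that a pairing takes when one partner is time-reflected:
  \<open>conv c a a 0\<close> is the integral of a(t) a(- t) over the line or the circle.\<close>

definition conv :: "real option \<Rightarrow> (real \<Rightarrow> real) \<Rightarrow> (real \<Rightarrow> real) \<Rightarrow> real \<Rightarrow> real" where
  "conv c a b z = cint c (\<lambda>t. a t * b (z - t))"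

text \<open>The heat flow of h at time r^2 / 2, evaluated at 0. The density is fixed and r scales
  the argument, so that differentiation in r falls on h and r = 0 needs no separate case.\<close>

definition gauss_mean :: "real \<Rightarrow> (real \<Rightarrow> real) \<Rightarrow> real" where
  "gauss_mean r h = (\<integral>z. std_normal_density z * h (r * z) \<partial>lborel)"

text \<open>The factor of \<open>heat\<close> that belongs to one coordinate, without the
  mass.\<close>

definition heat1 :: "real \<Rightarrow> (real \<Rightarrow> real) \<Rightarrow> real \<Rightarrow> real" where
  "heat1 \<tau> f x = (if \<tau> = 0 then f x
     else \<integral>s. normal_density 0 (sqrt (2 * \<tau>)) (x - s) * f s \<partial>lborel)"

text \<open>Substitution of z - t for t, legitimate on the circle by \<open>cint_shift\<close>.
  Derivatives of a convolution are always put on its second factor; commuting makes the first one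
  accessible.\<close>

lemma conv_commute:
  assumes c: "pos_circ c" and F: "schwartz_family c F" and G: "schwartz_family c G"
  shows "conv c (F i) (G j) = conv c (G j) (F i)"
proof
  fix z
  have "continuous_on UNIV (\<lambda>t. F i t * G j (z - t))"
    by (intro continuous_intros schwartz_family_continuous[OF F] continuous_on_compose2[OF schwartz_family_continuous[OF G, of UNIV]]) auto
  moreover have "periodic1 c (\<lambda>t. F i t * G j (z - t))"
    using schwartz_family_periodic1[OF F, of i] periodic1_minus[OF schwartz_family_periodic1[OF G, of j], of z] by (auto simp: periodic1_def)
  ultimately show "conv c (F i) (G j) z = conv c (G j) (F i) z"
    using cint_shift(2)[OF c, of "\<lambda>t. F i t * G j (z - t)" z] by (simp add: conv_def mult.commute)
qed

text \<open>The derivatives pass under the integral onto the second factor. The index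
  \<open>Some 0\<close> retains only that all of them are bounded, which is what Gaussian means
  require.\<close>

lemma schwartz_family_conv:
  assumes F: "schwartz_family c F" and G: "schwartz_family c G"
  shows "schwartz_family (Some 0) (\<lambda>n. conv c (F i) (G n))"
  unfolding schwartz_family_def
proof (intro conjI allI)
  note [measurable] = schwartz_family_measurable[OF F] schwartz_family_measurable[OF G]
  have int: "integrable lborel (\<lambda>t. indicator (cell1 c) t * (F i t * G n (z - t)))" for n z
    by (rule schwartz_family_bounded[OF G, of n]) (rule integrable_cell_schwartz_family_mult[OF F], auto)
  fix n
  obtain B where B: "0 \<le> B" "\<And>x. \<bar>G (Suc n) x\<bar> \<le> B" by (metis schwartz_family_bounded[OF G])
  fix z
  have "((\<lambda>z. \<integral>t. indicator (cell1 c) t * (F i t * G n (z - t)) \<partial>lborel) has_real_derivative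
      (\<integral>t. indicator (cell1 c) t * (F i t * G (Suc n) (z - t)) \<partial>lborel)) (at z)"
  proof (rule has_real_derivative_integral)
    fix z t
    have "((\<lambda>z. G n (z - t)) has_real_derivative G (Suc n) (z - t) * 1) (at z)"
      by (rule DERIV_chain2[OF schwartz_family_deriv[OF G]]) (auto intro!: derivative_eq_intros)
    from DERIV_cmult[OF this, of "indicator (cell1 c) t * F i t"]
    show "((\<lambda>z. indicator (cell1 c) t * (F i t * G n (z - t))) has_real_derivative
        indicator (cell1 c) t * (F i t * G (Suc n) (z - t))) (at z)"
      by (simp add: mult.assoc)
    show "\<bar>indicator (cell1 c) t * (F i t * G (Suc n) (z - t))\<bar> \<le> B * \<bar>indicator (cell1 c) t * F i t\<bar>"
      using mult_left_mono[OF B(2)[of "z - t"], of "\<bar>F i t\<bar>"]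
      by (auto simp: indicator_def abs_mult mult.commute)
  qed (use int integrable_cell_schwartz_family[OF F, of i] in auto)
  then show "((conv c (F i) (G n)) has_real_derivative conv c (F i) (G (Suc n)) z) (at z)"
    unfolding conv_def .
next
  fix n show "periodic1 (Some 0) (conv c (F i) (G n))" by (simp add: periodic1_def)
next
  fix n k
  note [measurable] = schwartz_family_measurable[OF F] schwartz_family_measurable[OF G]
  obtain B where B: "0 \<le> B" "\<And>x. \<bar>G n x\<bar> \<le> B" by (metis schwartz_family_bounded[OF G])
  have "\<bar>conv c (F i) (G n) z\<bar> \<le> (\<integral>t. B * \<bar>indicator (cell1 c) t * F i t\<bar> \<partial>lborel)" for z
    unfolding conv_def
  proof (rule order_trans[OF integral_abs_bound integral_mono])
    show "integrable lborel (\<lambda>t. \<bar>indicator (cell1 c) t * (F i t * G n (z - t))\<bar>)"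
      by (intro integrable_abs integrable_cell_schwartz_family_mult[OF F]) (use B in auto)
    show "integrable lborel (\<lambda>t. B * \<bar>indicator (cell1 c) t * F i t\<bar>)"
      using integrable_cell_schwartz_family[OF F, of i] by auto
    show "\<bar>indicator (cell1 c) t * (F i t * G n (z - t))\<bar> \<le> B * \<bar>indicator (cell1 c) t * F i t\<bar>" for t
      using mult_left_mono[OF B(2)[of "z - t"], of "\<bar>F i t\<bar>"]
      by (auto simp: indicator_def abs_mult mult.commute)
  qed
  then show "\<exists>B. \<forall>z. weight1 (Some 0) z ^ k * \<bar>conv c (F i) (G n) z\<bar> \<le> B"
    by (auto simp: weight1_def)
qed

lemma conv_lincomb:
  assumes F: "schwartz_family c F" and G: "schwartz_family c G"
  shows "conv c (F i) (\<lambda>x. a * G j x + b * G k x) z = a * conv c (F i) (G j) z + b * conv c (F i) (G k) z"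
proof -
  note [measurable] = schwartz_family_measurable[OF F] schwartz_family_measurable[OF G]
  have int: "integrable lborel (\<lambda>t. indicator (cell1 c) t * (F i t * G n (z - t)))" for n z
    by (rule schwartz_family_bounded[OF G, of n]) (rule integrable_cell_schwartz_family_mult[OF F], auto)
  have "conv c (F i) (\<lambda>x. a * G j x + b * G k x) z
      = (\<integral>t. a * (indicator (cell1 c) t * (F i t * G j (z - t)))
            + b * (indicator (cell1 c) t * (F i t * G k (z - t))) \<partial>lborel)"
    unfolding conv_def by (intro Bochner_Integration.integral_cong) (auto simp: algebra_simps)
  also have "\<dots> = a * conv c (F i) (G j) z + b * conv c (F i) (G k) z"
    unfolding conv_def
    by (subst Bochner_Integration.integral_add) (auto intro!: int)
  finally show ?thesis .
qed

section \<open>Gaussian means and the heat equation\<close>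

lemma gauss_mean_eq_normal:
  assumes "0 < r"
  shows "gauss_mean r h = (\<integral>z. normal_density 0 r z * h z \<partial>lborel)"
proof -
  have *: "r * (normal_density 0 r (r * z) * h (r * z)) = std_normal_density z * h (r * z)" for z
    using assms by (simp add: normal_density_def real_sqrt_mult power_mult_distrib field_simps)
  have "gauss_mean r h = (\<integral>z. r * (normal_density 0 r (r * z) * h (r * z)) \<partial>lborel)"
    by (simp only: gauss_mean_def *)
  also have "\<dots> = r * (\<integral>z. normal_density 0 r (r * z) * h (r * z) \<partial>lborel)"
    by (rule integral_mult_right_zero)
  also have "\<dots> = (\<integral>z. normal_density 0 r z * h z \<partial>lborel)"
    using lborel_integral_real_affine[of r "\<lambda>z. normal_density 0 r z * h z" 0] assms by simp
  finally show ?thesis .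
qed

lemma integrable_normal_mult:
  assumes "0 < r" and [measurable]: "h \<in> borel_measurable borel" and "\<And>x. \<bar>h x\<bar> \<le> B"
  shows "integrable lborel (\<lambda>z. normal_density 0 r z * h z)"
proof (rule Bochner_Integration.integrable_bound)
  show "integrable lborel (\<lambda>z. B * normal_density 0 r z)"
    using integrable_normal_density[OF assms(1)] by simp
  show "AE x in lborel. norm (normal_density 0 r x * h x) \<le> norm (B * normal_density 0 r x)"
  proof (rule AE_I2)
    fix x
    show "norm (normal_density 0 r x * h x) \<le> norm (B * normal_density 0 r x)"
      using order_trans[OF assms(3)[of x] abs_ge_self]
      by (simp add: abs_mult mult.commute mult_right_mono)
  qed
qed simp

lemma gauss_mean_const: "gauss_mean r (\<lambda>_. a) = a"
  by (simp add: gauss_mean_def integral_normal_density)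

lemma gauss_mean_0: "gauss_mean 0 h = h 0"
  by (simp add: gauss_mean_def integral_normal_density)

lemma std_normal_tendsto_0:
  assumes "\<And>x. \<bar>h x\<bar> \<le> B"
  shows "((\<lambda>x. std_normal_density x * h x) \<longlongrightarrow> 0) at_top" "((\<lambda>x. std_normal_density x * h x) \<longlongrightarrow> 0) at_bot"
proof -
  have 1: "((\<lambda>x. B * std_normal_density x) \<longlongrightarrow> 0) at_top" "((\<lambda>x. B * std_normal_density x) \<longlongrightarrow> 0) at_bot"
    unfolding normal_density_def by real_asymp+
  have 2: "norm (std_normal_density x * h x) \<le> B * std_normal_density x" for x
    using assms[of x] by (simp add: abs_mult mult.commute mult_right_mono)
  show "((\<lambda>x. std_normal_density x * h x) \<longlongrightarrow> 0) at_top" "((\<lambda>x. std_normal_density x * h x) \<longlongrightarrow> 0) at_bot"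
    by (rule Lim_null_comparison[OF always_eventually[OF allI[OF 2]]] 1)+
qed

lemma std_normal_deriv: "(std_normal_density has_real_derivative - (z * std_normal_density z)) (at z)"
  unfolding normal_density_def by (auto intro!: derivative_eq_intros simp: field_simps power2_eq_square)

text \<open>Differentiation under the integral gives the mean of Z F'(r Z) for a standard normal Z,
  and Gaussian integration by parts replaces the factor Z by r times one more derivative. In the
  variable s = r^2 / 2 this is the heat equation.\<close>

lemma gauss_mean_deriv:
  assumes F: "schwartz_family c F"
  shows "((\<lambda>r. gauss_mean r (F n)) has_real_derivative r * gauss_mean r (F (Suc (Suc n)))) (at r)"
proof -
  note [measurable] = schwartz_family_measurable[OF F]
  have int: "integrable lborel (\<lambda>z. std_normal_density z * F n (r * z))" for n r
    by (rule schwartz_family_bounded[OF F, of n]) (auto intro!: integrable_normal_mult)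
  have m1: "integrable lborel (\<lambda>z. \<bar>std_normal_density z * z\<bar>)"
    using integrable_std_normal_moment[of 1] by (intro integrable_abs) simp
  obtain B where B: "0 \<le> B" "\<And>x. \<bar>F (Suc n) x\<bar> \<le> B" by (metis schwartz_family_bounded[OF F])
  have bd: "\<bar>std_normal_density z * (z * F (Suc n) (r * z))\<bar> \<le> B * \<bar>std_normal_density z * z\<bar>" for r z
    using mult_left_mono[OF B(2)[of "r * z"], of "\<bar>std_normal_density z * z\<bar>"]
    by (simp add: abs_mult mult_ac)
  have der: "((\<lambda>r. gauss_mean r (F n)) has_real_derivative
      (\<integral>z. std_normal_density z * (z * F (Suc n) (r * z)) \<partial>lborel)) (at r)"
    unfolding gauss_mean_def
  proof (rule has_real_derivative_integral)
    fix r z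
    have "((\<lambda>r. F n (r * z)) has_real_derivative F (Suc n) (r * z) * z) (at r)"
      by (rule DERIV_chain2[OF schwartz_family_deriv[OF F]]) (auto intro!: derivative_eq_intros)
    from DERIV_cmult[OF this, of "std_normal_density z"]
    show "((\<lambda>r. std_normal_density z * F n (r * z)) has_real_derivative
        std_normal_density z * (z * F (Suc n) (r * z))) (at r)" by (simp add: mult.commute)
    show "\<bar>std_normal_density z * (z * F (Suc n) (r * z))\<bar> \<le> B * \<bar>std_normal_density z * z\<bar>"
      by (rule bd)
  qed (use int m1 in auto)
  have int1: "integrable lborel (\<lambda>z. std_normal_density z * (z * F (Suc n) (r * z)))"
    by (rule Bochner_Integration.integrable_bound[OF integrable_mult_right[OF m1, of B]])
       (use bd in \<open>auto intro: order_trans[OF _ abs_ge_self]\<close>)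
  have "(\<integral>z. std_normal_density z * (r * F (Suc (Suc n)) (r * z))
      - std_normal_density z * (z * F (Suc n) (r * z)) \<partial>lborel) = 0"
  proof (rule integral_derivative_eq_0)
    fix z
    have "((\<lambda>z. F (Suc n) (r * z)) has_real_derivative F (Suc (Suc n)) (r * z) * r) (at z)"
      by (rule DERIV_chain2[OF schwartz_family_deriv[OF F]]) (auto intro!: derivative_eq_intros)
    from DERIV_mult[OF std_normal_deriv this]
    show "((\<lambda>z. std_normal_density z * F (Suc n) (r * z)) has_real_derivative
        std_normal_density z * (r * F (Suc (Suc n)) (r * z))
          - std_normal_density z * (z * F (Suc n) (r * z))) (at z)"
      by (simp add: algebra_simps)
  next
    show "continuous_on UNIV (\<lambda>z. std_normal_density z * (r * F (Suc (Suc n)) (r * z))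
      - std_normal_density z * (z * F (Suc n) (r * z)))"
      unfolding normal_density_def
      by (intro continuous_intros continuous_on_compose2[OF schwartz_family_continuous[OF F, of UNIV]]) auto
    show "integrable lborel (\<lambda>z. std_normal_density z * (r * F (Suc (Suc n)) (r * z))
      - std_normal_density z * (z * F (Suc n) (r * z)))"
      using integrable_mult_right[OF int[of "Suc (Suc n)" r], of r] int1
      by (intro Bochner_Integration.integrable_diff) (auto simp: mult_ac)
  qed (use B in \<open>auto intro!: std_normal_tendsto_0\<close>)
  moreover have "(\<integral>z. std_normal_density z * (r * F (Suc (Suc n)) (r * z))
      - std_normal_density z * (z * F (Suc n) (r * z)) \<partial>lborel)
      = r * gauss_mean r (F (Suc (Suc n))) - (\<integral>z. std_normal_density z * (z * F (Suc n) (r * z)) \<partial>lborel)"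
    unfolding gauss_mean_def
    using integrable_mult_right[OF int[of "Suc (Suc n)" r], of r] int1
    by (subst Bochner_Integration.integral_diff) (auto simp: mult.left_commute[of _ r])
  ultimately show ?thesis using der by simp
qed

lemma gauss_mean_continuous: "schwartz_family c F \<Longrightarrow> continuous_on S (\<lambda>r. gauss_mean r (F n))"
  by (rule continuous_at_imp_continuous_on) (blast intro: DERIV_isCont gauss_mean_deriv)

lemma gauss_mean_heat_eq:
  assumes F: "schwartz_family c F" and s: "0 < s"
  shows "((\<lambda>s. gauss_mean (sqrt (2 * s)) (F n)) has_real_derivative
     gauss_mean (sqrt (2 * s)) (F (Suc (Suc n)))) (at s)"
proof -
  have "((\<lambda>s. sqrt (2 * s)) has_real_derivative 1 / sqrt (2 * s)) (at s)"
    using s by (auto intro!: derivative_eq_intros simp: field_simps)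
  from DERIV_chain2[OF gauss_mean_deriv[OF F, of n] this] show ?thesis
    using s by simp
qed

lemma gauss_mean_lincomb:
  assumes F: "schwartz_family c F"
  shows "gauss_mean r (\<lambda>x. a * F i x + b * F j x) = a * gauss_mean r (F i) + b * gauss_mean r (F j)"
proof -
  note [measurable] = schwartz_family_measurable[OF F]
  have int: "integrable lborel (\<lambda>z. std_normal_density z * F n (r * z))" for n
    by (rule schwartz_family_bounded[OF F, of n]) (auto intro!: integrable_normal_mult)
  have "gauss_mean r (\<lambda>x. a * F i x + b * F j x) = (\<integral>z. a * (std_normal_density z * F i (r * z))
     + b * (std_normal_density z * F j (r * z)) \<partial>lborel)"
    unfolding gauss_mean_def by (intro Bochner_Integration.integral_cong) (auto simp: algebra_simps)
  also have "\<dots> = a * gauss_mean r (F i) + b * gauss_mean r (F j)"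
    unfolding gauss_mean_def by (subst Bochner_Integration.integral_add) (auto intro!: int)
  finally show ?thesis .
qed

text \<open>The integrand is minus the s-derivative of exp (- s m^2) times the mean of
  \<open>F 0\<close>, by the heat equation. This is the identity D H = 1 - exp (- \<lambda> H),
  evaluated at 0.\<close>

lemma integral_heat_flow:
  assumes F: "schwartz_family c F" and lam: "0 < lam"
  shows "(\<integral>s. indicator {0..lam} s * (exp (- s * m\<^sup>2) *
       gauss_mean (sqrt (2 * s)) (\<lambda>x. m\<^sup>2 * F 0 x + (- 1) * F 2 x)) \<partial>lborel)
     = F 0 0 - exp (- lam * m\<^sup>2) * gauss_mean (sqrt (2 * lam)) (F 0)"
proof -
  let ?M = "\<lambda>n s. gauss_mean (sqrt (2 * s)) (F n)"
  let ?v = "\<lambda>s. exp (- s * m\<^sup>2) * (m\<^sup>2 * ?M 0 s - ?M 2 s)"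
  have cont: "continuous_on S (?M n)" for n S
    by (rule continuous_on_compose2[OF gauss_mean_continuous[OF F, of UNIV]])
       (auto intro!: continuous_intros)
  \<comment> \<open>Only interior points are differentiated: sqrt (2 s) has no derivative at s = 0,
    but the primitive is continuous there.\<close>
  have "((\<lambda>s. ?v s) has_integral (- (exp (- lam * m\<^sup>2) * ?M 0 lam)) - (- (exp (- 0 * m\<^sup>2) * ?M 0 0))) {0..lam}"
  proof (rule fundamental_theorem_of_calculus_interior)
    show "continuous_on {0..lam} (\<lambda>s. - (exp (- s * m\<^sup>2) * ?M 0 s))"
      by (intro continuous_intros cont)
    fix s assume "s \<in> {0<..<lam}"
    then have "((\<lambda>s. ?M 0 s) has_real_derivative ?M 2 s) (at s)"
      using gauss_mean_heat_eq[OF F, of s 0] by (simp add: numeral_2_eq_2)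
    moreover have "((\<lambda>s. exp (- s * m\<^sup>2)) has_real_derivative - (m\<^sup>2) * exp (- s * m\<^sup>2)) (at s)"
      by (auto intro!: derivative_eq_intros)
    ultimately have "((\<lambda>s. - (exp (- s * m\<^sup>2) * ?M 0 s)) has_real_derivative
        - (- (m\<^sup>2) * exp (- s * m\<^sup>2) * ?M 0 s + ?M 2 s * exp (- s * m\<^sup>2))) (at s)"
      by (intro DERIV_minus DERIV_mult)
    then show "((\<lambda>s. - (exp (- s * m\<^sup>2) * ?M 0 s)) has_vector_derivative ?v s) (at s)"
      by (simp add: has_real_derivative_iff_has_vector_derivative[symmetric] algebra_simps)
  qed (use lam in auto)
  then have "integral {0..lam} ?v = F 0 0 - exp (- lam * m\<^sup>2) * ?M 0 lam"
    by (simp add: integral_unique gauss_mean_0)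
  moreover have "set_integrable lborel {0..lam} ?v"
    by (intro borel_integrable_atLeastAtMost' continuous_intros cont)
  then have "(LINT s:{0..lam}|lborel. ?v s) = integral {0..lam} ?v"
    by (intro set_borel_integral_eq_integral)
  ultimately show ?thesis
    unfolding gauss_mean_lincomb[OF F] by (simp add: set_lebesgue_integral_def)
qed

text \<open>Two integrations by parts move the operator from F to the normal density N; the
  polynomial factor comes from N'' = (z^2 / r^4 - 1 / r^2) N.\<close>

lemma gauss_mean_by_parts:
  assumes F: "schwartz_family c F" and r: "0 < r"
  shows "gauss_mean r (\<lambda>x. m\<^sup>2 * F 0 x + (- 1) * F 2 x)
     = (\<integral>z. (m\<^sup>2 + 1 / r\<^sup>2 - z\<^sup>2 / r ^ 4) * normal_density 0 r z * F 0 z \<partial>lborel)"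
proof -
  let ?N = "normal_density 0 r"
  note [measurable] = schwartz_family_measurable[OF F]
  have N': "(?N has_real_derivative - (z / r\<^sup>2 * ?N z)) (at z)" for z
    using r unfolding normal_density_def
    by (auto intro!: derivative_eq_intros simp: field_simps power2_eq_square)
  have int: "integrable lborel (\<lambda>z. ?N z * F n z)" for n
    by (rule schwartz_family_bounded[OF F, of n]) (auto intro!: integrable_normal_mult r)
  obtain B where B: "0 \<le> B" "\<And>x. \<bar>F 0 x\<bar> \<le> B" by (metis schwartz_family_bounded[OF F])
  obtain D where D: "0 \<le> D" "\<And>x. \<bar>F 1 x\<bar> \<le> D" by (metis schwartz_family_bounded[OF F])
  have m2: "integrable lborel (\<lambda>z. ?N z * z\<^sup>2)"
    using integrable_normal_moment[OF r, of 0 2] by simp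
  have int2: "integrable lborel (\<lambda>z. (1 / r\<^sup>2 - z\<^sup>2 / r ^ 4) * ?N z * F 0 z)"
  proof (rule Bochner_Integration.integrable_bound)
    show "integrable lborel (\<lambda>z. B * (1 / r\<^sup>2 * ?N z + 1 / r ^ 4 * (?N z * z\<^sup>2)))"
      using integrable_normal_density[OF r] m2 by (intro integrable_mult_right Bochner_Integration.integrable_add) auto
    show "AE z in lborel. norm ((1 / r\<^sup>2 - z\<^sup>2 / r ^ 4) * ?N z * F 0 z)
        \<le> norm (B * (1 / r\<^sup>2 * ?N z + 1 / r ^ 4 * (?N z * z\<^sup>2)))"
    proof (rule AE_I2)
      fix z
      have "\<bar>(1 / r\<^sup>2 - z\<^sup>2 / r ^ 4) * ?N z * F 0 z\<bar> \<le> (1 / r\<^sup>2 + z\<^sup>2 / r ^ 4) * ?N z * B"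
        unfolding abs_mult by (intro mult_mono B) (auto simp: abs_if)
      also have "\<dots> = B * (1 / r\<^sup>2 * ?N z + 1 / r ^ 4 * (?N z * z\<^sup>2))"
        by (simp add: algebra_simps)
      finally show "norm ((1 / r\<^sup>2 - z\<^sup>2 / r ^ 4) * ?N z * F 0 z)
        \<le> norm (B * (1 / r\<^sup>2 * ?N z + 1 / r ^ 4 * (?N z * z\<^sup>2)))" by simp
    qed
  qed simp
  \<comment> \<open>The integrand is N F'' - N'' F, the derivative of N F' - N' F.\<close>
  have "(\<integral>z. ?N z * F 2 z + (1 / r\<^sup>2 - z\<^sup>2 / r ^ 4) * ?N z * F 0 z \<partial>lborel) = 0"
  proof (rule integral_derivative_eq_0)
    fix z
    have 1: "((\<lambda>z. ?N z * F 1 z) has_real_derivative - (z / r\<^sup>2 * ?N z) * F 1 z + F 2 z * ?N z) (at z)"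
      using DERIV_mult[OF N' schwartz_family_deriv[OF F, of 1]] by (simp add: numeral_2_eq_2)
    have 2: "((\<lambda>z. z / r\<^sup>2 * ?N z) has_real_derivative 1 / r\<^sup>2 * ?N z + - (z / r\<^sup>2 * ?N z) * (z / r\<^sup>2)) (at z)"
      by (rule DERIV_mult[OF DERIV_cdivide[OF DERIV_ident] N'])
    have 3: "((\<lambda>z. z / r\<^sup>2 * ?N z * F 0 z) has_real_derivative
       (1 / r\<^sup>2 * ?N z + - (z / r\<^sup>2 * ?N z) * (z / r\<^sup>2)) * F 0 z + F 1 z * (z / r\<^sup>2 * ?N z)) (at z)"
      using DERIV_mult[OF 2 schwartz_family_deriv[OF F, of 0]] by simp
    have 4: "(- (z / r\<^sup>2 * ?N z) * F 1 z + F 2 z * ?N z) + ((1 / r\<^sup>2 * ?N z + - (z / r\<^sup>2 * ?N z) * (z / r\<^sup>2)) * F 0 z + F 1 z * (z / r\<^sup>2 * ?N z))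
       = ?N z * F 2 z + (1 / r\<^sup>2 - z\<^sup>2 / r ^ 4) * ?N z * F 0 z"
      using r by (simp add: field_simps power2_eq_square power4_eq_xxxx)
    show "((\<lambda>z. ?N z * F 1 z + z / r\<^sup>2 * ?N z * F 0 z) has_real_derivative
        ?N z * F 2 z + (1 / r\<^sup>2 - z\<^sup>2 / r ^ 4) * ?N z * F 0 z) (at z)"
      using DERIV_add[OF 1 3] unfolding 4 .
  next
    show "continuous_on UNIV (\<lambda>z. ?N z * F 2 z + (1 / r\<^sup>2 - z\<^sup>2 / r ^ 4) * ?N z * F 0 z)"
      using r unfolding normal_density_def by (intro continuous_intros schwartz_family_continuous[OF F]) auto
    show "integrable lborel (\<lambda>z. ?N z * F 2 z + (1 / r\<^sup>2 - z\<^sup>2 / r ^ 4) * ?N z * F 0 z)"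
      using int int2 by auto
    have bd: "norm (?N z * F 1 z + z / r\<^sup>2 * ?N z * F 0 z) \<le> (D + \<bar>z\<bar> / r\<^sup>2 * B) * ?N z" for z
    proof -
      have "norm (?N z * F 1 z + z / r\<^sup>2 * ?N z * F 0 z) \<le> ?N z * \<bar>F 1 z\<bar> + \<bar>z\<bar> / r\<^sup>2 * ?N z * \<bar>F 0 z\<bar>"
        by (rule order_trans[OF norm_triangle_ineq]) (simp add: abs_mult)
      also have "\<dots> \<le> ?N z * D + \<bar>z\<bar> / r\<^sup>2 * ?N z * B"
        using B D by (intro add_mono mult_left_mono) auto
      finally show ?thesis by (simp add: algebra_simps)
    qed
    have "((\<lambda>z. (D + \<bar>z\<bar> / r\<^sup>2 * B) * ?N z) \<longlongrightarrow> 0) at_top" "((\<lambda>z. (D + \<bar>z\<bar> / r\<^sup>2 * B) * ?N z) \<longlongrightarrow> 0) at_bot"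
      using r unfolding normal_density_def by real_asymp+
    then show "((\<lambda>z. ?N z * F 1 z + z / r\<^sup>2 * ?N z * F 0 z) \<longlongrightarrow> 0) at_top"
      "((\<lambda>z. ?N z * F 1 z + z / r\<^sup>2 * ?N z * F 0 z) \<longlongrightarrow> 0) at_bot"
      by - (rule Lim_null_comparison[OF always_eventually[OF allI[OF bd]]], assumption)+
  qed
  then have eq: "(\<integral>z. ?N z * F 2 z \<partial>lborel) = - (\<integral>z. (1 / r\<^sup>2 - z\<^sup>2 / r ^ 4) * ?N z * F 0 z \<partial>lborel)"
    using int int2 by (simp add: Bochner_Integration.integral_add)
  have "(\<integral>z. (m\<^sup>2 + 1 / r\<^sup>2 - z\<^sup>2 / r ^ 4) * ?N z * F 0 z \<partial>lborel)
      = (\<integral>z. m\<^sup>2 * (?N z * F 0 z) + (1 / r\<^sup>2 - z\<^sup>2 / r ^ 4) * ?N z * F 0 z \<partial>lborel)"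
    by (intro Bochner_Integration.integral_cong) (auto simp: algebra_simps)
  also have "\<dots> = m\<^sup>2 * (\<integral>z. ?N z * F 0 z \<partial>lborel) + (\<integral>z. (1 / r\<^sup>2 - z\<^sup>2 / r ^ 4) * ?N z * F 0 z \<partial>lborel)"
    using int int2 by (subst Bochner_Integration.integral_add) auto
  finally show ?thesis
    unfolding gauss_mean_lincomb[OF F] gauss_mean_eq_normal[OF r] eq by simp
qed

section \<open>The heat flow of test functions: reflection, decay, measurability\<close>

lemma heat1_eq_gauss_mean:
  assumes "0 \<le> \<tau>"
  shows "heat1 \<tau> f x = gauss_mean (sqrt (2 * \<tau>)) (\<lambda>y. f (x - y))"
proof (cases "\<tau> = 0")
  case False
  then have r: "0 < sqrt (2 * \<tau>)" using assms by simp
  show ?thesis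
    using lborel_integral_real_affine[of "- 1" "\<lambda>s. normal_density 0 (sqrt (2 * \<tau>)) (x - s) * f s" x] False
    unfolding gauss_mean_eq_normal[OF r] heat1_def by simp
qed (simp add: heat1_def gauss_mean_0)

lemma gauss_mean_reflect: "gauss_mean r (\<lambda>y. h (- y)) = gauss_mean r h"
  using lborel_integral_real_affine[of "- 1" "\<lambda>z. std_normal_density z * h (r * z)" 0]
  by (simp add: gauss_mean_def normal_density_def)

lemma heat1_reflect:
  assumes "0 \<le> \<tau>"
  shows "heat1 \<tau> (\<lambda>s. f (- s)) x = heat1 \<tau> f (- x)"
  using gauss_mean_reflect[of "sqrt (2 * \<tau>)" "\<lambda>y. f (- x - y)"]
  by (simp add: heat1_eq_gauss_mean[OF assms])

text \<open>Peetre's inequality.\<close>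

lemma weight1_triangle: "weight1 c x \<le> 2 * (1 + y\<^sup>2) * weight1 c (x - y)"
proof (cases c)
  case None
  have "0 \<le> (x - 2 * y)\<^sup>2 + 2 * y\<^sup>2 * (x - y)\<^sup>2" by simp
  also have "\<dots> = 2 * (1 + y\<^sup>2) * (1 + (x - y)\<^sup>2) - (1 + x\<^sup>2) - 1"
    by (simp add: power2_eq_square algebra_simps)
  finally show ?thesis using None by (simp add: weight1_def)
next
  case (Some l)
  show ?thesis unfolding Some weight1_def using zero_le_power2[of y] by simp
qed

text \<open>Peetre's inequality takes the weight out of the Gaussian mean at the cost of a factor 2
  (1 + y^2), and the second moment of y is 2 \<tau> \<le> 2 T. Uniformity in \<tau> provides the
  majorant on the noise space.\<close>

lemma heat1_decay:
  assumes F: "schwartz_family c F" and T: "0 \<le> T"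
  obtains B where "0 \<le> B" "\<And>\<tau> x. 0 \<le> \<tau> \<Longrightarrow> \<tau> \<le> T \<Longrightarrow> \<bar>heat1 \<tau> (F n) x\<bar> \<le> B / weight1 c x"
proof -
  obtain D where D: "0 \<le> D" "\<And>x. \<bar>F n x\<bar> \<le> D / weight1 c x ^ 1" by (metis schwartz_family_decay[OF F])
  note [measurable] = schwartz_family_measurable[OF F]
  have m: "integrable lborel (\<lambda>z. std_normal_density z * z\<^sup>2)" "(\<integral>z. std_normal_density z * z\<^sup>2 \<partial>lborel) = 1"
    using integrable_std_normal_moment[of 2] integral_std_normal_moment_even[of 1] by (auto simp: numeral_2_eq_2)
  have "\<bar>heat1 \<tau> (F n) x\<bar> \<le> 2 * D * (1 + 2 * T) / weight1 c x" if \<tau>: "0 \<le> \<tau>" "\<tau> \<le> T" for \<tau> x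
  proof -
    let ?r = "sqrt (2 * \<tau>)"
    have w: "0 < weight1 c y" for y using weight1_ge_1[of c y] by simp
    have le: "\<bar>std_normal_density z * F n (x - ?r * z)\<bar>
        \<le> 2 * D / weight1 c x * (std_normal_density z + 2 * T * (std_normal_density z * z\<^sup>2))" for z
    proof -
      have "\<bar>F n (x - ?r * z)\<bar> \<le> D / weight1 c (x - ?r * z)" using D(2) by simp
      also have "\<dots> \<le> D * (2 * (1 + (?r * z)\<^sup>2) / weight1 c x)"
      proof -
        have "1 / weight1 c (x - ?r * z) \<le> 2 * (1 + (?r * z)\<^sup>2) / weight1 c x"
          using weight1_triangle[of c x "?r * z"] w[of x] w[of "x - ?r * z"] by (simp add: field_simps)
        from mult_left_mono[OF this D(1)] show ?thesis by simp
      qed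
      also have "\<dots> \<le> D * (2 * (1 + 2 * T * z\<^sup>2) / weight1 c x)"
        using \<tau> D(1) w[of x]
        by (intro mult_left_mono divide_right_mono add_left_mono)
           (auto simp: power_mult_distrib intro: mult_right_mono)
      finally have "\<bar>F n (x - ?r * z)\<bar> \<le> D * (2 * (1 + 2 * T * z\<^sup>2) / weight1 c x)" .
      from mult_left_mono[OF this, of "std_normal_density z"] show ?thesis
        by (simp add: abs_mult algebra_simps add_divide_distrib)
    qed
    have "\<bar>heat1 \<tau> (F n) x\<bar> \<le> (\<integral>z. \<bar>std_normal_density z * F n (x - ?r * z)\<bar> \<partial>lborel)"
      unfolding heat1_eq_gauss_mean[OF \<tau>(1)] gauss_mean_def by (rule integral_abs_bound)
    also have "\<dots> \<le> (\<integral>z. 2 * D / weight1 c x * (std_normal_density z + 2 * T * (std_normal_density z * z\<^sup>2)) \<partial>lborel)"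
    proof (rule integral_mono[OF _ _ le])
      obtain B where B: "\<And>x. \<bar>F n x\<bar> \<le> B" by (metis schwartz_family_bounded[OF F])
      show "integrable lborel (\<lambda>z. \<bar>std_normal_density z * F n (x - ?r * z)\<bar>)"
        by (intro integrable_abs integrable_normal_mult) (use B in auto)
      show "integrable lborel (\<lambda>z. 2 * D / weight1 c x * (std_normal_density z + 2 * T * (std_normal_density z * z\<^sup>2)))"
        using m by (intro integrable_mult_right Bochner_Integration.integrable_add integrable_normal_density) auto
    qed
    also have "\<dots> = 2 * D / weight1 c x * (1 + 2 * T)"
      using m by (subst integral_mult_right_zero, subst Bochner_Integration.integral_add)
        (auto intro!: integrable_normal_density simp: integral_normal_density)
    finally show ?thesis by simp
  qed
  then show ?thesis using that[of "2 * D * (1 + 2 * T)"] D(1) T by auto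
qed

lemma heat1_measurable_pair [measurable]:
  assumes [measurable]: "f \<in> borel_measurable borel"
  shows "(\<lambda>p. heat1 (fst p) f (snd p)) \<in> borel_measurable (borel \<Otimes>\<^sub>M borel)"
proof -
  have "(\<lambda>p. if fst p = 0 then f (snd p)
     else \<integral>s. normal_density 0 (sqrt (2 * fst p)) (snd p - s) * f s \<partial>lborel)
     \<in> borel_measurable (borel \<Otimes>\<^sub>M borel)"
    unfolding normal_density_def by measurable
  then show ?thesis unfolding heat1_def .
qed

lemma heat1_measurable [measurable]:
  assumes "f \<in> borel_measurable borel" shows "heat1 \<tau> f \<in> borel_measurable borel"
  using measurable_compose[OF measurable_Pair1'[of \<tau>] heat1_measurable_pair[OF assms]] by simp

section \<open>Exchange of integrals and the pairing with a reflected function\<close>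

lemma fubini_bounded:
  fixes a b :: "real \<Rightarrow> real"
  assumes a: "integrable lborel a" and b: "integrable lborel b"
    and [measurable]: "(\<lambda>p. k (fst p) (snd p)) \<in> borel_measurable (borel \<Otimes>\<^sub>M borel)"
    and k: "\<And>t x. \<bar>k t x\<bar> \<le> B"
  shows "(\<integral>t. a t * (\<integral>x. b x * k t x \<partial>lborel) \<partial>lborel) = (\<integral>x. b x * (\<integral>t. a t * k t x \<partial>lborel) \<partial>lborel)"
proof -
  note [measurable] = borel_measurable_integrable[OF a] borel_measurable_integrable[OF b]
  have int0: "integrable (lborel \<Otimes>\<^sub>M lborel) (\<lambda>(t, x). a t * b x)"
  proof (rule lborel_pair.Fubini_integrable)
    show "integrable lborel (\<lambda>t. \<integral>x. norm (case (t, x) of (t, x) \<Rightarrow> a t * b x) \<partial>lborel)"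
      using a by (simp add: abs_mult)
    show "AE t in lborel. integrable lborel (\<lambda>x. case (t, x) of (t, x) \<Rightarrow> a t * b x)"
      using b by simp
  qed simp
  have int: "integrable (lborel \<Otimes>\<^sub>M lborel) (\<lambda>(t, x). a t * b x * k t x)"
  proof (rule Bochner_Integration.integrable_bound)
    show "integrable (lborel \<Otimes>\<^sub>M lborel) (\<lambda>p. B * (case p of (t, x) \<Rightarrow> a t * b x))"
      using int0 by (rule integrable_mult_right)
    show "AE p in lborel \<Otimes>\<^sub>M lborel. norm (case p of (t, x) \<Rightarrow> a t * b x * k t x)
        \<le> norm (B * (case p of (t, x) \<Rightarrow> a t * b x))"
    proof (rule AE_I2, clarify)
      fix t x
      show "norm (a t * b x * k t x) \<le> norm (B * (a t * b x))"
        using mult_left_mono[OF order_trans[OF k[of t x] abs_ge_self], of "\<bar>a t * b x\<bar>"]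
        by (simp add: abs_mult mult_ac)
    qed
    have "(\<lambda>p. a (fst p) * b (snd p) * k (fst p) (snd p)) \<in> borel_measurable (lborel \<Otimes>\<^sub>M lborel)"
      by simp
    then show "(\<lambda>(t, x). a t * b x * k t x) \<in> borel_measurable (lborel \<Otimes>\<^sub>M lborel)"
      by (simp add: case_prod_beta')
  qed
  have "(\<integral>t. a t * (\<integral>x. b x * k t x \<partial>lborel) \<partial>lborel) = (\<integral>t. (\<integral>x. a t * b x * k t x \<partial>lborel) \<partial>lborel)"
    by (simp only: mult.assoc integral_mult_right_zero)
  also have "\<dots> = (\<integral>x. (\<integral>t. a t * b x * k t x \<partial>lborel) \<partial>lborel)"
    by (rule lborel_pair.Fubini_integral[OF int, symmetric])
  also have "\<dots> = (\<integral>x. b x * (\<integral>t. a t * k t x \<partial>lborel) \<partial>lborel)"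
    by (simp only: mult.assoc mult.left_commute[of "a _"] integral_mult_right_zero)
  finally show ?thesis .
qed

lemma normal_convolution:
  assumes "0 < r" "0 < s"
  shows "integrable lborel (\<lambda>y. normal_density 0 r (z - y) * normal_density 0 s y)"
    and "(\<integral>y. normal_density 0 r (z - y) * normal_density 0 s y \<partial>lborel)
      = normal_density 0 (sqrt (r\<^sup>2 + s\<^sup>2)) z"
proof -
  have eq: "(\<integral>\<^sup>+y. ennreal (normal_density 0 r (z - y) * normal_density 0 s y) \<partial>lborel)
      = ennreal (normal_density 0 (sqrt (r\<^sup>2 + s\<^sup>2)) z)"
    using fun_cong[OF conv_normal_density_zero_mean[OF assms], of z] .
  then show "integrable lborel (\<lambda>y. normal_density 0 r (z - y) * normal_density 0 s y)"
    by (intro integrableI_nonneg) auto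
  show "(\<integral>y. normal_density 0 r (z - y) * normal_density 0 s y \<partial>lborel)
      = normal_density 0 (sqrt (r\<^sup>2 + s\<^sup>2)) z"
    by (intro integral_eq_nn_integral[THEN trans]) (auto simp: eq)
qed

text \<open>The semigroup property: variances of independent Gaussians add. Boundedness of V
  justifies the exchange of integrals.\<close>

lemma gauss_mean_gauss_mean:
  assumes r: "0 < r" and s: "0 < s"
    and [measurable]: "V \<in> borel_measurable borel" and V: "\<And>x. \<bar>V x\<bar> \<le> B"
  shows "gauss_mean s (\<lambda>y. gauss_mean r (\<lambda>x. V (x + y))) = gauss_mean (sqrt (r\<^sup>2 + s\<^sup>2)) V"
proof -
  let ?N = "normal_density 0"
  have B: "0 \<le> B" using V[of 0] by simp
  have shift: "gauss_mean r (\<lambda>x. V (x + y)) = (\<integral>z. ?N r (z - y) * V z \<partial>lborel)" for y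
    using lborel_integral_real_affine[of 1 "\<lambda>z. ?N r (z - y) * V z" y]
    unfolding gauss_mean_eq_normal[OF r] by (simp add: add.commute)
  have N1: "(\<integral>z. ?N r (z - y) \<partial>lborel) = 1" "integrable lborel (\<lambda>z. ?N r (z - y))" for y
  proof -
    have "?N r (z - y) = normal_density y r z" for z by (simp add: normal_density_def)
    then show "(\<integral>z. ?N r (z - y) \<partial>lborel) = 1" "integrable lborel (\<lambda>z. ?N r (z - y))"
      using integral_normal_density[OF r, of y] integrable_normal_density[OF r, of y] by simp_all
  qed
  have int0: "integrable (lborel \<Otimes>\<^sub>M lborel) (\<lambda>(y, z). ?N s y * ?N r (z - y))"
  proof (rule lborel_pair.Fubini_integrable)
    show "integrable lborel (\<lambda>y. \<integral>z. norm (case (y, z) of (y, z) \<Rightarrow> ?N s y * ?N r (z - y)) \<partial>lborel)"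
      using N1 integrable_normal_density[OF s] by (simp add: abs_mult)
    show "AE y in lborel. integrable lborel (\<lambda>z. case (y, z) of (y, z) \<Rightarrow> ?N s y * ?N r (z - y))"
      using N1 by simp
    show "(\<lambda>(y, z). ?N s y * ?N r (z - y)) \<in> borel_measurable (lborel \<Otimes>\<^sub>M lborel)"
      unfolding normal_density_def by measurable
  qed
  have int: "integrable (lborel \<Otimes>\<^sub>M lborel) (\<lambda>(y, z). ?N s y * ?N r (z - y) * V z)"
  proof (rule Bochner_Integration.integrable_bound)
    show "integrable (lborel \<Otimes>\<^sub>M lborel) (\<lambda>p. B * (case p of (y, z) \<Rightarrow> ?N s y * ?N r (z - y)))"
      using int0 by (rule integrable_mult_right)
    show "AE p in lborel \<Otimes>\<^sub>M lborel. norm (case p of (y, z) \<Rightarrow> ?N s y * ?N r (z - y) * V z)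
        \<le> norm (B * (case p of (y, z) \<Rightarrow> ?N s y * ?N r (z - y)))"
    proof (rule AE_I2, clarify)
      fix y z
      show "norm (?N s y * ?N r (z - y) * V z) \<le> norm (B * (?N s y * ?N r (z - y)))"
        using mult_left_mono[OF order_trans[OF V[of z] abs_ge_self], of "\<bar>?N s y * ?N r (z - y)\<bar>"]
        by (simp add: abs_mult mult_ac)
    qed
    show "(\<lambda>(y, z). ?N s y * ?N r (z - y) * V z) \<in> borel_measurable (lborel \<Otimes>\<^sub>M lborel)"
      unfolding normal_density_def by measurable
  qed
  have "gauss_mean s (\<lambda>y. gauss_mean r (\<lambda>x. V (x + y)))
      = (\<integral>y. (\<integral>z. ?N s y * ?N r (z - y) * V z \<partial>lborel) \<partial>lborel)"
    unfolding shift gauss_mean_eq_normal[OF s] by (simp only: mult.assoc integral_mult_right_zero)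
  also have "\<dots> = (\<integral>z. (\<integral>y. ?N s y * ?N r (z - y) * V z \<partial>lborel) \<partial>lborel)"
    by (rule lborel_pair.Fubini_integral[OF int, symmetric])
  also have "\<dots> = (\<integral>z. (\<integral>y. ?N r (z - y) * ?N s y \<partial>lborel) * V z \<partial>lborel)"
    by (simp only: integral_mult_left_zero mult.commute[of "?N s _"])
  also have "\<dots> = gauss_mean (sqrt (r\<^sup>2 + s\<^sup>2)) V"
    unfolding normal_convolution(2)[OF r s] using r s
    by (subst gauss_mean_eq_normal) (auto simp: add_pos_pos)
  finally show ?thesis .
qed

lemma integrable_cell_reflect:
  assumes F: "schwartz_family c F"
  shows "integrable lborel (\<lambda>t. indicator (cell1 c) t * F n (z - t))"
proof (cases c)
  case None
  have "integrable lborel (\<lambda>t. F n t)"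
    using integrable_cell_schwartz_family[OF F, of n] None by (simp add: cell1_def)
  from lborel_integrable_real_affine[OF this, of "- 1" z] None show ?thesis
    by (simp add: cell1_def)
next
  case (Some l)
  note [measurable] = schwartz_family_measurable[OF F]
  obtain B where "\<And>x. \<bar>F n x\<bar> \<le> B" by (metis schwartz_family_bounded[OF F])
  then show ?thesis using Some by (intro integrable_cell[of _ B]) (auto simp: weight1_def)
qed

text \<open>As Gaussian means, the flow of u at t averages u(t + x) and the flow of the reflected u
  averages u(y - t), with x and y independent of variance 2 \<tau>. Integration over t gives the
  convolution square of u at x + y, which has variance 4 \<tau>.\<close>

lemma heat1_reflection_pairing:
  assumes c: "pos_circ c" and F: "schwartz_family c F" and \<tau>: "0 < \<tau>"
  shows "cint c (\<lambda>t. heat1 \<tau> (F n) t * heat1 \<tau> (\<lambda>s. F n (- s)) t)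
    = gauss_mean (sqrt (4 * \<tau>)) (conv c (F n) (F n))"
proof -
  let ?r = "sqrt (2 * \<tau>)" and ?u = "F n"
  have r: "0 < ?r" using \<tau> by simp
  have \<tau>0: "0 \<le> \<tau>" using \<tau> by simp
  note [measurable] = schwartz_family_measurable[OF F]
  obtain B where B: "\<And>x. \<bar>?u x\<bar> \<le> B" by (metis schwartz_family_bounded[OF F])
  obtain D where D: "\<And>x. \<bar>heat1 \<tau> ?u x\<bar> \<le> D / weight1 c x"
    using heat1_decay[OF F \<tau>0] \<tau>0 by (metis order_refl)
  have Nint: "integrable lborel (normal_density 0 ?r)" by (rule integrable_normal_density[OF r])
  have g: "gauss_mean ?r h = (\<integral>z. normal_density 0 ?r z * h z \<partial>lborel)" for h
    by (rule gauss_mean_eq_normal[OF r])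
  have h1: "heat1 \<tau> (\<lambda>s. ?u (- s)) t = (\<integral>y. normal_density 0 ?r y * ?u (y - t) \<partial>lborel)" for t
    unfolding heat1_reflect[OF \<tau>0] using gauss_mean_reflect[of ?r "\<lambda>y. ?u (y - t)"]
    by (simp add: heat1_eq_gauss_mean[OF \<tau>0] g minus_diff_commute)
  have h2: "heat1 \<tau> ?u t = (\<integral>x. normal_density 0 ?r x * ?u (t + x) \<partial>lborel)" for t
    using gauss_mean_reflect[of ?r "\<lambda>y. ?u (t + y)"]
    by (simp add: heat1_eq_gauss_mean[OF \<tau>0] g)
  have sh: "cint c (\<lambda>t. ?u (y - t) * ?u (t + x)) = conv c ?u ?u (x + y)" for x y
  proof -
    have "continuous_on UNIV (\<lambda>t. ?u t * ?u (x + y - t))"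
      by (intro continuous_intros schwartz_family_continuous[OF F] continuous_on_compose2[OF schwartz_family_continuous[OF F, of UNIV]]) auto
    moreover have "periodic1 c (\<lambda>t. ?u t * ?u (x + y - t))"
      using schwartz_family_periodic1[OF F, of n] periodic1_minus[OF schwartz_family_periodic1[OF F, of n], of "x + y"] by (auto simp: periodic1_def)
    ultimately show ?thesis
      using cint_shift(1)[OF c, of "\<lambda>t. ?u t * ?u (x + y - t)" x]
      by (simp add: conv_def mult.commute add.commute)
  qed
  have "cint c (\<lambda>t. heat1 \<tau> ?u t * heat1 \<tau> (\<lambda>s. ?u (- s)) t)
      = (\<integral>t. (indicator (cell1 c) t * heat1 \<tau> ?u t) * (\<integral>y. normal_density 0 ?r y * ?u (y - t) \<partial>lborel) \<partial>lborel)"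
    by (simp add: h1 mult.assoc)
  \<comment> \<open>One exchange for each Gaussian variable. Integrability in t comes from the decay
    of the flow of u here, and from u(y - t) in the second exchange.\<close>
  also have "\<dots> = (\<integral>y. normal_density 0 ?r y * (\<integral>t. (indicator (cell1 c) t * heat1 \<tau> ?u t) * ?u (y - t) \<partial>lborel) \<partial>lborel)"
    by (rule fubini_bounded[OF integrable_cell[OF _ D] Nint _ B]) auto
  also have "(\<lambda>y. \<integral>t. (indicator (cell1 c) t * heat1 \<tau> ?u t) * ?u (y - t) \<partial>lborel)
      = (\<lambda>y. \<integral>t. (indicator (cell1 c) t * ?u (y - t)) * (\<integral>x. normal_density 0 ?r x * ?u (t + x) \<partial>lborel) \<partial>lborel)"
    unfolding h2 by (simp only: mult_ac)
  also have "\<dots> = (\<lambda>y. \<integral>x. normal_density 0 ?r x * (\<integral>t. (indicator (cell1 c) t * ?u (y - t)) * ?u (t + x) \<partial>lborel) \<partial>lborel)"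
    by (rule ext, rule fubini_bounded[OF integrable_cell_reflect[OF F] Nint _ B]) auto
  also have "\<dots> = (\<lambda>y. gauss_mean ?r (\<lambda>x. conv c ?u ?u (x + y)))"
    unfolding g by (simp only: mult.assoc sh)
  also have "(\<integral>y. normal_density 0 ?r y * gauss_mean ?r (\<lambda>x. conv c ?u ?u (x + y)) \<partial>lborel)
      = gauss_mean ?r (\<lambda>y. gauss_mean ?r (\<lambda>x. conv c ?u ?u (x + y)))"
    by (simp only: g)
  also have "\<dots> = gauss_mean (sqrt (?r\<^sup>2 + ?r\<^sup>2)) (conv c ?u ?u)"
  proof -
    obtain C where "\<And>x. \<bar>conv c ?u ?u x\<bar> \<le> C" by (metis schwartz_family_bounded[OF schwartz_family_conv[OF F F]])
    then show ?thesis
      by (intro gauss_mean_gauss_mean[OF r r schwartz_family_measurable[OF schwartz_family_conv[OF F F]]])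
  qed
  also have "?r\<^sup>2 + ?r\<^sup>2 = 4 * \<tau>" using \<tau> by simp
  finally show ?thesis .
qed

section \<open>Strict positivity of integrals\<close>

lemma integral_pos_if_bounded_below:
  fixes f :: "real \<Rightarrow> real"
  assumes f: "integrable lborel f" "\<And>x. 0 \<le> f x"
    and uv: "u < v" "0 < \<eta>" "\<And>x. u \<le> x \<Longrightarrow> x \<le> v \<Longrightarrow> \<eta> \<le> f x"
  shows "0 < (\<integral>x. f x \<partial>lborel)"
proof -
  have "0 < \<eta> * (v - u)" using uv by simp
  also have "\<dots> = (\<integral>x. \<eta> * indicator {u..v} x \<partial>lborel)" using uv by simp
  also have "\<dots> \<le> (\<integral>x. f x \<partial>lborel)"
  proof (rule integral_mono)
    show "integrable lborel (\<lambda>x. \<eta> * indicator {u..v} x)"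
      using uv by (intro integrable_mult_right integrable_real_indicator) auto
    show "\<eta> * indicator {u..v} x \<le> f x" for x
      using f(2)[of x] uv(3)[of x] by (auto simp: indicator_def)
  qed (rule f)
  finally show ?thesis .
qed

lemma continuous_pos_nbhd:
  fixes f :: "real \<Rightarrow> real"
  assumes "continuous_on {a..b} f" "a < x" "x < b" "0 < f x"
  obtains e where "0 < e" "a < x - e" "x + e < b" "\<And>y. \<bar>y - x\<bar> \<le> e \<Longrightarrow> f x / 2 \<le> f y"
proof -
  have "isCont f x"
    using assms by (intro continuous_on_interior[OF assms(1)]) auto
  then obtain d where d: "0 < d" "\<And>y. \<bar>y - x\<bar> < d \<Longrightarrow> \<bar>f y - f x\<bar> < f x / 2"
    unfolding continuous_at_eps_delta dist_real_def using assms(4) by (metis half_gt_zero)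
  define e where "e = min (d / 2) (min ((x - a) / 2) ((b - x) / 2))"
  have e: "0 < e" "e \<le> d / 2" "e \<le> (x - a) / 2" "e \<le> (b - x) / 2"
  proof -
    show "0 < e" using d assms by (simp add: e_def)
    show "e \<le> d / 2" unfolding e_def by (rule min.cobounded1)
    show "e \<le> (x - a) / 2" unfolding e_def by (rule min.coboundedI2[OF min.cobounded1])
    show "e \<le> (b - x) / 2" unfolding e_def by (rule min.coboundedI2[OF min.cobounded2])
  qed
  show ?thesis
  proof (rule that[of e])
    show "f x / 2 \<le> f y" if "\<bar>y - x\<bar> \<le> e" for y
    proof -
      have "\<bar>y - x\<bar> < d" using that e d(1) by linarith
      from d(2)[OF this] show ?thesis by linarith
    qed
  qed (use e assms in \<open>auto simp: field_simps\<close>)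
qed

lemma cint_pos:
  assumes f: "continuous_on UNIV f" "\<And>x. 0 \<le> f x" "0 < f x"
    and int: "integrable lborel (\<lambda>t. indicator (cell1 c) t * f t)"
    and x: "\<And>l. c = Some l \<Longrightarrow> 0 < x \<and> x < l"
  shows "0 < cint c f"
proof -
  obtain a b where ab: "a < x" "x < b" "{a<..<b} \<subseteq> cell1 c"
  proof (cases c)
    case None
    show ?thesis by (rule that[of "x - 1" "x + 1"]) (auto simp: None cell1_def)
  next
    case (Some l)
    show ?thesis by (rule that[of 0 l]) (use Some x in \<open>auto simp: cell1_def\<close>)
  qed
  obtain e where e: "0 < e" "a < x - e" "x + e < b" "\<And>y. \<bar>y - x\<bar> \<le> e \<Longrightarrow> f x / 2 \<le> f y"
    using continuous_pos_nbhd[of a b f x] ab f by (metis continuous_on_subset subset_UNIV)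
  show ?thesis
  proof (rule integral_pos_if_bounded_below[OF int, of "x - e" "x + e" "f x / 2"])
    fix y assume y: "x - e \<le> y" "y \<le> x + e"
    then have "y \<in> cell1 c" using ab(3) e by auto
    then show "f x / 2 \<le> indicator (cell1 c) y * f y" using e(4)[of y] y by auto
  qed (use f e in auto)
qed

section \<open>Bump functions\<close>

text \<open>The powers of x in the denominator make the family closed under differentiation up to
  linear combinations; \<open>bump 0\<close> is the usual flat function.\<close>

definition bump :: "nat \<Rightarrow> real \<Rightarrow> real" where
  "bump k x = (if 0 < x then exp (- 1 / x) / x ^ k else 0)"

lemma bump_deriv: "(bump k has_real_derivative - real k * bump (Suc k) x + bump (Suc (Suc k)) x) (at x)"
proof (cases "x = 0")
  case True
  have lim: "((\<lambda>h. (bump k (0 + h) - bump k 0) / h) \<longlongrightarrow> 0) (at 0)"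
  proof (rule filterlim_split_at)
    have "((\<lambda>h::real. 0::real) \<longlongrightarrow> 0) (at_left 0)" by simp
    then show "((\<lambda>h. (bump k (0 + h) - bump k 0) / h) \<longlongrightarrow> 0) (at_left 0)"
      by (rule Lim_transform_eventually)
        (auto simp: bump_def eventually_at_filter)
    have "((\<lambda>h::real. exp (- 1 / h) / h ^ k / h) \<longlongrightarrow> 0) (at_right 0)"
      by real_asymp
    then show "((\<lambda>h. (bump k (0 + h) - bump k 0) / h) \<longlongrightarrow> 0) (at_right 0)"
      by (rule Lim_transform_eventually)
        (auto simp: bump_def eventually_at_filter)
  qed
  then show ?thesis unfolding True DERIV_def by (simp add: bump_def)
next
  case False
  show ?thesis
  proof (cases "0 < x")
    case True
    have "((\<lambda>x. exp (- 1 / x) / x ^ k) has_real_derivative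
        (exp (- 1 / x) * (1 / x\<^sup>2) * x ^ k - exp (- 1 / x) * (real k * x ^ (k - 1))) / (x ^ k * x ^ k)) (at x)"
      using True by (auto intro!: derivative_eq_intros simp: power2_eq_square)
    moreover have "(exp (- 1 / x) * (1 / x\<^sup>2) * x ^ k - exp (- 1 / x) * (real k * x ^ (k - 1))) / (x ^ k * x ^ k)
       = - real k * bump (Suc k) x + bump (Suc (Suc k)) x"
      using True by (cases k) (auto simp: bump_def field_simps power2_eq_square)
    ultimately have "((\<lambda>x. exp (- 1 / x) / x ^ k) has_real_derivative
       - real k * bump (Suc k) x + bump (Suc (Suc k)) x) (at x)" by simp
    then show ?thesis
      by (rule has_field_derivative_transform_within_open[where S = "{0<..}"])
        (use True in \<open>auto simp: bump_def\<close>)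
  next
    case xneg: False
    have "((\<lambda>x. 0) has_real_derivative 0) (at x)" by simp
    then have "(bump k has_real_derivative 0) (at x)"
      by (rule has_field_derivative_transform_within_open[where S = "{..<0}"])
        (use xneg False in \<open>auto simp: bump_def\<close>)
    then show ?thesis using xneg by (simp add: bump_def)
  qed
qed

text \<open>
  If the derivatives of the generators lie in the algebra, then it is closed under differentiation, and
  its elements are smooth. This replaces a formula for the iterated derivatives of a composition.
\<close>

inductive_set fun_alg :: "(real \<Rightarrow> real) set \<Rightarrow> (real \<Rightarrow> real) set" for A where
  atom: "f \<in> A \<Longrightarrow> f \<in> fun_alg A"
| const: "(\<lambda>_. a) \<in> fun_alg A"
| add: "f \<in> fun_alg A \<Longrightarrow> g \<in> fun_alg A \<Longrightarrow> (\<lambda>x. f x + g x) \<in> fun_alg A"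
| mult: "f \<in> fun_alg A \<Longrightarrow> g \<in> fun_alg A \<Longrightarrow> (\<lambda>x. f x * g x) \<in> fun_alg A"

lemma fun_alg_deriv:
  assumes A: "\<And>f. f \<in> A \<Longrightarrow> \<exists>g\<in>fun_alg A. \<forall>x. (f has_real_derivative g x) (at x)"
    and f: "f \<in> fun_alg A"
  shows "\<exists>g\<in>fun_alg A. \<forall>x. (f has_real_derivative g x) (at x)"
  using f
proof induction
  case (atom f) then show ?case by (rule A)
next
  case (const a) show ?case by (rule bexI[OF _ fun_alg.const[of 0]]) simp
next
  case (add f g)
  then obtain f' g' where "f' \<in> fun_alg A" "\<forall>x. (f has_real_derivative f' x) (at x)"
    "g' \<in> fun_alg A" "\<forall>x. (g has_real_derivative g' x) (at x)" by blast
  then show ?case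
    by (intro bexI[of _ "\<lambda>x. f' x + g' x"]) (auto intro: fun_alg.add DERIV_add)
next
  case (mult f g)
  then obtain f' g' where "f' \<in> fun_alg A" "\<forall>x. (f has_real_derivative f' x) (at x)"
    "g' \<in> fun_alg A" "\<forall>x. (g has_real_derivative g' x) (at x)" by blast
  with mult.hyps show ?case
    by (intro bexI[of _ "\<lambda>x. f' x * g x + g' x * f x"]) (auto intro: fun_alg.add fun_alg.mult DERIV_mult)
qed

lemma fun_alg_derivatives:
  assumes A: "\<And>f. f \<in> A \<Longrightarrow> \<exists>g\<in>fun_alg A. \<forall>x. (f has_real_derivative g x) (at x)"
    and f: "f \<in> fun_alg A"
  shows "\<exists>F. F 0 = f \<and> (\<forall>n x. (F n has_real_derivative F (Suc n) x) (at x))"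
proof -
  have "\<forall>f\<in>fun_alg A. \<exists>g. g \<in> fun_alg A \<and> (\<forall>x. (f has_real_derivative g x) (at x))"
    using fun_alg_deriv[OF A] by blast
  then obtain D where D: "\<And>f. f \<in> fun_alg A \<Longrightarrow> D f \<in> fun_alg A \<and> (\<forall>x. (f has_real_derivative D f x) (at x))"
    by metis
  have "(D ^^ n) f \<in> fun_alg A" for n
    by (induction n) (use f D in auto)
  then show ?thesis
    using D by (intro exI[of _ "\<lambda>n. (D ^^ n) f"]) auto
qed

text \<open>Repeated differentiation of \<open>bump 0\<close> after h meets only functions
  \<open>bump k\<close> after h and derivatives of h. Adding the former for all k as generators
  therefore keeps the algebra closed under differentiation.\<close>

lemma bump_comp_derivatives:
  assumes P: "\<And>f. f \<in> P \<Longrightarrow> \<exists>g\<in>fun_alg P. \<forall>x. (f has_real_derivative g x) (at x)"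
    and h: "h \<in> fun_alg P"
  shows "\<exists>F. F 0 = (\<lambda>x. bump 0 (h x)) \<and> (\<forall>n x. (F n has_real_derivative F (Suc n) x) (at x))"
proof -
  let ?A = "P \<union> range (\<lambda>k x. bump k (h x))"
  have mono: "f \<in> fun_alg ?A" if "f \<in> fun_alg P" for f
    using that by induction (auto intro: fun_alg.intros)
  obtain h' where h': "h' \<in> fun_alg P" "\<And>x. (h has_real_derivative h' x) (at x)"
    using fun_alg_deriv[OF P h] by blast
  have b: "(\<lambda>x. bump k (h x)) \<in> fun_alg ?A" for k by (rule fun_alg.atom) auto
  have "\<exists>g\<in>fun_alg ?A. \<forall>x. (f has_real_derivative g x) (at x)" if "f \<in> ?A" for f
  proof (cases "f \<in> P")
    case True then show ?thesis using P mono by blast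
  next
    case False
    with that obtain k where k: "f = (\<lambda>x. bump k (h x))" by auto
    have "(f has_real_derivative (- real k * bump (Suc k) (h x) + bump (Suc (Suc k)) (h x)) * h' x) (at x)" for x
      unfolding k by (rule DERIV_chain2[OF bump_deriv h'(2)])
    then show ?thesis
      by (intro bexI[of _ "\<lambda>x. (- real k * bump (Suc k) (h x) + bump (Suc (Suc k)) (h x)) * h' x"]
          fun_alg.mult fun_alg.add fun_alg.const b mono h'(1)) blast
  qed
  from fun_alg_derivatives[OF this b[of 0]] show ?thesis by blast
qed

text \<open>Setting the shift to 0 on the line lets statements modulo the period cover both
  cases.\<close>

definition lattice_shift :: "real option \<Rightarrow> int \<Rightarrow> real" where
  "lattice_shift c k = (case c of None \<Rightarrow> 0 | Some l \<Rightarrow> of_int k * l)"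

text \<open>On a circle the arc of half-width d around a is encoded by comparing cosines. This makes
  it closed and periodic without mention of translates, and it is where the argument of the bump
  below is nonnegative.\<close>

definition near :: "real option \<Rightarrow> real \<Rightarrow> real \<Rightarrow> real set" where
  "near c a d = {x. case c of None \<Rightarrow> \<bar>x - a\<bar> \<le> d | Some l \<Rightarrow> cos (2 * pi * d / l) \<le> cos (2 * pi * (x - a) / l)}"

lemma closed_near: "closed (near c a d)"
  unfolding near_def by (cases c) (auto simp: divide_inverse intro!: closed_Collect_le continuous_intros)

lemma near_lattice_shift:
  assumes "x \<in> near c a d" "pos_circ c" "0 < d" "\<And>l. c = Some l \<Longrightarrow> d < l / 2"
  obtains k where "\<bar>x + lattice_shift c k - a\<bar> \<le> d"
proof (cases c)
  case None
  then show ?thesis using assms(1) that by (simp add: near_def lattice_shift_def)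
next
  case (Some l)
  then have l: "0 < l" using assms by (simp add: pos_circ_def)
  \<comment> \<open>Rounding brings x - a into the interval from - l / 2 to l / 2, where the cosine
    decreases with the distance, so that comparing cosines amounts to comparing distances.\<close>
  define k where "k = - round ((x - a) / l)"
  have "\<bar>of_int (round ((x - a) / l)) - (x - a) / l\<bar> \<le> 1 / 2"
    by (rule of_int_round_abs_le)
  then have k: "\<bar>(x - a) / l + of_int k\<bar> \<le> 1 / 2" by (simp add: k_def abs_minus_commute)
  have "2 * pi * \<bar>x + of_int k * l - a\<bar> / l = 2 * pi * \<bar>(x - a) / l + of_int k\<bar>"
  proof -
    have "(x - a) / l + of_int k = (x + of_int k * l - a) / l" using l by (simp add: field_simps)
    then show ?thesis using l by simp
  qed
  also have "\<dots> \<le> 2 * pi * (1 / 2)" by (intro mult_left_mono k) simp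
  finally have le_pi: "2 * pi * \<bar>x + of_int k * l - a\<bar> / l \<le> pi" by simp
  have "cos (2 * pi * \<bar>x + of_int k * l - a\<bar> / l) = cos (2 * pi * (x - a) / l)"
  proof -
    have "2 * pi * (x + of_int k * l - a) / l = 2 * pi * (x - a) / l + 2 * pi * of_int k"
      using l by (simp add: field_simps)
    moreover have "cos (2 * pi * (x - a) / l + 2 * pi * of_int k) = cos (2 * pi * (x - a) / l)"
      by (simp add: cos_add)
    moreover have "2 * pi * \<bar>x + of_int k * l - a\<bar> / l = \<bar>2 * pi * (x + of_int k * l - a) / l\<bar>"
      using l by (simp add: abs_mult)
    ultimately show ?thesis by simp
  qed
  with assms(1) Some have "cos (2 * pi * d / l) \<le> cos (2 * pi * \<bar>x + of_int k * l - a\<bar> / l)"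
    by (simp add: near_def)
  moreover have "0 \<le> 2 * pi * d / l" "2 * pi * d / l \<le> pi"
    using assms(3) assms(4)[OF Some] l by (auto simp: field_simps)
  ultimately have "2 * pi * \<bar>x + of_int k * l - a\<bar> / l \<le> 2 * pi * d / l"
    using le_pi l by (subst (asm) cos_mono_le_eq) auto
  then have "\<bar>x + of_int k * l - a\<bar> \<le> d" using l by (simp add: field_simps)
  then show ?thesis using that[of k] Some by (simp add: lattice_shift_def)
qed

lemma periodic1_lattice_shift: "periodic1 c h \<Longrightarrow> h (x + lattice_shift c k) = h x"
proof (cases c)
  case (Some l)
  assume h: "periodic1 c h"
  have *: "h (x + of_nat n * l) = h x" for n x
  proof (induction n)
    case (Suc n)
    have "x + of_nat (Suc n) * l = (x + of_nat n * l) + l" by (simp add: algebra_simps)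
    then show ?case using h Some Suc by (simp only: periodic1_def)
  qed simp
  show ?thesis
  proof (cases "0 \<le> k")
    case True then show ?thesis using *[of x "nat k"] Some by (simp add: lattice_shift_def)
  next
    case False then show ?thesis using *[of "x + of_int k * l" "nat (- k)"] Some by (simp add: lattice_shift_def)
  qed
qed (simp add: lattice_shift_def)

lemma continuous_on_bounded_interval:
  fixes f :: "real \<Rightarrow> real"
  assumes "continuous_on {a..b} f"
  shows "\<exists>B. \<forall>x\<in>{a..b}. \<bar>f x\<bar> \<le> B"
proof -
  have "bounded (f ` {a..b})"
    by (intro compact_imp_bounded compact_continuous_image assms) simp
  then show ?thesis by (auto simp: bounded_iff)
qed

lemma derivatives_support:
  fixes F :: "nat \<Rightarrow> real \<Rightarrow> real"
  assumes der: "\<And>n x. (F n has_real_derivative F (Suc n) x) (at x)"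
    and K: "closed K" and supp: "\<And>x. F 0 x \<noteq> 0 \<Longrightarrow> x \<in> K"
  shows "F n x \<noteq> 0 \<Longrightarrow> x \<in> K"
proof (induction n arbitrary: x)
  case 0 then show ?case by (rule supp)
next
  case (Suc n)
  show ?case
  proof (rule ccontr)
    assume x: "x \<notin> K"
    have "((\<lambda>x. 0) has_real_derivative 0) (at x)" by simp
    then have "(F n has_real_derivative 0) (at x)"
      by (rule has_field_derivative_transform_within_open[where S = "- K"]) (use Suc.IH K x in auto)
    then show False using der[of n x] Suc.prems by (metis DERIV_unique)
  qed
qed

text \<open>All bounds reduce to continuity on a compact interval: one containing the support on the
  line, one period on a circle. Periodicity passes to the derivatives because derivatives are
  unique.\<close>

lemma schwartz_family_if_supported:
  assumes c: "pos_circ c"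
    and der: "\<And>n x. (F n has_real_derivative F (Suc n) x) (at x)" and periodic1: "periodic1 c (F 0)"
    and supp: "\<And>x. c = None \<Longrightarrow> F 0 x \<noteq> 0 \<Longrightarrow> \<bar>x - a\<bar> \<le> d"
  shows "schwartz_family c F"
  unfolding schwartz_family_def
proof (intro conjI allI)
  have cont: "continuous_on S (F n)" for S n
    by (rule continuous_at_imp_continuous_on) (blast intro: DERIV_isCont der)
  show "(F n has_real_derivative F (Suc n) x) (at x)" for n x by (rule der)
  show periodic1': "periodic1 c (F n)" for n
  proof (induction n)
    case (Suc n)
    show ?case unfolding periodic1_def
    proof (intro allI impI)
      fix l x assume l: "c = Some l"
      have "((\<lambda>x. F n (x + l)) has_real_derivative F (Suc n) (x + l)) (at x)"
        using der[of n "x + l"] by (simp add: DERIV_shift)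
      moreover have "(\<lambda>x. F n (x + l)) = F n" using Suc l by (auto simp: periodic1_def)
      ultimately show "F (Suc n) (x + l) = F (Suc n) x" using der[of n x] by (metis DERIV_unique)
    qed
  qed (rule periodic1)
  fix n k
  show "\<exists>B. \<forall>x. weight1 c x ^ k * \<bar>F n x\<bar> \<le> B"
  proof (cases c)
    case None
    have "closed {x. \<bar>x - a\<bar> \<le> d}" by (intro closed_Collect_le continuous_intros)
    from derivatives_support[where F = F, OF der this] supp[OF None] have zero: "F n x = 0" if "\<not> \<bar>x - a\<bar> \<le> d" for x
      using that by blast
    have "continuous_on {a - d..a + d} (\<lambda>x. weight1 c x ^ k * \<bar>F n x\<bar>)"
      unfolding None weight1_def by (auto intro!: continuous_intros cont)
    from continuous_on_bounded_interval[OF this]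
    obtain B where B: "\<And>x. x \<in> {a - d..a + d} \<Longrightarrow> \<bar>weight1 c x ^ k * \<bar>F n x\<bar>\<bar> \<le> B" by blast
    have "weight1 c x ^ k * \<bar>F n x\<bar> \<le> max B 0" for x
    proof (cases "\<bar>x - a\<bar> \<le> d")
      case True
      then have "x \<in> {a - d..a + d}" by auto
      from B[OF this] show ?thesis by auto
    qed (simp add: zero)
    then show ?thesis by blast
  next
    case (Some l)
    then have l: "0 < l" using c by (simp add: pos_circ_def)
    obtain B where B: "\<And>x. x \<in> {0..l} \<Longrightarrow> \<bar>F n x\<bar> \<le> B"
      using continuous_on_bounded_interval[OF cont[of "{0..l}" n]] by blast
    have "\<bar>F n x\<bar> \<le> B" for x
    proof -
      define k where "k = - \<lfloor>x / l\<rfloor>"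
      have "0 \<le> x / l + of_int k" "x / l + of_int k \<le> 1"
        unfolding k_def using floor_correct[of "x / l"] by linarith+
      then have "x + of_int k * l \<in> {0..l}" using l by (simp add: field_simps)
      from B[OF this] show ?thesis using periodic1_lattice_shift[OF periodic1', of n x k] Some by (simp add: lattice_shift_def)
    qed
    then show ?thesis using Some by (auto simp: weight1_def)
  qed
qed

lemma bump_nonneg: "0 \<le> bump k x" by (simp add: bump_def)

text \<open>The function \<open>bump 0\<close> is applied to d^2 - (x - a)^2 on the line and to cos
  (p (x - a)) - cos (p d) with p = 2 pi / l on a circle, which is periodic from the outset. Symmetry
  about a will make the convolution square at 2 a the integral of a square.\<close>

lemma bump_family_exists:
  assumes c: "pos_circ c" and d: "0 < d" "\<And>l. c = Some l \<Longrightarrow> d < l / 2"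
  obtains G where "schwartz_family c G" "\<And>x. 0 \<le> G 0 x" "0 < G 0 a" "\<And>x. G 0 x \<noteq> 0 \<Longrightarrow> x \<in> near c a d"
    "\<And>x. G 0 (2 * a - x) = G 0 x"
proof (cases c)
  case None
  let ?h = "\<lambda>x. d\<^sup>2 + (- 1) * ((x + (- a)) * (x + (- a)))"
  have "\<exists>g\<in>fun_alg {\<lambda>x. x}. \<forall>x. (f has_real_derivative g x) (at x)" if "f \<in> {\<lambda>x. x}" for f
    by (rule bexI[OF _ fun_alg.const[of 1]]) (use that in auto)
  moreover have "?h \<in> fun_alg {\<lambda>x. x}"
    by (intro fun_alg.add fun_alg.mult fun_alg.const fun_alg.atom) auto
  ultimately have "\<exists>F. F 0 = (\<lambda>x. bump 0 (?h x)) \<and> (\<forall>n x. (F n has_real_derivative F (Suc n) x) (at x))"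
    by (rule bump_comp_derivatives)
  then obtain F where F: "F 0 = (\<lambda>x. bump 0 (?h x))" "\<And>n x. (F n has_real_derivative F (Suc n) x) (at x)"
    by auto
  have supp: "\<bar>x - a\<bar> \<le> d" if "F 0 x \<noteq> 0" for x
  proof -
    have "(x - a)\<^sup>2 < d\<^sup>2"
      using that by (auto simp: F(1) bump_def power2_eq_square split: if_splits)
    then have "\<bar>x - a\<bar> \<le> \<bar>d\<bar>" unfolding abs_le_square_iff by simp
    then show ?thesis using d by simp
  qed
  have "schwartz_family c F"
    by (rule schwartz_family_if_supported[where a = a and d = d]) (use c None supp in \<open>auto simp: periodic1_def intro: F(2)\<close>)
  then show ?thesis
  proof (rule that)
    fix x
    have "2 * a - x + - a = - (x + - a)" by simp
    then show "F 0 (2 * a - x) = F 0 x" unfolding F(1) by (simp only: minus_mult_minus)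
    show "0 \<le> F 0 x" unfolding F(1) by (rule bump_nonneg)
    show "0 < F 0 a" unfolding F(1) using d(1) by (simp add: bump_def)
    show "x \<in> near c a d" if "F 0 x \<noteq> 0" using supp[OF that] None by (simp add: near_def)
  qed
next
  case (Some l)
  then have l: "0 < l" using c by (simp add: pos_circ_def)
  define p where "p = 2 * pi / l"
  let ?C = "\<lambda>x. cos (p * (x - a))" and ?S = "\<lambda>x. sin (p * (x - a))"
  let ?h = "\<lambda>x. ?C x + - cos (p * d)"
  have 1: "(?C has_real_derivative - p * ?S x) (at x)" "(?S has_real_derivative p * ?C x) (at x)" for x
    by (auto intro!: derivative_eq_intros)
  have 2: "(\<lambda>x. - p * ?S x) \<in> fun_alg {?C, ?S}" "(\<lambda>x. p * ?C x) \<in> fun_alg {?C, ?S}"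
    by (intro fun_alg.mult fun_alg.const fun_alg.atom; simp)+
  have "\<exists>g\<in>fun_alg {?C, ?S}. \<forall>x. (f has_real_derivative g x) (at x)" if "f \<in> {?C, ?S}" for f
  proof -
    from that have "f = ?C \<or> f = ?S" by simp
    then show ?thesis
    proof
      assume "f = ?C" then show ?thesis using 1(1) by (intro bexI[OF _ 2(1)]) simp
    next
      assume "f = ?S" then show ?thesis using 1(2) by (intro bexI[OF _ 2(2)]) simp
    qed
  qed
  moreover have "?h \<in> fun_alg {?C, ?S}"
    by (intro fun_alg.add fun_alg.const fun_alg.atom) auto
  ultimately have "\<exists>F. F 0 = (\<lambda>x. bump 0 (?h x)) \<and> (\<forall>n x. (F n has_real_derivative F (Suc n) x) (at x))"
    by (rule bump_comp_derivatives)
  then obtain F where F: "F 0 = (\<lambda>x. bump 0 (?h x))" "\<And>n x. (F n has_real_derivative F (Suc n) x) (at x)"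
    by auto
  have pl: "p * l = 2 * pi" using l by (simp add: p_def)
  have "schwartz_family c F"
  proof (rule schwartz_family_if_supported[where a = 0 and d = 0])
    have "cos (p * (x + l - a)) = cos (p * (x - a))" for x
    proof -
      have "p * (x + l - a) = p * (x - a) + 2 * pi" using pl by (simp add: algebra_simps)
      then show ?thesis by simp
    qed
    then show "periodic1 c (F 0)" by (simp add: periodic1_def Some F(1))
  qed (use Some c F(2) in auto)
  then show ?thesis
  proof (rule that)
    have "cos (p * d) < cos 0"
      using d(1) d(2)[OF Some] l by (intro cos_monotone_0_pi) (auto simp: p_def field_simps)
    then show "0 < F 0 a" by (simp add: F(1) bump_def)
    have "cos (p * (2 * a - x - a)) = cos (p * (x - a))" for x
      using cos_minus[of "p * (x - a)"] by (simp add: algebra_simps)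
    then show "F 0 (2 * a - x) = F 0 x" for x by (simp only: F(1))
    show "x \<in> near c a d" if "F 0 x \<noteq> 0" for x
      using that by (auto simp: F(1) bump_def near_def Some p_def split: if_splits)
  qed (simp add: F(1) bump_nonneg)
qed

section \<open>Positivity of the kernel\<close>

lemma power_le_exp:
  fixes x :: real
  assumes "0 \<le> x" shows "x ^ n \<le> real n ^ n * exp x"
proof (cases "n = 0")
  case False
  have "(x / real n) ^ n \<le> (1 + x / real n) ^ n"
    using assms by (intro power_mono) auto
  also have "\<dots> \<le> exp x"
    using assms False by (intro exp_ge_one_plus_x_over_n_power_n) auto
  finally show ?thesis using False by (simp add: power_divide field_simps)
qed (use assms in simp)

lemma poly_growth: "\<exists>C N. 0 \<le> C \<and> (\<forall>x::real. \<bar>poly p x\<bar> \<le> C * (1 + x\<^sup>2) ^ N)"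
proof (induction p)
  case 0
  show ?case by (rule exI[of _ 0]) simp
next
  case (pCons a p)
  then obtain C N where C: "0 \<le> C" "\<And>x. \<bar>poly p x\<bar> \<le> C * (1 + x\<^sup>2) ^ N" by blast
  have "\<bar>poly (pCons a p) x\<bar> \<le> (\<bar>a\<bar> + C) * (1 + x\<^sup>2) ^ Suc N" for x
  proof -
    have "\<bar>x\<bar> \<le> 1 + x\<^sup>2"
      using zero_le_power2[of "\<bar>x\<bar> - 1"] by (simp add: power2_diff)
    then have "\<bar>x * poly p x\<bar> \<le> (1 + x\<^sup>2) * (C * (1 + x\<^sup>2) ^ N)"
      unfolding abs_mult by (intro mult_mono C) auto
    moreover have "\<bar>a\<bar> * 1 \<le> \<bar>a\<bar> * (1 + x\<^sup>2) ^ Suc N"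
      by (intro mult_left_mono one_le_power) auto
    ultimately show ?thesis
      by (simp add: algebra_simps)
  qed
  then show ?case using C(1) by (intro exI[of _ "\<bar>a\<bar> + C"] exI[of _ "Suc N"]) auto
qed

text \<open>The polynomial in front of the normal density of deviation r after n differentiations of
  p times that density.\<close>

primrec normal_poly :: "real \<Rightarrow> real poly \<Rightarrow> nat \<Rightarrow> real poly" where
  "normal_poly r p 0 = p"
| "normal_poly r p (Suc n) = pderiv (normal_poly r p n) - smult (1 / r\<^sup>2) (pCons 0 (normal_poly r p n))"

text \<open>A Gaussian beats every polynomial. This serves twice: for the decay of
  \<open>heat_symbol_kernel\<close> and for the transverse Gaussians in
  \<open>spread\<close>.\<close>

lemma schwartz_family_normal:
  assumes r: "0 < r"
  shows "schwartz_family None (\<lambda>n x. poly (normal_poly r p n) x * normal_density 0 r x)"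
  unfolding schwartz_family_def
proof (intro conjI allI)
  fix n x
  have N': "(normal_density 0 r has_real_derivative - (x / r\<^sup>2 * normal_density 0 r x)) (at x)"
    using r unfolding normal_density_def
    by (auto intro!: derivative_eq_intros simp: field_simps power2_eq_square)
  show "((\<lambda>x. poly (normal_poly r p n) x * normal_density 0 r x) has_real_derivative
     poly (normal_poly r p (Suc n)) x * normal_density 0 r x) (at x)"
    using DERIV_mult[OF poly_DERIV[of "normal_poly r p n" x] N'] by (simp add: algebra_simps)
next
  fix n show "periodic1 None (\<lambda>x. poly (normal_poly r p n) x * normal_density 0 r x)" by (simp add: periodic1_def)
next
  fix n k
  obtain C N where C: "0 \<le> C" "\<And>x. \<bar>poly (normal_poly r p n) x\<bar> \<le> C * (1 + x\<^sup>2) ^ N"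
    using poly_growth by blast
  define c where "c = 1 / (2 * r\<^sup>2)"
  have c: "0 < c" using r by (simp add: c_def)
  \<comment> \<open>With y = 1 + x^2 the density is a multiple of exp (- c y), the polynomial is at
    most C y^N, and y^j exp (- c y) is at most (j / c)^j for j = k + N.\<close>
  define K where "K = C * (real (k + N) ^ (k + N) / c ^ (k + N)) * exp c / sqrt (2 * pi * r\<^sup>2)"
  have "weight1 None x ^ k * \<bar>poly (normal_poly r p n) x * normal_density 0 r x\<bar> \<le> K" for x
  proof -
    let ?y = "1 + x\<^sup>2"
    have y: "0 < ?y" by (simp add: add_pos_nonneg)
    have N: "normal_density 0 r x = exp c * exp (- (c * ?y)) / sqrt (2 * pi * r\<^sup>2)"
    proof -
      have "- (x - 0)\<^sup>2 / (2 * r\<^sup>2) = c + - (c * ?y)" by (simp add: c_def add_divide_distrib distrib_left)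
      then show ?thesis unfolding normal_density_def exp_add[symmetric] by simp
    qed
    have "(c * ?y) ^ (k + N) \<le> real (k + N) ^ (k + N) * exp (c * ?y)"
      using c y by (intro power_le_exp) simp
    then have "?y ^ (k + N) \<le> real (k + N) ^ (k + N) / c ^ (k + N) * exp (c * ?y)"
      using c by (simp only: power_mult_distrib) (simp add: field_simps)
    then have le: "?y ^ (k + N) * exp (- (c * ?y)) \<le> real (k + N) ^ (k + N) / c ^ (k + N)"
      by (simp add: exp_minus divide_inverse[symmetric] pos_divide_le_eq del: power_add)
    have "?y ^ k * \<bar>poly (normal_poly r p n) x * normal_density 0 r x\<bar>
        \<le> ?y ^ k * (C * ?y ^ N * normal_density 0 r x)"
      unfolding abs_mult using y C(1) by (intro mult_left_mono mult_mono C) auto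
    also have "\<dots> = C * (?y ^ (k + N) * exp (- (c * ?y))) * (exp c / sqrt (2 * pi * r\<^sup>2))"
      unfolding N power_add by (simp only: times_divide_eq_right mult_ac)
    also have "\<dots> \<le> C * (real (k + N) ^ (k + N) / c ^ (k + N)) * (exp c / sqrt (2 * pi * r\<^sup>2))"
      using C(1) by (intro mult_right_mono mult_left_mono le) auto
    finally show ?thesis by (simp add: weight1_def K_def)
  qed
  then show "\<exists>B. \<forall>x. weight1 None x ^ k * \<bar>poly (normal_poly r p n) x * normal_density 0 r x\<bar> \<le> B" by blast
qed

text \<open>The kernel of \<open>(- \<partial>\<^sup>2 + m\<^sup>2) exp (s \<partial>\<^sup>2)\<close> for \<open>r\<^sup>2 = 2 s\<close>.\<close>

definition heat_symbol_kernel :: "real \<Rightarrow> real \<Rightarrow> real \<Rightarrow> real" where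
  "heat_symbol_kernel m r z = (m\<^sup>2 + 1 / r\<^sup>2 - z\<^sup>2 / r ^ 4) * normal_density 0 r z"

lemma heat_symbol_kernel_decay:
  assumes r: "0 < r"
  obtains C where "0 \<le> C" "\<And>z. \<bar>heat_symbol_kernel m r z\<bar> \<le> C / (1 + z\<^sup>2)"
    and "continuous_on UNIV (heat_symbol_kernel m r)"
proof -
  let ?p = "[:m\<^sup>2 + 1 / r\<^sup>2, 0, - (1 / r ^ 4):]"
  have eq: "heat_symbol_kernel m r = (\<lambda>x. poly (normal_poly r ?p 0) x * normal_density 0 r x)"
    by (simp add: heat_symbol_kernel_def fun_eq_iff power2_eq_square)
  show ?thesis
  proof (rule schwartz_family_decay[OF schwartz_family_normal[OF r, of ?p], of 0 1])
    fix B assume B: "0 \<le> B" "\<And>x. \<bar>poly (normal_poly r ?p 0) x * normal_density 0 r x\<bar> \<le> B / weight1 None x ^ 1"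
    show ?thesis
    proof (rule that[OF B(1)])
      show "\<bar>heat_symbol_kernel m r z\<bar> \<le> B / (1 + z\<^sup>2)" for z
        using B(2)[of z] unfolding eq by (simp add: weight1_def)
      show "continuous_on UNIV (heat_symbol_kernel m r)"
        unfolding eq by (rule schwartz_family_continuous[OF schwartz_family_normal[OF r]])
    qed
  qed
qed

section \<open>Periodization of a kernel\<close>

lemma integral_indicator_shift:
  fixes h :: "real \<Rightarrow> real"
  shows "(\<integral>z. indicator {a..<a + l} z * h z \<partial>lborel) = (\<integral>z. indicator {0..<l} z * h (a + z) \<partial>lborel)"
proof -
  have "indicator {a..<a + l} (a + z) = (indicator {0..<l} z :: real)" for z
    by (auto simp: indicator_def)
  then show ?thesis
    using lborel_integral_real_affine[of 1 "\<lambda>z. indicator {a..<a + l} z * h z" a] by simp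
qed

text \<open>The translates by \<open>n l\<close> and \<open>- (n + 1) l\<close> with \<open>n \<ge> 0\<close> exhaust all translates by multiples of \<open>l\<close>.\<close>

definition fold_term :: "(real \<Rightarrow> real) \<Rightarrow> real \<Rightarrow> nat \<Rightarrow> real \<Rightarrow> real" where
  "fold_term q l n z = q (z + real n * l) + q (z - real (Suc n) * l)"

text \<open>By induction: the window grows by one period at each end, and since w is periodic both
  new pieces can be shifted back to the cell, where they form one \<open>fold_term\<close>.\<close>

lemma fold_partial_sum:
  fixes q w :: "real \<Rightarrow> real"
  assumes l: "0 < l" and periodic1: "periodic1 (Some l) w" and int: "integrable lborel (\<lambda>z. q z * w z)"
  shows "(\<integral>z. indicator {- (real N * l)..<real N * l} z * (q z * w z) \<partial>lborel)
    = (\<integral>z. indicator {0..<l} z * ((\<Sum>n<N. fold_term q l n z) * w z) \<partial>lborel)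
    \<and> integrable lborel (\<lambda>z. indicator {0..<l} z * ((\<Sum>n<N. fold_term q l n z) * w z))"
proof (induction N)
  case 0
  show ?case by simp
next
  case (Suc N)
  have iint: "integrable lborel (\<lambda>z. indicator {u..<v} z * (q z * w z))" for u v :: real
    using integrable_mult_indicator[of "{u..<v}" lborel "\<lambda>z. q z * w z"] int by simp
  have shift: "(\<integral>z. indicator {a..<a + l} z * (q z * w z) \<partial>lborel)
       = (\<integral>z. indicator {0..<l} z * (q (z + a) * w z) \<partial>lborel)
     \<and> integrable lborel (\<lambda>z. indicator {0..<l} z * (q (z + a) * w z))" if "\<exists>k. a = lattice_shift (Some l) k" for a
  proof -
    have w: "w (z + a) = w z" for z
      using that periodic1_lattice_shift[OF periodic1] by metis
    have ind: "indicator {a..<a + l} (z + a) = (indicator {0..<l} z :: real)" for z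
      by (auto simp: indicator_def)
    have "integrable lborel (\<lambda>z. indicator {a..<a + l} (a + 1 * z) * (q (a + 1 * z) * w (a + 1 * z)))"
      by (rule lborel_integrable_real_affine[OF iint]) simp
    then show ?thesis
      unfolding integral_indicator_shift by (simp add: w ind[unfolded add.commute[of a l]] add.commute[of a])
  qed
  have s1: "\<exists>k. real N * l = lattice_shift (Some l) k" "\<exists>k. - (real (Suc N) * l) = lattice_shift (Some l) k"
    by (rule exI[of _ "int N"], simp add: lattice_shift_def) (rule exI[of _ "- int (Suc N)"], simp add: lattice_shift_def algebra_simps)
  have split: "indicator {- (real (Suc N) * l)..<real (Suc N) * l} z * h
     = indicator {- (real N * l)..<real N * l} z * h
      + (indicator {real N * l..<real N * l + l} z * h
      + indicator {- (real (Suc N) * l)..<- (real (Suc N) * l) + l} z * h)" for z h :: real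
  proof -
    define y where "y = real N * l"
    have y: "0 \<le> y" "real (Suc N) * l = y + l" using l by (simp_all add: y_def algebra_simps)
    show ?thesis unfolding y_def[symmetric] y(2) using y(1) l by (auto simp: indicator_def)
  qed
  have split2: "indicator {0..<l} z * ((\<Sum>n<Suc N. fold_term q l n z) * w z)
     = indicator {0..<l} z * ((\<Sum>n<N. fold_term q l n z) * w z)
      + (indicator {0..<l} z * (q (z + real N * l) * w z)
      + indicator {0..<l} z * (q (z + - (real (Suc N) * l)) * w z))" for z
    by (simp add: fold_term_def algebra_simps)
  show ?case
    unfolding split split2 using Suc shift[OF s1(1)] shift[OF s1(2)] iint
    by (simp add: Bochner_Integration.integral_add)
qed

lemma summable_fold_bound:
  assumes "0 < l" shows "summable (\<lambda>n. C / (1 + (real n * l)\<^sup>2))"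
proof (rule summable_comparison_test)
  show "\<exists>N. \<forall>n\<ge>N. norm (C / (1 + (real n * l)\<^sup>2)) \<le> \<bar>C\<bar> / l\<^sup>2 * inverse (real n ^ 2)"
  proof (intro exI[of _ 1] allI impI)
    fix n :: nat assume "1 \<le> n"
    then have "0 < (real n * l)\<^sup>2" using assms by simp
    then have "\<bar>C\<bar> / (1 + (real n * l)\<^sup>2) \<le> \<bar>C\<bar> / (real n * l)\<^sup>2"
      by (intro divide_left_mono mult_pos_pos add_pos_pos) auto
    then show "norm (C / (1 + (real n * l)\<^sup>2)) \<le> \<bar>C\<bar> / l\<^sup>2 * inverse (real n ^ 2)"
      by (simp add: power_mult_distrib field_simps abs_of_nonneg)
  qed
  show "summable (\<lambda>n. \<bar>C\<bar> / l\<^sup>2 * inverse (real n ^ 2))"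
    by (intro summable_mult inverse_power_summable) simp
qed

text \<open>Q is the sum of all translates of q, continuous on a closed period by the Weierstrass
  test. It is chosen before w because the same Q is paired with 1 + cos (p z) to find a point of
  positivity and then with the convolution square of the bump.\<close>

lemma periodization:
  fixes q :: "real \<Rightarrow> real"
  assumes l: "0 < l" and q: "continuous_on UNIV q" "\<And>z. \<bar>q z\<bar> \<le> C / (1 + z\<^sup>2)" "0 \<le> C"
  obtains Q :: "real \<Rightarrow> real" where "continuous_on {0..l} Q"
    and "\<And>(w :: real \<Rightarrow> real) B. continuous_on UNIV w \<Longrightarrow> periodic1 (Some l) w \<Longrightarrow> (\<And>z. \<bar>w z\<bar> \<le> B) \<Longrightarrow>
      (\<integral>z. q z * w z \<partial>lborel) = (\<integral>z. indicator {0..<l} z * (Q z * w z) \<partial>lborel)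
      \<and> integrable lborel (\<lambda>z. indicator {0..<l} z * (Q z * w z))"
proof -
  let ?f = "fold_term q l"
  \<comment> \<open>For z in [0, l] both translates in the n-th term are evaluated at distance at
    least n l from 0, hence the factor 2.\<close>
  define M where "M = (\<lambda>n. 2 * C / (1 + (real n * l)\<^sup>2))"
  have bound: "norm (?f n z) \<le> M n" if z: "z \<in> {0..l}" for n z
  proof -
    have *: "\<bar>q y\<bar> \<le> C / (1 + (real n * l)\<^sup>2)" if "real n * l \<le> \<bar>y\<bar>" for y
    proof -
      have "(real n * l)\<^sup>2 \<le> y\<^sup>2"
        using that l power_mono[of "real n * l" "\<bar>y\<bar>" 2] by simp
      then have "C / (1 + y\<^sup>2) \<le> C / (1 + (real n * l)\<^sup>2)"
        using q(3) by (intro divide_left_mono) (auto simp: add_pos_nonneg)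
      then show ?thesis using q(2)[of y] by linarith
    qed
    have nl: "0 \<le> real n * l" using l by simp
    have e: "real (Suc n) * l = real n * l + l" by (simp add: algebra_simps)
    have "\<bar>q (z + real n * l)\<bar> \<le> C / (1 + (real n * l)\<^sup>2)"
      using z nl by (intro *) auto
    moreover have "\<bar>q (z - real (Suc n) * l)\<bar> \<le> C / (1 + (real n * l)\<^sup>2)"
      unfolding e using z nl by (intro *) auto
    ultimately show ?thesis unfolding fold_term_def M_def by simp
  qed
  have sM: "summable M" unfolding M_def by (rule summable_fold_bound[OF l])
  define Q where "Q = (\<lambda>z. \<Sum>n. ?f n z)"
  have ul: "uniform_limit {0..l} (\<lambda>N z. \<Sum>n<N. ?f n z) Q sequentially"
    unfolding Q_def by (rule Weierstrass_m_test[OF bound sM])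
  have contf: "continuous_on S (?f n)" for S n
    unfolding fold_term_def
    by (intro continuous_intros continuous_on_compose2[OF q(1)]) auto
  show ?thesis
  proof (rule that)
    show contQ: "continuous_on {0..l} Q"
      by (rule uniform_limit_theorem[OF always_eventually ul]) (auto intro!: continuous_intros contf)
    fix w :: "real \<Rightarrow> real" and B assume w: "continuous_on UNIV w" "periodic1 (Some l) w" "\<And>z. \<bar>w z\<bar> \<le> B"
    have B: "0 \<le> B" using w(3)[of 0] by simp
    note [measurable] = borel_measurable_continuous_onI[OF q(1)] borel_measurable_continuous_onI[OF w(1)]
    have [measurable]: "?f n \<in> borel_measurable borel" for n
      by (intro borel_measurable_continuous_onI contf)
    have int: "integrable lborel (\<lambda>z. q z * w z)"
    proof (rule Bochner_Integration.integrable_bound)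
      have i1: "integrable lborel (\<lambda>z::real. 1 / (1 + z\<^sup>2))"
        using integrable_inverse_weight1[of None] by (simp add: cell1_def weight1_def)
      show "integrable lborel (\<lambda>z. C * B * (1 / (1 + z\<^sup>2)))"
        by (intro integrable_mult_right i1)
      show "AE z in lborel. norm (q z * w z) \<le> norm (C * B * (1 / (1 + z\<^sup>2)))"
      proof (rule AE_I2)
        fix z
        have "\<bar>q z * w z\<bar> \<le> C / (1 + z\<^sup>2) * B"
          unfolding abs_mult using q(3) by (intro mult_mono q w) auto
        also have "\<dots> = C * B * (1 / (1 + z\<^sup>2))" by simp
        finally show "norm (q z * w z) \<le> norm (C * B * (1 / (1 + z\<^sup>2)))"
          using abs_ge_self[of "C * B * (1 / (1 + z\<^sup>2))"] unfolding real_norm_def by (rule order_trans)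
      qed
    qed simp
    let ?g = "\<lambda>N z. indicator {0..<l} z * ((\<Sum>n<N. ?f n z) * w z)"
    have lim_pt: "(\<lambda>N. ?g N z) \<longlonglongrightarrow> indicator {0..<l} z * (Q z * w z)" for z
    proof (cases "z \<in> {0..<l}")
      case True
      then have "(\<lambda>N. \<Sum>n<N. ?f n z) \<longlonglongrightarrow> Q z" by (intro tendsto_uniform_limitI[OF ul]) auto
      then show ?thesis by (intro tendsto_intros)
    qed simp
    have measQ: "(\<lambda>z. indicator {0..<l} z * (Q z * w z)) \<in> borel_measurable lborel"
      by (rule borel_measurable_LIMSEQ_real[OF lim_pt]) simp
    have dom: "norm (?g N z) \<le> indicator {0..<l} z * (suminf M * B)" for N z
    proof (cases "z \<in> {0..<l}")
      case True
      have M0: "0 \<le> M n" for n using q(3) by (simp add: M_def)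
      have "\<bar>\<Sum>n<N. ?f n z\<bar> \<le> (\<Sum>n<N. M n)"
        using bound True by (intro order_trans[OF sum_abs sum_mono]) auto
      also have "\<dots> \<le> suminf M" using sM M0 by (intro sum_le_suminf) auto
      finally have "\<bar>(\<Sum>n<N. ?f n z) * w z\<bar> \<le> suminf M * B"
        unfolding abs_mult using w(3) by (intro mult_mono) auto
      then show ?thesis using True by simp
    qed simp
    have dom_int: "integrable lborel (\<lambda>z. indicator {0..<l} z * (suminf M * B))"
      using l by (intro integrable_mult_left integrable_real_indicator) auto
    have L1: "(\<lambda>N. \<integral>z. ?g N z \<partial>lborel) \<longlonglongrightarrow> (\<integral>z. indicator {0..<l} z * (Q z * w z) \<partial>lborel)"
      by (rule integral_dominated_convergence[where w = "\<lambda>z. indicator {0..<l} z * (suminf M * B)"])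
        (use measQ dom_int lim_pt dom in auto)
    have intQ: "integrable lborel (\<lambda>z. indicator {0..<l} z * (Q z * w z))"
      by (rule integrable_dominated_convergence[where w = "\<lambda>z. indicator {0..<l} z * (suminf M * B)" and s = ?g])
        (use measQ dom_int lim_pt dom in auto)
    have L2: "(\<lambda>N. \<integral>z. indicator {- (real N * l)..<real N * l} z * (q z * w z) \<partial>lborel)
      \<longlonglongrightarrow> (\<integral>z. q z * w z \<partial>lborel)"
    proof (rule integral_dominated_convergence[where w = "\<lambda>z. \<bar>q z * w z\<bar>"])
      show "AE z in lborel. (\<lambda>N. indicator {- (real N * l)..<real N * l} z * (q z * w z)) \<longlonglongrightarrow> q z * w z"
      proof (rule AE_I2)
        fix z
        obtain N0 :: nat where N0: "\<bar>z\<bar> / l < real N0" using reals_Archimedean2 by blast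
        have "indicator {- (real N * l)..<real N * l} z * (q z * w z) = q z * w z" if "N0 \<le> N" for N
        proof -
          have "\<bar>z\<bar> / l < real N" using N0 that by linarith
          then have "\<bar>z\<bar> < real N * l" using l by (simp add: field_simps)
          then have "z \<in> {- (real N * l)..<real N * l}" by auto
          then show ?thesis by simp
        qed
        then show "(\<lambda>N. indicator {- (real N * l)..<real N * l} z * (q z * w z)) \<longlonglongrightarrow> q z * w z"
          by (intro tendsto_eventually) (auto simp: eventually_sequentially)
      qed
    qed (use int in \<open>auto simp: indicator_def\<close>)
    show "(\<integral>z. q z * w z \<partial>lborel) = (\<integral>z. indicator {0..<l} z * (Q z * w z) \<partial>lborel)
      \<and> integrable lborel (\<lambda>z. indicator {0..<l} z * (Q z * w z))"
      using LIMSEQ_unique[OF L2] L1 intQ fold_partial_sum[OF l w(2) int] by simp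
  qed
qed

section \<open>The kernel against the lowest Fourier modes\<close>

lemma schwartz_family_cos: "schwartz_family (Some 0) (\<lambda>n x. p ^ n * cos (p * x + real n * (pi / 2)))"
  unfolding schwartz_family_def
proof (intro conjI allI)
  fix n x
  have "cos (p * x + real (Suc n) * (pi / 2)) = - sin (p * x + real n * (pi / 2))"
  proof -
    have "p * x + real (Suc n) * (pi / 2) = (p * x + real n * (pi / 2)) + pi / 2"
      by (simp add: algebra_simps)
    then show ?thesis by (simp only: cos_add sin_pi_half cos_pi_half mult_zero_right mult_1_right diff_0)
  qed
  moreover have "((\<lambda>x. p ^ n * cos (p * x + real n * (pi / 2))) has_real_derivative
    p ^ n * (- sin (p * x + real n * (pi / 2)) * p)) (at x)"
    by (auto intro!: derivative_eq_intros)
  ultimately show "((\<lambda>x. p ^ n * cos (p * x + real n * (pi / 2))) has_real_derivative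
    p ^ Suc n * cos (p * x + real (Suc n) * (pi / 2))) (at x)"
    by (simp add: mult_ac)
next
  fix n show "periodic1 (Some 0) (\<lambda>x. p ^ n * cos (p * x + real n * (pi / 2)))" by (simp add: periodic1_def)
next
  fix n k
  have "\<bar>p ^ n * cos (p * x + real n * (pi / 2))\<bar> \<le> \<bar>p ^ n\<bar>" for x
    using mult_left_mono[OF abs_cos_le_one, of "\<bar>p ^ n\<bar>" "p * x + real n * (pi / 2)"] by (simp add: abs_mult)
  then show "\<exists>B. \<forall>x. weight1 (Some 0) x ^ k * \<bar>p ^ n * cos (p * x + real n * (pi / 2))\<bar> \<le> B"
    by (auto simp: weight1_def)
qed

lemma gauss_mean_cmult: "gauss_mean r (\<lambda>x. a * h x) = a * gauss_mean r h"
  unfolding gauss_mean_def by (simp add: mult.left_commute)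

text \<open>By \<open>gauss_mean_deriv\<close> the mean solves y' = - p^2 r y in the variable r,
  with y(0) = 1.\<close>

lemma gauss_mean_cos: "gauss_mean r (\<lambda>x. cos (p * x)) = exp (- (p\<^sup>2 * r\<^sup>2 / 2))"
proof -
  let ?\<phi> = "\<lambda>r. gauss_mean r (\<lambda>x. cos (p * x))"
  have "(?\<phi> has_real_derivative r * (- (p\<^sup>2) * ?\<phi> r)) (at r)" for r
    using gauss_mean_deriv[OF schwartz_family_cos, of p 0 r] gauss_mean_cmult[of r "- (p\<^sup>2)" "\<lambda>x. cos (p * x)"]
    by (simp add: power2_eq_square)
  moreover have "((\<lambda>r. exp (p\<^sup>2 * r\<^sup>2 / 2)) has_real_derivative p\<^sup>2 * r * exp (p\<^sup>2 * r\<^sup>2 / 2)) (at r)" for r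
    by (auto intro!: derivative_eq_intros simp: power2_eq_square)
  ultimately have "((\<lambda>r. ?\<phi> r * exp (p\<^sup>2 * r\<^sup>2 / 2)) has_real_derivative
     r * (- (p\<^sup>2) * ?\<phi> r) * exp (p\<^sup>2 * r\<^sup>2 / 2) + p\<^sup>2 * r * exp (p\<^sup>2 * r\<^sup>2 / 2) * ?\<phi> r) (at r)" for r
    by (rule DERIV_mult)
  then have "((\<lambda>r. ?\<phi> r * exp (p\<^sup>2 * r\<^sup>2 / 2)) has_real_derivative 0) (at r)" for r
    by (simp add: algebra_simps)
  then have "?\<phi> r * exp (p\<^sup>2 * r\<^sup>2 / 2) = ?\<phi> 0 * exp (p\<^sup>2 * 0\<^sup>2 / 2)"
    using DERIV_isconst_all[of "\<lambda>r. ?\<phi> r * exp (p\<^sup>2 * r\<^sup>2 / 2)" r 0] by blast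
  then show ?thesis by (simp add: gauss_mean_0 exp_minus field_simps)
qed

lemma schwartz_family_const_plus:
  assumes "schwartz_family (Some 0) F"
  shows "schwartz_family (Some 0) (\<lambda>n x. (if n = 0 then a else 0) + F n x)"
proof -
  have "schwartz_family (Some 0) (\<lambda>n x. if n = 0 then a else 0)"
    by (auto simp: schwartz_family_def periodic1_def weight1_def)
  from schwartz_family_lincomb[OF this assms, of 1 1] show ?thesis by simp
qed

text \<open>Read backwards, \<open>gauss_mean_by_parts\<close> lets the operator act on 1 + cos (p
  z) instead of the density. Both modes are eigenfunctions, with eigenvalues m^2 and m^2 +
  p^2.\<close>

lemma heat_symbol_kernel_cos:
  assumes r: "0 < r"
  shows "(\<integral>z. heat_symbol_kernel m r z * (1 + cos (p * z)) \<partial>lborel)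
    = m\<^sup>2 + (m\<^sup>2 + p\<^sup>2) * exp (- (p\<^sup>2 * r\<^sup>2 / 2))"
proof -
  let ?F = "\<lambda>n x. (if n = 0 then 1 else 0) + p ^ n * cos (p * x + real n * (pi / 2))"
  have F: "schwartz_family (Some 0) ?F" by (rule schwartz_family_const_plus[OF schwartz_family_cos])
  have "(\<integral>z. heat_symbol_kernel m r z * (1 + cos (p * z)) \<partial>lborel)
      = gauss_mean r (\<lambda>x. m\<^sup>2 * ?F 0 x + (- 1) * ?F 2 x)"
    unfolding gauss_mean_by_parts[OF F r] heat_symbol_kernel_def by simp
  also have "(\<lambda>x. m\<^sup>2 * ?F 0 x + (- 1) * ?F 2 x) = (\<lambda>x. m\<^sup>2 + (m\<^sup>2 + p\<^sup>2) * cos (p * x))"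
    by (simp add: algebra_simps)
  also have "gauss_mean r \<dots> = gauss_mean r (\<lambda>x. m\<^sup>2) + (m\<^sup>2 + p\<^sup>2) * gauss_mean r (\<lambda>x. cos (p * x))"
  proof -
    have "integrable lborel (\<lambda>z. std_normal_density z * ((m\<^sup>2 + p\<^sup>2) * cos (p * (r * z))))"
      by (rule integrable_normal_mult[where B = "m\<^sup>2 + p\<^sup>2"]) (auto simp: abs_mult mult_left_le)
    then show ?thesis
      unfolding gauss_mean_cmult[symmetric]
      by (simp add: gauss_mean_def distrib_left integrable_normal_density Bochner_Integration.integral_add)
  qed
  finally show ?thesis by (simp add: gauss_mean_const gauss_mean_cos)
qed

lemma integral_pos_near:
  fixes q W :: "real \<Rightarrow> real"
  assumes qW: "continuous_on {u..v} q" "continuous_on {u..v} W" "u < z" "z < v" "0 < q z" "0 < W z"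
    and int: "integrable lborel (\<lambda>x. indicator A x * (q x * W x))" and A: "{u<..<v} \<subseteq> A"
    and nonneg: "\<And>x. x \<in> A \<Longrightarrow> 0 \<le> q x * W x"
  shows "0 < (\<integral>x. indicator A x * (q x * W x) \<partial>lborel)"
proof -
  have "continuous_on {u..v} (\<lambda>x. q x * W x)" by (intro continuous_intros qW)
  then obtain e where e: "0 < e" "u < z - e" "z + e < v" "\<And>y. \<bar>y - z\<bar> \<le> e \<Longrightarrow> q z * W z / 2 \<le> q y * W y"
    using continuous_pos_nbhd[of u v "\<lambda>x. q x * W x" z] qW by (smt (verit) mult_pos_pos)
  show ?thesis
  proof (rule integral_pos_if_bounded_below[OF int, of "z - e" "z + e" "q z * W z / 2"])
    fix y assume y: "z - e \<le> y" "y \<le> z + e"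
    then have "y \<in> A" using A e by auto
    then show "q z * W z / 2 \<le> indicator A y * (q y * W y)" using e(4)[of y] y by auto
  qed (use e qW nonneg in \<open>auto simp: indicator_def\<close>)
qed

text \<open>Positivity near 2 a is phrased through functions W on the whole line so that line and
  circle share one statement: against a periodic W the kernel acts through its periodization. The
  radius is doubled because W will be the convolution square of a bump of radius d at a.\<close>

definition kernel_pos_near :: "real option \<Rightarrow> real \<Rightarrow> real \<Rightarrow> real \<Rightarrow> real \<Rightarrow> bool" where
  "kernel_pos_near c m r a d \<longleftrightarrow> (\<forall>W B. continuous_on UNIV W \<longrightarrow> periodic1 c W \<longrightarrow> (\<forall>z. 0 \<le> W z) \<longrightarrow>
     (\<forall>z. \<bar>W z\<bar> \<le> B) \<longrightarrow> 0 < W (2 * a) \<longrightarrow>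
     (\<forall>z. W z \<noteq> 0 \<longrightarrow> (\<exists>k. \<bar>z + lattice_shift c k - 2 * a\<bar> \<le> 2 * d)) \<longrightarrow>
     0 < (\<integral>z. heat_symbol_kernel m r z * W z \<partial>lborel))"

lemma kernel_localized:
  assumes c: "pos_circ c" and r: "0 < r"
  obtains a d where "0 < d" "d < a" "\<And>l. c = Some l \<Longrightarrow> a + d < l / 2"
    "kernel_pos_near c m r a d"
proof (cases c)
  case None
  obtain C where C: "0 \<le> C" "\<And>z. \<bar>heat_symbol_kernel m r z\<bar> \<le> C / (1 + z\<^sup>2)"
    and cont: "continuous_on UNIV (heat_symbol_kernel m r)"
    by (metis heat_symbol_kernel_decay[OF r])
  \<comment> \<open>With a = r / 4 and d = r / 8 the relevant z lie between r / 4 and 3 r / 4, while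
    1 / r^2 - z^2 / r^4 is positive for |z| < r.\<close>
  have pos: "0 < heat_symbol_kernel m r z" if "\<bar>z - 2 * (r / 4)\<bar> \<le> 2 * (r / 8)" for z
  proof -
    have "\<bar>z\<bar> < r" using that r by (auto simp: field_simps abs_if split: if_splits)
    then have "z\<^sup>2 < r\<^sup>2" using r power_strict_mono[of "\<bar>z\<bar>" r 2] by simp
    then have "z\<^sup>2 / r ^ 4 < r\<^sup>2 / r ^ 4" using r by (intro divide_strict_right_mono) auto
    also have "r\<^sup>2 / r ^ 4 = 1 / r\<^sup>2" using r by (simp add: field_simps power2_eq_square power4_eq_xxxx)
    finally have "0 < m\<^sup>2 + 1 / r\<^sup>2 - z\<^sup>2 / r ^ 4" by (smt (verit) zero_le_power2)
    then show ?thesis unfolding heat_symbol_kernel_def using r by (simp add: normal_density_pos)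
  qed
  show ?thesis
  proof (rule that[of "r / 8" "r / 4"])
    show "kernel_pos_near c m r (r / 4) (r / 8)"
      unfolding kernel_pos_near_def
    proof (intro allI impI)
    fix W :: "real \<Rightarrow> real" and B
    assume W: "continuous_on UNIV W" "periodic1 c W" "\<forall>z. 0 \<le> W z" "\<forall>z. \<bar>W z\<bar> \<le> B" "0 < W (2 * (r / 4))"
      and supp: "\<forall>z. W z \<noteq> 0 \<longrightarrow> (\<exists>k. \<bar>z + lattice_shift c k - 2 * (r / 4)\<bar> \<le> 2 * (r / 8))"
    let ?q = "heat_symbol_kernel m r"
    note [measurable] = borel_measurable_continuous_onI[OF cont] borel_measurable_continuous_onI[OF W(1)]
    have "integrable lborel (\<lambda>z. indicator UNIV z * (?q z * W z))"
    proof -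
      have "\<bar>?q z * W z\<bar> \<le> C * B / weight1 None z" for z
      proof -
        have "\<bar>?q z * W z\<bar> \<le> C / (1 + z\<^sup>2) * B" unfolding abs_mult using C W(4)[rule_format] by (intro mult_mono) auto
        then show ?thesis by (simp add: weight1_def)
      qed
      from integrable_cell[OF _ this] show ?thesis by (simp add: cell1_def)
    qed
    moreover have "0 \<le> ?q z * W z" for z
    proof (cases "W z = 0")
      case False
      with supp[rule_format, OF this] None have "0 < ?q z" by (intro pos) (auto simp: lattice_shift_def)
      then show ?thesis using W(3)[rule_format, of z] by simp
    qed simp
    ultimately have "0 < (\<integral>z. indicator UNIV z * (?q z * W z) \<partial>lborel)"
      using r W pos[of "2 * (r / 4)"] cont
      by (intro integral_pos_near[of 0 r _ _ "2 * (r / 4)"]) (auto intro: continuous_on_subset)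
    then show "0 < (\<integral>z. ?q z * W z \<partial>lborel)" by simp
    qed
  qed (use r None in auto)
next
  case (Some l)
  then have l: "0 < l" using c by (simp add: pos_circ_def)
  let ?q = "heat_symbol_kernel m r"
  obtain C where C: "0 \<le> C" "\<And>z. \<bar>?q z\<bar> \<le> C / (1 + z\<^sup>2)" and cont: "continuous_on UNIV ?q"
    by (metis heat_symbol_kernel_decay[OF r])
  obtain Q :: "real \<Rightarrow> real" where Q: "continuous_on {0..l} Q"
    and fold: "\<And>(w :: real \<Rightarrow> real) B. continuous_on UNIV w \<Longrightarrow> periodic1 (Some l) w \<Longrightarrow> (\<And>z. \<bar>w z\<bar> \<le> B) \<Longrightarrow>
      (\<integral>z. ?q z * w z \<partial>lborel) = (\<integral>z. indicator {0..<l} z * (Q z * w z) \<partial>lborel)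
      \<and> integrable lborel (\<lambda>z. indicator {0..<l} z * (Q z * w z))"
    using periodization[OF l cont C(2,1)] by blast
  define p where "p = 2 * pi / l"
  have pl: "p * l = 2 * pi" using l by (simp add: p_def)
  \<comment> \<open>otherwise the integral of \<open>Q(z) (1 + cos (p z))\<close> would not be positive\<close>
  have "\<exists>z\<in>{0<..<l}. 0 < Q z"
  proof (rule ccontr)
    assume neg: "\<not> (\<exists>z\<in>{0<..<l}. 0 < Q z)"
    let ?w = "\<lambda>z. 1 + cos (p * z)"
    have periodic1: "periodic1 (Some l) ?w" by (simp add: periodic1_def distrib_left pl)
    have w2: "\<bar>?w z\<bar> \<le> 2" for z using cos_le_one[of "p * z"] cos_ge_minus_one[of "p * z"] by linarith
    have "continuous_on UNIV ?w" by (intro continuous_intros)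
    from fold[OF this periodic1 w2]
    have eq: "(\<integral>z. ?q z * ?w z \<partial>lborel) = (\<integral>z. indicator {0..<l} z * (Q z * ?w z) \<partial>lborel)" ..
    have "0 \<le> (\<integral>z. - (indicator {0..<l} z * (Q z * ?w z)) \<partial>lborel)"
    proof (rule integral_nonneg_AE)
      show "AE z in lborel. 0 \<le> - (indicator {0..<l} z * (Q z * ?w z))"
        using AE_lborel_singleton[of 0]
      proof eventually_elim
        case (elim z)
        have "0 \<le> ?w z" using cos_ge_minus_one[of "p * z"] by linarith
        moreover have "Q z \<le> 0" if "z \<in> {0..<l}"
        proof -
          have "z \<in> {0<..<l}" using elim that by simp
          then show ?thesis using neg by (meson not_le)
        qed
        ultimately show ?case by (auto simp: indicator_def mult_nonpos_nonneg)
      qed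
    qed
    then have "(\<integral>z. ?q z * ?w z \<partial>lborel) \<le> 0" unfolding eq by simp
    moreover have "0 < m\<^sup>2 + (m\<^sup>2 + p\<^sup>2) * exp (- (p\<^sup>2 * r\<^sup>2 / 2))"
      using l by (intro add_nonneg_pos mult_pos_pos) (auto simp: p_def)
    ultimately show False unfolding heat_symbol_kernel_cos[OF r] by linarith
  qed
  then obtain z0 where z0: "0 < z0" "z0 < l" "0 < Q z0" by auto
  obtain e where e: "0 < e" "0 < z0 - e" "z0 + e < l" "\<And>y. \<bar>y - z0\<bar> \<le> e \<Longrightarrow> Q z0 / 2 \<le> Q y"
    using continuous_pos_nbhd[OF Q z0] by blast
  \<comment> \<open>The bump goes to half of z0, as its convolution square is centred at twice its
    centre. The conditions 0 < z0 - e and z0 + e < l become d < a and a + d < l / 2.\<close>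
  show ?thesis
  proof (rule that[of "e / 2" "z0 / 2"])
    show "kernel_pos_near c m r (z0 / 2) (e / 2)"
      unfolding kernel_pos_near_def
    proof (intro allI impI)
    fix W :: "real \<Rightarrow> real" and B
    assume W: "continuous_on UNIV W" "periodic1 c W" "\<forall>z. 0 \<le> W z" "\<forall>z. \<bar>W z\<bar> \<le> B" "0 < W (2 * (z0 / 2))"
      and supp: "\<forall>z. W z \<noteq> 0 \<longrightarrow> (\<exists>k. \<bar>z + lattice_shift c k - 2 * (z0 / 2)\<bar> \<le> 2 * (e / 2))"
    have f: "(\<integral>z. ?q z * W z \<partial>lborel) = (\<integral>z. indicator {0..<l} z * (Q z * W z) \<partial>lborel)"
      "integrable lborel (\<lambda>z. indicator {0..<l} z * (Q z * W z))"
      using fold[OF W(1) _ W(4)[rule_format]] W(2) Some by auto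
    have "0 \<le> Q z * W z" if z: "z \<in> {0..<l}" for z
    proof (cases "W z = 0")
      case False
      with supp[rule_format, OF this] Some obtain k where k: "\<bar>z + of_int k * l - z0\<bar> \<le> e" by (auto simp: lattice_shift_def)
      \<comment> \<open>The interval of radius e around z0 lies inside the cell, so a point of the
        cell can only meet it without a shift: k = 0.\<close>
      have "0 \<le> z" "z < l" using z by auto
      then have "- 1 * l < of_int k * l" "of_int k * l < 1 * l" using k e(2,3) by linarith+
      then have "- 1 < (of_int k :: real)" "(of_int k :: real) < 1"
        unfolding mult_less_cancel_right_pos[OF l] .
      then have "k = 0" by linarith
      then have "Q z0 / 2 \<le> Q z" using k e(4) by simp
      then show ?thesis using z0(3) W(3)[rule_format, of z] by simp
    qed simp
    then show "0 < (\<integral>z. ?q z * W z \<partial>lborel)"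
      unfolding f(1) using z0 W Q f(2)
      by (intro integral_pos_near[of 0 l _ _ z0]) (auto intro: continuous_on_subset)
    qed
  qed (use e Some in \<open>auto simp: field_simps\<close>)
qed

definition pos_time :: "real option \<Rightarrow> real set" where
  "pos_time c = {x. \<exists>k. 0 \<le> x + lattice_shift c k \<and> (\<forall>l. c = Some l \<longrightarrow> x + lattice_shift c k \<le> l / 2)}"

lemma lattice_shift_add: "lattice_shift c j + lattice_shift c k = lattice_shift c (j + k)"
  by (auto simp: lattice_shift_def algebra_simps split: option.split)

lemma periodic1_conv: "periodic1 c b \<Longrightarrow> periodic1 c (conv c a b)"
  unfolding periodic1_def conv_def by (simp add: diff_add_eq[symmetric])

text \<open>The one-dimensional core. The closed set K is carried along so that the closure of the
  support, not just the set where U is nonzero, lies at positive times.\<close>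

lemma time_profile_exists:
  assumes c: "pos_circ c" and lam: "0 < lam"
  obtains U K where "schwartz_family c U" "closed K" "\<And>x. U 0 x \<noteq> 0 \<Longrightarrow> x \<in> K" "K \<subseteq> pos_time c"
    and "(\<integral>s. indicator {0..lam} s * (exp (- s * m\<^sup>2) *
       gauss_mean (sqrt (2 * s)) (conv c (U 0) (U 0))) \<partial>lborel) < 0"
proof -
  let ?r = "sqrt (2 * lam)"
  have r: "0 < ?r" using lam by simp
  obtain a d where ad: "0 < d" "d < a" "\<And>l. c = Some l \<Longrightarrow> a + d < l / 2"
    and pos: "kernel_pos_near c m ?r a d"
    using kernel_localized[OF c r, where m = m] by blast
  have dl: "\<And>l. c = Some l \<Longrightarrow> d < l / 2" using ad by force
  obtain G where G: "schwartz_family c G" "\<And>x. 0 \<le> G 0 x" "0 < G 0 a" "\<And>x. G 0 x \<noteq> 0 \<Longrightarrow> x \<in> near c a d"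
    "\<And>x. G 0 (2 * a - x) = G 0 x"
    using bump_family_exists[OF c ad(1) dl, of a] by blast
  have near: "\<exists>k. \<bar>x + lattice_shift c k - a\<bar> \<le> d" if "x \<in> near c a d" for x
    using near_lattice_shift[OF that c ad(1) dl] by blast
  have suppG: "x \<in> near c a d" if "G n x \<noteq> 0" for n x
    using derivatives_support[where F = G, OF schwartz_family_deriv[OF G(1)] closed_near G(4) that] .
  define U where "U = (\<lambda>n x. m\<^sup>2 * G n x + (- 1) * G (n + 2) x)"
  have U: "schwartz_family c U" unfolding U_def by (rule schwartz_family_lincomb[OF G(1) schwartz_family_shift[OF G(1)]])
  have suppU: "x \<in> near c a d" if "U n x \<noteq> 0" for n x
    using suppG[of n x] suppG[of "n + 2" x] that by (cases "G n x = 0") (auto simp: U_def)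
  \<comment> \<open>Y = U * G and W = G * G. As U is H applied to G, both U * U = H Y and Y = H W
    hold: one H is consumed by the telescoping in s, the other produces
    \<open>heat_symbol_kernel\<close>.\<close>
  define Y where "Y = (\<lambda>n. conv c (U 0) (G n))"
  define W where "W = (\<lambda>n. conv c (G 0) (G n))"
  have Y: "schwartz_family (Some 0) Y" unfolding Y_def by (rule schwartz_family_conv[OF U G(1)])
  have W: "schwartz_family (Some 0) W" unfolding W_def by (rule schwartz_family_conv[OF G(1) G(1)])
  have U0: "U 0 = (\<lambda>x. m\<^sup>2 * G 0 x + (- 1) * G 2 x)" by (simp add: U_def numeral_2_eq_2)
  have V: "conv c (U 0) (U 0) = (\<lambda>x. m\<^sup>2 * Y 0 x + (- 1) * Y 2 x)"
    unfolding Y_def using conv_lincomb[OF U G(1), of 0 "m\<^sup>2" 0 "- 1" 2] by (simp add: U0 fun_eq_iff)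
  have YW: "Y 0 = (\<lambda>x. m\<^sup>2 * W 0 x + (- 1) * W 2 x)"
    unfolding Y_def W_def conv_commute[OF c U G(1)]
    using conv_lincomb[OF G(1) G(1), of 0 "m\<^sup>2" 0 "- 1" 2] by (simp add: U0 fun_eq_iff)
  have Y0: "Y 0 0 = 0"
  proof -
    \<comment> \<open>If t and - t were both within d of a modulo the period, then 2 a would be
      within 2 d of a lattice point; but 0 < 2 (a - d), and 2 (a + d) < l on a circle.\<close>
    have "U 0 t * G 0 (0 - t) = 0" for t
    proof (rule ccontr)
      assume "U 0 t * G 0 (0 - t) \<noteq> 0"
      then have "t \<in> near c a d" "- t \<in> near c a d" using suppU[of 0 t] suppG[of 0 "- t"] by auto
      from near[OF this(1)] near[OF this(2)] obtain j k
        where "\<bar>t + lattice_shift c j - a\<bar> \<le> d" "\<bar>- t + lattice_shift c k - a\<bar> \<le> d" by auto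
      then have jk: "\<bar>lattice_shift c (j + k) - 2 * a\<bar> \<le> 2 * d" unfolding lattice_shift_add[symmetric] by linarith
      show False
      proof (cases c)
        case None then show ?thesis using jk ad by (simp add: lattice_shift_def)
      next
        case (Some l)
        then have l: "0 < l" using c by (simp add: pos_circ_def)
        have "0 * l < of_int (j + k) * l" "of_int (j + k) * l < 1 * l"
          using jk ad(1,2) ad(3)[OF Some] unfolding Some lattice_shift_def option.case by linarith+
        then have "0 < (of_int (j + k) :: real)" "(of_int (j + k) :: real) < 1"
          unfolding mult_less_cancel_right_pos[OF l] .
        then have "0 < j + k" "j + k < 1" by (simp_all del: of_int_add)
        then show False by linarith
      qed
    qed
    then show ?thesis unfolding Y_def conv_def by (simp only: mult_zero_right integral_zero)
  qed
  have "0 < (\<integral>z. heat_symbol_kernel m ?r z * W 0 z \<partial>lborel)"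
  proof -
    obtain B where B: "\<And>z. \<bar>W 0 z\<bar> \<le> B" by (metis schwartz_family_bounded[OF W])
    show ?thesis
    proof (rule pos[unfolded kernel_pos_near_def, rule_format, OF schwartz_family_continuous[OF W] _ _ B])
      show "periodic1 c (W 0)" unfolding W_def by (rule periodic1_conv[OF schwartz_family_periodic1[OF G(1)]])
      show "0 \<le> W 0 z" for z
        unfolding W_def conv_def using G(2) by (intro Bochner_Integration.integral_nonneg) auto
      show "0 < W 0 (2 * a)"
        unfolding W_def conv_def G(5)
      proof (rule cint_pos[where x = a])
        show "continuous_on UNIV (\<lambda>t. G 0 t * G 0 t)" by (intro continuous_intros schwartz_family_continuous[OF G(1)])
        obtain D where "\<And>z. \<bar>G 0 z\<bar> \<le> D" by (metis schwartz_family_bounded[OF G(1)])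
        then show "integrable lborel (\<lambda>t. indicator (cell1 c) t * (G 0 t * G 0 t))"
          by (rule integrable_cell_schwartz_family_mult[OF G(1) schwartz_family_measurable[OF G(1)]])
      qed (use G(2,3) ad in force)+
      fix z assume z: "W 0 z \<noteq> 0"
      have "\<exists>t. G 0 t * G 0 (z - t) \<noteq> 0"
      proof (rule ccontr)
        assume "\<not> (\<exists>t. G 0 t * G 0 (z - t) \<noteq> 0)"
        then have "G 0 t * G 0 (z - t) = 0" for t by blast
        then have "W 0 z = 0" unfolding W_def conv_def by (simp only: mult_zero_right integral_zero)
        then show False using z by simp
      qed
      then obtain t where "t \<in> near c a d" "z - t \<in> near c a d" using suppG[of 0] by auto
      from near[OF this(1)] near[OF this(2)] obtain j k
        where "\<bar>t + lattice_shift c j - a\<bar> \<le> d" "\<bar>z - t + lattice_shift c k - a\<bar> \<le> d" by auto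
      then have "\<bar>z + lattice_shift c (j + k) - 2 * a\<bar> \<le> 2 * d" unfolding lattice_shift_add[symmetric] by linarith
      then show "\<exists>k. \<bar>z + lattice_shift c k - 2 * a\<bar> \<le> 2 * d" by blast
    qed
  qed
  also have "\<dots> = gauss_mean ?r (Y 0)"
    unfolding YW gauss_mean_by_parts[OF W r] heat_symbol_kernel_def ..
  finally have "0 < gauss_mean ?r (Y 0)" .
  then have neg: "(\<integral>s. indicator {0..lam} s * (exp (- s * m\<^sup>2) *
       gauss_mean (sqrt (2 * s)) (conv c (U 0) (U 0))) \<partial>lborel) < 0"
    unfolding V integral_heat_flow[OF Y lam] Y0 by simp
  have "near c a d \<subseteq> pos_time c"
  proof
    fix x assume "x \<in> near c a d"
    from near[OF this] obtain k where "\<bar>x + lattice_shift c k - a\<bar> \<le> d" by blast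
    then show "x \<in> pos_time c"
      unfolding pos_time_def using ad by (auto intro!: exI[of _ k])
  qed
  from that[OF U closed_near suppU this neg] show ?thesis .
qed

section \<open>Product test functions\<close>

definition prod_fun :: "('n::finite \<Rightarrow> real \<Rightarrow> real) \<Rightarrow> real ^ 'n \<Rightarrow> real" where
  "prod_fun f x = (\<Prod>i\<in>UNIV. f i (x $ i))"

lemma prod_fun_split: "prod_fun f x = f i (x $ i) * (\<Prod>j\<in>UNIV - {i}. f j (x $ j))"
  unfolding prod_fun_def by (rule prod.remove) auto

lemma prod_fun_deriv:
  assumes "\<And>j n x. (F j n has_real_derivative F j (Suc n) x) (at x)"
  shows "((\<lambda>s. prod_fun (\<lambda>j. F j (k j)) (x + s *\<^sub>R axis i 1)) has_real_derivative
    prod_fun (\<lambda>j. F j (k j + (if j = i then 1 else 0))) x) (at 0)"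
proof -
  let ?P = "\<Prod>j\<in>UNIV - {i}. F j (k j) (x $ j)"
  have "prod_fun (\<lambda>j. F j (k j)) (x + s *\<^sub>R axis i 1) = F i (k i) (x $ i + s) * ?P" for s
    unfolding prod_fun_split[of _ _ i] by (simp add: axis_def)
  moreover have "prod_fun (\<lambda>j. F j (k j + (if j = i then 1 else 0))) x = F i (Suc (k i)) (x $ i) * ?P"
    unfolding prod_fun_split[of _ _ i] by simp
  moreover have "((\<lambda>s. F i (k i) (x $ i + s)) has_real_derivative F i (Suc (k i)) (x $ i)) (at 0)"
    using DERIV_at_within_shift[of "F i (k i)" "F i (Suc (k i)) (x $ i)" "x $ i" 0 UNIV] assms[of i "k i" "x $ i"]
    by simp
  ultimately show ?thesis by (simp add: DERIV_cmult_right)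
qed

lemma partial_derivs_prod_fun:
  assumes "\<And>j n x. (F j n has_real_derivative F j (Suc n) x) (at x)"
  shows "partial_derivs js (prod_fun (\<lambda>j. F j 0)) = prod_fun (\<lambda>j. F j (count_list js j))"
proof (induction js)
  case (Cons i js)
  have count: "count_list (i # js) j = count_list js j + (if j = i then 1 else 0)" for j by simp
  show ?case
  proof
    fix x
    have "partial_derivs (i # js) (prod_fun (\<lambda>j. F j 0)) x
        = deriv (\<lambda>s. prod_fun (\<lambda>j. F j (count_list js j)) (x + s *\<^sub>R axis i 1)) 0"
      by (simp add: partial_deriv_def Cons)
    also have "\<dots> = prod_fun (\<lambda>j. F j (count_list (i # js) j)) x"
      unfolding count by (rule DERIV_imp_deriv[OF prod_fun_deriv[where F = F, OF assms]])
    finally show "partial_derivs (i # js) (prod_fun (\<lambda>j. F j 0)) x = \<dots>" .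
  qed
qed simp

text \<open>Expanding the product gives the weight plus nonnegative terms. Decay in each coordinate
  separately thus yields joint decay.\<close>

lemma weight_le_prod: "weight L x \<le> (\<Prod>i\<in>UNIV. weight1 (L i) (x $ i))"
proof -
  have "1 + (\<Sum>i\<in>A. if L i = None then (x $ i)\<^sup>2 else 0) \<le> (\<Prod>i\<in>A. weight1 (L i) (x $ i))" if "finite A" for A
    using that
  proof induction
    case (insert i A)
    have w: "weight1 (L i) (x $ i) = 1 + (if L i = None then (x $ i)\<^sup>2 else 0)"
      by (auto simp: weight1_def split: option.split)
    have "0 \<le> (\<Sum>i\<in>A. if L i = None then (x $ i)\<^sup>2 else 0)" by (intro sum_nonneg) auto
    then have "1 + ((if L i = None then (x $ i)\<^sup>2 else 0) + (\<Sum>i\<in>A. if L i = None then (x $ i)\<^sup>2 else 0))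
       \<le> weight1 (L i) (x $ i) * (1 + (\<Sum>i\<in>A. if L i = None then (x $ i)\<^sup>2 else 0))"
      unfolding w by (auto simp: algebra_simps)
    also have "\<dots> \<le> weight1 (L i) (x $ i) * (\<Prod>i\<in>A. weight1 (L i) (x $ i))"
      using insert.IH weight1_ge_1[of "L i" "x $ i"] by (intro mult_left_mono) auto
    finally show ?case using insert.hyps by simp
  qed simp
  moreover have "(\<Sum>i\<in>UNIV. if L i = None then (x $ i)\<^sup>2 else 0) = (\<Sum>i\<in>- dom L. (x $ i)\<^sup>2)"
    by (rule sum.mono_neutral_cong_right) auto
  ultimately show ?thesis unfolding weight_def using finite[of UNIV] by metis
qed

lemma prod_fun_schwartz:
  fixes F :: "'n::finite \<Rightarrow> nat \<Rightarrow> real \<Rightarrow> real"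
  assumes F: "\<And>i. schwartz_family (L i) (F i)"
  shows "prod_fun (\<lambda>i. F i 0) \<in> schwartz L"
proof -
  note pd = partial_derivs_prod_fun[where F = F, OF schwartz_family_deriv[OF F]]
  have "periodic L (prod_fun (\<lambda>i. F i 0))"
    unfolding periodic_def
  proof (intro allI impI)
    fix j l x assume "L j = Some l"
    then have "F j 0 (x $ j + l) = F j 0 (x $ j)" using schwartz_family_periodic1[OF F, of j 0] by (simp add: periodic1_def)
    then show "prod_fun (\<lambda>i. F i 0) (x + axis j l) = prod_fun (\<lambda>i. F i 0) x"
      unfolding prod_fun_split[of _ _ j] by (simp add: axis_def)
  qed
  moreover have "smooth (prod_fun (\<lambda>i. F i 0))"
    unfolding smooth_def pd
  proof (intro allI conjI)
    fix js :: "'n list"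
    show "continuous_on UNIV (prod_fun (\<lambda>j. F j (count_list js j)))"
      unfolding prod_fun_def
    proof (rule continuous_on_prod)
      fix i
      have "continuous_on UNIV (\<lambda>x :: real ^ 'n. x $ i)" by (intro continuous_intros)
      from continuous_on_compose2[OF schwartz_family_continuous[OF F, of UNIV] this]
      show "continuous_on UNIV (\<lambda>x. F i (count_list js i) (x $ i))" by simp
    qed
    fix i x
    show "(\<lambda>s. prod_fun (\<lambda>j. F j (count_list js j)) (x + s *\<^sub>R axis i 1)) differentiable at 0"
      using prod_fun_deriv[where F = F and k = "count_list js", OF schwartz_family_deriv[OF F], of x i]
      unfolding real_differentiable_def by blast
  qed
  moreover have "bdd_above (range (\<lambda>x. weight L x ^ k * \<bar>partial_derivs js (prod_fun (\<lambda>i. F i 0)) x\<bar>))" for k js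
  proof -
    have "\<forall>i. \<exists>B. \<forall>x. weight1 (L i) x ^ k * \<bar>F i (count_list js i) x\<bar> \<le> B"
      using F unfolding schwartz_family_def by blast
    then obtain B where B: "\<And>i x. weight1 (L i) x ^ k * \<bar>F i (count_list js i) x\<bar> \<le> B i" by metis
    have "weight L x ^ k * \<bar>partial_derivs js (prod_fun (\<lambda>i. F i 0)) x\<bar> \<le> (\<Prod>i\<in>UNIV. B i)" for x
    proof -
      have "0 \<le> weight L x" unfolding weight_def by (intro add_nonneg_nonneg sum_nonneg) auto
      then have "weight L x ^ k \<le> (\<Prod>i\<in>UNIV. weight1 (L i) (x $ i)) ^ k"
        by (intro power_mono weight_le_prod)
      then have "weight L x ^ k * \<bar>partial_derivs js (prod_fun (\<lambda>i. F i 0)) x\<bar>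
          \<le> (\<Prod>i\<in>UNIV. weight1 (L i) (x $ i)) ^ k * \<bar>partial_derivs js (prod_fun (\<lambda>i. F i 0)) x\<bar>"
        by (intro mult_right_mono) auto
      also have "\<dots> = (\<Prod>i\<in>UNIV. weight1 (L i) (x $ i) ^ k * \<bar>F i (count_list js i) (x $ i)\<bar>)"
        unfolding pd by (simp add: prod_fun_def abs_prod prod.distrib prod_power_distrib)
      also have "\<dots> \<le> (\<Prod>i\<in>UNIV. B i)"
      proof (intro prod_mono conjI)
        fix i
        have "0 \<le> weight1 (L i) (x $ i)" using weight1_ge_1[of "L i" "x $ i"] by linarith
        then show "0 \<le> weight1 (L i) (x $ i) ^ k * \<bar>F i (count_list js i) (x $ i)\<bar>" by simp
      qed (rule B)
      finally show ?thesis .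
    qed
    then show ?thesis by (intro bdd_aboveI2)
  qed
  ultimately show ?thesis by (simp add: schwartz_def)
qed

section \<open>Heat flow and noise energy of product functions\<close>

lemma integral_prod_real:
  fixes h :: "'n::finite \<Rightarrow> real \<Rightarrow> real"
  assumes h: "\<And>i. integrable lborel (h i)"
  shows "integrable lborel (\<lambda>y :: real ^ 'n. \<Prod>i\<in>UNIV. h i (y $ i))"
    and "(\<integral>y. (\<Prod>i\<in>UNIV. h i (y $ i)) \<partial>(lborel :: (real ^ 'n) measure)) = (\<Prod>i\<in>UNIV. \<integral>s. h i s \<partial>lborel)"
proof -
  have c: "integrable lborel (\<lambda>s. complex_of_real (h i s))" for i using h[of i] by simp
  have 1: "integrable lborel (\<lambda>y :: real ^ 'n. complex_of_real (\<Prod>i\<in>UNIV. h i (y $ i)))"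
    using integral_prod_components(1)[OF c] by simp
  then show "integrable lborel (\<lambda>y :: real ^ 'n. \<Prod>i\<in>UNIV. h i (y $ i))"
    unfolding complex_of_real_integrable_eq .
  have "complex_of_real (\<integral>y. (\<Prod>i\<in>UNIV. h i (y $ i)) \<partial>(lborel :: (real ^ 'n) measure))
      = complex_of_real (\<Prod>i\<in>UNIV. \<integral>s. h i s \<partial>lborel)"
    using integral_prod_components(2)[OF c] by (simp flip: integral_complex_of_real)
  then show "(\<integral>y. (\<Prod>i\<in>UNIV. h i (y $ i)) \<partial>(lborel :: (real ^ 'n) measure)) = (\<Prod>i\<in>UNIV. \<integral>s. h i s \<partial>lborel)"
    by (simp only: of_real_eq_iff)
qed

text \<open>The Gaussian kernel is a product over the coordinates, so the integral factors; the mass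
  factor occurs once.\<close>

lemma heat_prod_fun:
  assumes F: "\<And>i. schwartz_family (L i) (F i)" and \<tau>: "0 \<le> \<tau>"
  shows "heat m \<tau> (prod_fun (\<lambda>i. F i 0)) x = exp (- \<tau> * m\<^sup>2) * prod_fun (\<lambda>i. heat1 \<tau> (F i 0)) x"
proof (cases "\<tau> = 0")
  case False
  then have r: "0 < sqrt (2 * \<tau>)" using \<tau> by simp
  have "integrable lborel (\<lambda>s. normal_density 0 (sqrt (2 * \<tau>)) (x $ i - s) * F i 0 s)" for i
  proof -
    note [measurable] = schwartz_family_measurable[OF F]
    obtain B where B: "\<And>s. \<bar>F i 0 s\<bar> \<le> B" by (metis schwartz_family_bounded[OF F])
    have "integrable lborel (\<lambda>z. normal_density 0 (sqrt (2 * \<tau>)) z * F i 0 (x $ i - z))"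
      using B by (intro integrable_normal_mult[OF r]) auto
    from lborel_integrable_real_affine[OF this, of "- 1" "x $ i"] show ?thesis by simp
  qed
  from integral_prod_real(2)[where h = "\<lambda>i s. normal_density 0 (sqrt (2 * \<tau>)) (x $ i - s) * F i 0 s", OF this]
  show ?thesis using False
    by (simp add: heat_def heat1_def prod_fun_def prod.distrib)
qed (simp add: heat_def heat1_def prod_fun_def)

lemma indicator_fundamental_cell:
  "indicator (fundamental_cell L) x = (\<Prod>i\<in>UNIV. indicator (cell1 (L i)) (x $ i) :: real)"
proof -
  have "x \<in> fundamental_cell L \<longleftrightarrow> (\<forall>i. x $ i \<in> cell1 (L i))"
    unfolding fundamental_cell_def cell1_def by (auto split: option.split)
  then show ?thesis by (auto simp: indicator_def)
qed

lemma fundamental_cell_borel [measurable]: "fundamental_cell L \<in> sets borel"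
proof -
  have "fundamental_cell L = {x. \<forall>i. x $ i \<in> cell1 (L i)}"
    unfolding fundamental_cell_def cell1_def by (auto split: option.split)
  moreover have "{x \<in> space borel. \<forall>i. x $ i \<in> cell1 (L i)} \<in> sets borel" by measurable
  ultimately show ?thesis by simp
qed

text \<open>The square-integrable function with which \<open>solution\<close> pairs the noise, named
  so that the covariance of the noise can be applied to it.\<close>

definition sol_fun :: "real \<Rightarrow> real \<Rightarrow> (real ^ 'n \<Rightarrow> real) \<Rightarrow> real \<times> (real ^ 'n) \<Rightarrow> real" where
  "sol_fun m lam f = (\<lambda>(\<alpha>, x). indicator {0..lam} \<alpha> * heat m ((lam - \<alpha>) / 2) f x)"

lemma solution_eq: "solution m lam \<xi> f = \<xi> (sol_fun m lam f)"
  by (simp add: solution_def sol_fun_def)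

lemma sol_fun_prod_fun:
  assumes F: "\<And>i. schwartz_family (L i) (F i)"
  shows "sol_fun m lam (prod_fun (\<lambda>i. F i 0)) z = indicator {0..lam} (fst z) *
     (exp (- ((lam - fst z) / 2) * m\<^sup>2) * (\<Prod>i\<in>UNIV. heat1 ((lam - fst z) / 2) (F i 0) (snd z $ i)))"
  using heat_prod_fun[OF F, of "(lam - fst z) / 2"]
  by (cases "fst z \<in> {0..lam}") (auto simp: sol_fun_def prod_fun_def split_beta)

text \<open>Membership in \<open>L2\<close> gives access to the covariance of white noise. At fixed
  \<alpha> the energy factors over the coordinates, and squaring the flow for time (lam - \<alpha>)
  / 2 produces the mass factor exp (- (lam - \<alpha>) m^2).\<close>

lemma sol_fun_L2:
  fixes F :: "'n::finite \<Rightarrow> nat \<Rightarrow> real \<Rightarrow> real" and m lam :: real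
  assumes F: "\<And>i. schwartz_family (L i) (F i)" and lam: "0 < lam"
  defines "e \<equiv> (\<lambda>\<alpha>. indicator {0..lam} \<alpha> * (exp (- (lam - \<alpha>) * m\<^sup>2) *
     (\<Prod>i\<in>UNIV. cint (L i) (\<lambda>t. (heat1 ((lam - \<alpha>) / 2) (F i 0) t)\<^sup>2))))"
  shows "sol_fun m lam (prod_fun (\<lambda>i. F i 0)) \<in> L2 (noise_space L)"
    and "(\<integral>z. sol_fun m lam (prod_fun (\<lambda>i. F i 0)) z * sol_fun m lam (prod_fun (\<lambda>i. F i 0)) z \<partial>noise_space L)
       = (\<integral>\<alpha>. e \<alpha> \<partial>lborel)"
    and "integrable lborel e"
proof -
  let ?S = "sol_fun m lam (prod_fun (\<lambda>i. F i 0))"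
  let ?D = "{0::real..} \<times> fundamental_cell L"
  note [measurable] = schwartz_family_measurable[OF F]
  have D: "?D \<in> sets lborel"
    unfolding lborel_prod[symmetric] by (rule pair_measureI) auto
  have [measurable]: "(\<lambda>z. heat1 ((lam - fst z) / 2) (F i 0) (snd z $ i)) \<in> borel_measurable (borel :: (real \<times> (real ^ 'n)) measure)" for i
  proof -
    have "(\<lambda>z :: real \<times> (real ^ 'n). (lam - fst z) / 2) \<in> borel_measurable borel"
      "(\<lambda>z :: real \<times> (real ^ 'n). snd z $ i) \<in> borel_measurable borel"
      by (intro borel_measurable_continuous_onI continuous_intros; simp)+
    note measurable_Pair[OF this]
    from measurable_compose[OF this heat1_measurable_pair[OF schwartz_family_measurable[OF F, of i 0]]]
    show ?thesis by simp
  qed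
  have [measurable]: "(\<lambda>z :: real \<times> (real ^ 'n). fst z) \<in> borel_measurable borel"
    by (intro borel_measurable_continuous_onI continuous_intros)
  have S_meas: "?S \<in> borel_measurable borel"
    unfolding sol_fun_prod_fun[OF F, abs_def] by measurable
  define g where "g = (\<lambda>z. indicator ?D z * (?S z)\<^sup>2)"
  have g_eq: "g (\<alpha>, x) = indicator {0..lam} \<alpha> * (exp (- (lam - \<alpha>) * m\<^sup>2) *
      (\<Prod>i\<in>UNIV. indicator (cell1 (L i)) (x $ i) * (heat1 ((lam - \<alpha>) / 2) (F i 0) (x $ i))\<^sup>2))" for \<alpha> x
  proof -
    have "(exp (- ((lam - \<alpha>) / 2) * m\<^sup>2))\<^sup>2 = exp (- (lam - \<alpha>) * m\<^sup>2)"
      by (simp add: power2_eq_square exp_add[symmetric] algebra_simps)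
    moreover have "indicator ?D (\<alpha>, x) = (indicator {0..} \<alpha> * indicator (fundamental_cell L) x :: real)"
      by (auto simp: indicator_def)
    ultimately show ?thesis
      unfolding g_def sol_fun_prod_fun[OF F] indicator_fundamental_cell
      by (auto simp: indicator_fundamental_cell power_mult_distrib prod_power_distrib prod.distrib indicator_def)
  qed
  have "\<forall>i. \<exists>B. 0 \<le> B \<and> (\<forall>\<tau> x. 0 \<le> \<tau> \<longrightarrow> \<tau> \<le> lam \<longrightarrow> \<bar>heat1 \<tau> (F i 0) x\<bar> \<le> B / weight1 (L i) x)"
    using heat1_decay[OF F less_imp_le[OF lam]] by metis
  then obtain B where B: "\<And>i. 0 \<le> B i" "\<And>i \<tau> x. 0 \<le> \<tau> \<Longrightarrow> \<tau> \<le> lam \<Longrightarrow> \<bar>heat1 \<tau> (F i 0) x\<bar> \<le> B i / weight1 (L i) x"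
    by metis
  have sq: "(heat1 \<tau> (F i 0) x)\<^sup>2 \<le> (B i)\<^sup>2 / weight1 (L i) x" if "0 \<le> \<tau>" "\<tau> \<le> lam" for \<tau> i x
  proof -
    have w: "1 \<le> weight1 (L i) x" by (rule weight1_ge_1)
    have "(heat1 \<tau> (F i 0) x)\<^sup>2 \<le> (B i / weight1 (L i) x)\<^sup>2"
      using power_mono[OF B(2)[OF that, of i x], of 2] by simp
    also have "\<dots> = (B i)\<^sup>2 / weight1 (L i) x * (1 / weight1 (L i) x)" by (simp add: power2_eq_square)
    also have "\<dots> \<le> (B i)\<^sup>2 / weight1 (L i) x * 1"
      using w by (intro mult_left_mono) auto
    finally show ?thesis by simp
  qed
  \<comment> \<open>A majorant that does not depend on \<alpha> and is a product over the
    coordinates, so that integrability reduces to that of the inverse weights on the cells.\<close>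
  let ?p = "\<lambda>i s. (B i)\<^sup>2 * (indicator (cell1 (L i)) s / weight1 (L i) s)"
  have p_int: "integrable lborel (?p i)" for i
    by (intro integrable_mult_right integrable_inverse_weight1)
  have dom: "\<bar>g (\<alpha>, x)\<bar> \<le> indicator {0..lam} \<alpha> * (\<Prod>i\<in>UNIV. ?p i (x $ i))" for \<alpha> x
  proof (cases "\<alpha> \<in> {0..lam}")
    case True
    have le: "0 \<le> indicator (cell1 (L i)) (x $ i) * (heat1 ((lam - \<alpha>) / 2) (F i 0) (x $ i))\<^sup>2
        \<and> indicator (cell1 (L i)) (x $ i) * (heat1 ((lam - \<alpha>) / 2) (F i 0) (x $ i))\<^sup>2 \<le> ?p i (x $ i)" for i
      using sq[of "(lam - \<alpha>) / 2" i "x $ i"] True by (auto simp: indicator_def)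
    have e1: "exp (- (lam - \<alpha>) * m\<^sup>2) \<le> 1" using True by (simp add: mult_nonpos_nonneg)
    have P: "(\<Prod>i\<in>UNIV. indicator (cell1 (L i)) (x $ i) * (heat1 ((lam - \<alpha>) / 2) (F i 0) (x $ i))\<^sup>2)
        \<le> (\<Prod>i\<in>UNIV. ?p i (x $ i))" by (intro prod_mono le)
    have P0: "0 \<le> (\<Prod>i\<in>UNIV. indicator (cell1 (L i)) (x $ i) * (heat1 ((lam - \<alpha>) / 2) (F i 0) (x $ i))\<^sup>2)"
      by (intro prod_nonneg) (use le in auto)
    have "\<bar>g (\<alpha>, x)\<bar> = exp (- (lam - \<alpha>) * m\<^sup>2) *
      (\<Prod>i\<in>UNIV. indicator (cell1 (L i)) (x $ i) * (heat1 ((lam - \<alpha>) / 2) (F i 0) (x $ i))\<^sup>2)"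
      unfolding g_eq using P0 True by (simp only: abs_mult indicator_simps) simp
    also have "\<dots> \<le> 1 * (\<Prod>i\<in>UNIV. ?p i (x $ i))"
      by (rule mult_mono[OF e1 P]) (use P0 in auto)
    finally show ?thesis using True by simp
  qed (simp add: g_eq)
  have g_meas: "g \<in> borel_measurable (lborel \<Otimes>\<^sub>M lborel)"
    unfolding lborel_prod g_def using S_meas D by measurable
  have dom_int: "integrable (lborel \<Otimes>\<^sub>M lborel) (\<lambda>(\<alpha>, x :: real ^ 'n). indicator {0..lam} \<alpha> * (\<Prod>i\<in>UNIV. ?p i (x $ i)))"
  proof (rule lborel_pair.Fubini_integrable)
    note [measurable] = borel_measurable_integrable[OF integral_prod_real(1)[where h = ?p, OF p_int]]
    show "(\<lambda>(\<alpha>, x :: real ^ 'n). indicator {0..lam} \<alpha> * (\<Prod>i\<in>UNIV. ?p i (x $ i)))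
        \<in> borel_measurable (lborel \<Otimes>\<^sub>M lborel)"
      unfolding split_beta by measurable
    show "AE \<alpha> in lborel. integrable lborel (\<lambda>x :: real ^ 'n. case (\<alpha>, x) of (\<alpha>, x) \<Rightarrow> indicator {0..lam} \<alpha> * (\<Prod>i\<in>UNIV. ?p i (x $ i)))"
      using integral_prod_real(1)[where h = ?p, OF p_int] by simp
    have "norm (case (\<alpha>, x :: real ^ 'n) of (\<alpha>, x) \<Rightarrow> indicator {0..lam} \<alpha> * (\<Prod>i\<in>UNIV. ?p i (x $ i)))
      = indicator {0..lam} \<alpha> * norm (\<Prod>i\<in>UNIV. ?p i (x $ i))" for \<alpha> x
      by (simp add: abs_mult)
    then show "integrable lborel (\<lambda>\<alpha>. \<integral>x. norm (case (\<alpha>, x :: real ^ 'n) of (\<alpha>, x) \<Rightarrow> indicator {0..lam} \<alpha> * (\<Prod>i\<in>UNIV. ?p i (x $ i))) \<partial>lborel)"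
      using lam by (simp only: integral_mult_right_zero) (intro integrable_mult_left integrable_real_indicator; simp)
  qed
  have g_int: "integrable (lborel \<Otimes>\<^sub>M lborel) g"
    by (rule Bochner_Integration.integrable_bound[OF dom_int g_meas])
      (use dom in \<open>auto intro!: AE_I2 order_trans[OF _ abs_ge_self]\<close>)
  show L2: "?S \<in> L2 (noise_space L)"
    unfolding L2_def noise_space_def mem_Collect_eq
  proof
    show "?S \<in> borel_measurable (restrict_space lborel ?D)"
      using S_meas by (intro measurable_restrict_space1) simp
    show "integrable (restrict_space lborel ?D) (\<lambda>z. (?S z)\<^sup>2)"
      using g_int D unfolding lborel_prod g_def by (subst integrable_restrict_space) auto
  qed
  have e_eq: "(\<integral>x. g (\<alpha>, x) \<partial>lborel) = e \<alpha>" for \<alpha>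
  proof (cases "\<alpha> \<in> {0..lam}")
    case True
    have "integrable lborel (\<lambda>t. indicator (cell1 (L i)) t * (heat1 ((lam - \<alpha>) / 2) (F i 0) t)\<^sup>2)" for i
    proof (rule integrable_cell)
      show "(\<lambda>t. (heat1 ((lam - \<alpha>) / 2) (F i 0) t)\<^sup>2) \<in> borel_measurable borel" by measurable
      show "\<bar>(heat1 ((lam - \<alpha>) / 2) (F i 0) t)\<^sup>2\<bar> \<le> (B i)\<^sup>2 / weight1 (L i) t" for t
        using sq[of "(lam - \<alpha>) / 2" i t] True by simp
    qed
    from integral_prod_real(2)[where h = "\<lambda>i t. indicator (cell1 (L i)) t * (heat1 ((lam - \<alpha>) / 2) (F i 0) t)\<^sup>2", OF this]
    show ?thesis unfolding g_eq e_def by (simp only: integral_mult_right_zero)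
  qed (simp add: g_eq e_def)
  have "(\<integral>z. ?S z * ?S z \<partial>noise_space L) = (\<integral>z. g z \<partial>(lborel \<Otimes>\<^sub>M lborel))"
    unfolding noise_space_def lborel_prod g_def using D
    by (subst integral_restrict_space) (auto simp: power2_eq_square)
  also have "\<dots> = (\<integral>\<alpha>. (\<integral>x. g (\<alpha>, x) \<partial>lborel) \<partial>lborel)"
    using lborel_pair.integral_fst'[OF g_int] by simp
  finally show "(\<integral>z. ?S z * ?S z \<partial>noise_space L) = (\<integral>\<alpha>. e \<alpha> \<partial>lborel)"
    unfolding e_eq .
  show "integrable lborel e"
    using lborel_pair.integrable_fst'[OF g_int] unfolding e_eq .
qed

lemma heat1_lincomb:
  assumes F: "schwartz_family c F" and G: "schwartz_family c G" and \<tau>: "0 \<le> \<tau>"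
  shows "heat1 \<tau> (\<lambda>x. a * F n x + b * G k x) x = a * heat1 \<tau> (F n) x + b * heat1 \<tau> (G k) x"
proof -
  note [measurable] = schwartz_family_measurable[OF F] schwartz_family_measurable[OF G]
  let ?r = "sqrt (2 * \<tau>)"
  have i1: "integrable lborel (\<lambda>z. std_normal_density z * F n (x - ?r * z))"
    by (rule schwartz_family_bounded[OF F, of n]) (auto intro!: integrable_normal_mult)
  have i2: "integrable lborel (\<lambda>z. std_normal_density z * G k (x - ?r * z))"
    by (rule schwartz_family_bounded[OF G, of k]) (auto intro!: integrable_normal_mult)
  have "heat1 \<tau> (\<lambda>x. a * F n x + b * G k x) x = (\<integral>z. a * (std_normal_density z * F n (x - ?r * z))
     + b * (std_normal_density z * G k (x - ?r * z)) \<partial>lborel)"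
    unfolding heat1_eq_gauss_mean[OF \<tau>] gauss_mean_def
    by (intro Bochner_Integration.integral_cong) (auto simp: algebra_simps)
  also have "\<dots> = a * heat1 \<tau> (F n) x + b * heat1 \<tau> (G k) x"
    unfolding heat1_eq_gauss_mean[OF \<tau>] gauss_mean_def
    by (subst Bochner_Integration.integral_add) (auto intro!: i1 i2)
  finally show ?thesis .
qed

lemma integrable_cell_heat1_sq:
  assumes F: "schwartz_family c F" and \<tau>: "0 \<le> \<tau>"
  shows "integrable lborel (\<lambda>t. indicator (cell1 c) t * (heat1 \<tau> (F n) t)\<^sup>2)"
proof -
  note [measurable] = schwartz_family_measurable[OF F]
  obtain B where B: "0 \<le> B" "\<And>x. \<bar>heat1 \<tau> (F n) x\<bar> \<le> B / weight1 c x"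
    using heat1_decay[OF F \<tau>] \<tau> by (metis order_refl)
  have "\<bar>(heat1 \<tau> (F n) x)\<^sup>2\<bar> \<le> B\<^sup>2 / weight1 c x" for x
  proof -
    have w: "1 \<le> weight1 c x" by (rule weight1_ge_1)
    have "(heat1 \<tau> (F n) x)\<^sup>2 \<le> (B / weight1 c x)\<^sup>2"
      using power_mono[OF B(2)[of x], of 2] by simp
    also have "\<dots> = B\<^sup>2 / weight1 c x * (1 / weight1 c x)" by (simp add: power2_eq_square)
    also have "\<dots> \<le> B\<^sup>2 / weight1 c x * 1" using w by (intro mult_left_mono) auto
    finally show ?thesis by simp
  qed
  then show ?thesis by (intro integrable_cell) auto
qed

text \<open>The identity (a + b)^2 - (a - b)^2 = 4 a b, with a the flow of \<open>F 0\<close> and b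
  that of its reflection; the product is evaluated by \<open>heat1_reflection_pairing\<close>, or
  directly when \<tau> = 0.\<close>

lemma heat1_polarization:
  assumes c: "pos_circ c" and F: "schwartz_family c F" and \<tau>: "0 \<le> \<tau>"
  shows "cint c (\<lambda>t. (heat1 \<tau> (\<lambda>x. 1 * F 0 x + 1 * F 0 (- x)) t)\<^sup>2)
       - cint c (\<lambda>t. (heat1 \<tau> (\<lambda>x. 1 * F 0 x + (- 1) * F 0 (- x)) t)\<^sup>2)
     = 4 * gauss_mean (sqrt (4 * \<tau>)) (conv c (F 0) (F 0))"
proof -
  let ?G = "\<lambda>n x. (- 1) ^ n * F n (- x)"
  have G: "schwartz_family c ?G" by (rule schwartz_family_reflect[OF F])
  have lin: "heat1 \<tau> (\<lambda>x. 1 * F 0 x + b * F 0 (- x)) t = heat1 \<tau> (F 0) t + b * heat1 \<tau> (\<lambda>x. F 0 (- x)) t" for b t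
    using heat1_lincomb[OF F G \<tau>, of 1 0 b 0 t] by simp
  have int: "integrable lborel (\<lambda>t. indicator (cell1 c) t * (heat1 \<tau> (\<lambda>x. 1 * F 0 x + b * F 0 (- x)) t)\<^sup>2)" for b
    using integrable_cell_heat1_sq[OF schwartz_family_lincomb[OF F G, of 1 b] \<tau>, of 0] by simp
  have "cint c (\<lambda>t. (heat1 \<tau> (\<lambda>x. 1 * F 0 x + 1 * F 0 (- x)) t)\<^sup>2)
       - cint c (\<lambda>t. (heat1 \<tau> (\<lambda>x. 1 * F 0 x + (- 1) * F 0 (- x)) t)\<^sup>2)
     = (\<integral>t. indicator (cell1 c) t * (heat1 \<tau> (\<lambda>x. 1 * F 0 x + 1 * F 0 (- x)) t)\<^sup>2
         - indicator (cell1 c) t * (heat1 \<tau> (\<lambda>x. 1 * F 0 x + (- 1) * F 0 (- x)) t)\<^sup>2 \<partial>lborel)"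
    by (rule Bochner_Integration.integral_diff[OF int int, symmetric])
  also have "\<dots> = (\<integral>t. 4 * (indicator (cell1 c) t * (heat1 \<tau> (F 0) t * heat1 \<tau> (\<lambda>x. F 0 (- x)) t)) \<partial>lborel)"
    unfolding lin by (intro Bochner_Integration.integral_cong) (auto simp: power2_eq_square algebra_simps)
  also have "\<dots> = 4 * cint c (\<lambda>t. heat1 \<tau> (F 0) t * heat1 \<tau> (\<lambda>x. F 0 (- x)) t)"
    by (rule integral_mult_right_zero)
  also have "cint c (\<lambda>t. heat1 \<tau> (F 0) t * heat1 \<tau> (\<lambda>x. F 0 (- x)) t) = gauss_mean (sqrt (4 * \<tau>)) (conv c (F 0) (F 0))"
  proof (cases "\<tau> = 0")
    case True
    then show ?thesis by (simp add: heat1_def gauss_mean_0 conv_def)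
  next
    case False
    then show ?thesis using heat1_reflection_pairing[OF c F, of \<tau> 0] \<tau> by simp
  qed
  finally show ?thesis .
qed

lemma tempered_lincomb:
  assumes "\<Phi> \<in> tempered L" "f \<in> schwartz L" "g \<in> schwartz L"
  shows "\<Phi> (\<lambda>x. a * f x + b * g x) = a * \<Phi> f + b * \<Phi> g"
  using assms by (simp add: tempered_def)

lemma prod_fun_reflect:
  "prod_fun f \<circ> reflect t = prod_fun (f(t := (\<lambda>x. f t (- x))))"
proof
  fix x
  show "(prod_fun f \<circ> reflect t) x = prod_fun (f(t := (\<lambda>x. f t (- x)))) x"
    unfolding comp_def prod_fun_split[of _ _ t] by (simp add: reflect_def)
qed

lemma prod_fun_upd_add:
  "prod_fun (f(t := (\<lambda>x. a * u x + b * v x))) x = a * prod_fun (f(t := u)) x + b * prod_fun (f(t := v)) x"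
  unfolding prod_fun_split[of _ _ t] by (simp add: algebra_simps)

text \<open>The moment with n = 2 is a variance of the noise, and its covariance with both arguments
  equal turns it into the energy of \<open>sol_fun\<close>. Mixed moments are not prescribed
  directly, so only squares appear.\<close>

lemma stochastic_quantization_second_moment:
  fixes F :: "'n::finite \<Rightarrow> nat \<Rightarrow> real \<Rightarrow> real"
  assumes sq: "stochastic_quantization L m lam \<mu>" and F: "\<And>i. schwartz_family (L i) (F i)" and lam: "0 < lam"
  shows "integrable \<mu> (\<lambda>\<Phi>. (\<Phi> (prod_fun (\<lambda>i. F i 0)))\<^sup>2)"
    and "(\<integral>\<Phi>. (\<Phi> (prod_fun (\<lambda>i. F i 0)))\<^sup>2 \<partial>\<mu>) = (\<integral>\<alpha>. indicator {0..lam} \<alpha> * (exp (- (lam - \<alpha>) * m\<^sup>2) *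
     (\<Prod>i\<in>UNIV. cint (L i) (\<lambda>t. (heat1 ((lam - \<alpha>) / 2) (F i 0) t)\<^sup>2))) \<partial>lborel)"
proof -
  let ?f = "prod_fun (\<lambda>i. F i 0)"
  from sq obtain \<nu> where wn: "white_noise L \<nu>"
    and mom: "\<And>f n. f \<in> schwartz L \<Longrightarrow> integrable \<mu> (\<lambda>\<Phi>. \<Phi> f ^ n) \<and>
      (\<integral>\<Phi>. \<Phi> f ^ n \<partial>\<mu>) = (\<integral>\<xi>. solution m lam \<xi> f ^ n \<partial>\<nu>)"
    unfolding stochastic_quantization_def by blast
  note f = prod_fun_schwartz[OF F]
  show "integrable \<mu> (\<lambda>\<Phi>. (\<Phi> ?f)\<^sup>2)" using mom[OF f] by blast
  have "(\<integral>\<Phi>. (\<Phi> ?f)\<^sup>2 \<partial>\<mu>) = (\<integral>\<xi>. \<xi> (sol_fun m lam ?f) * \<xi> (sol_fun m lam ?f) \<partial>\<nu>)"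
    using mom[OF f, of 2] by (simp add: solution_eq power2_eq_square)
  also have "\<dots> = (\<integral>z. sol_fun m lam ?f z * sol_fun m lam ?f z \<partial>noise_space L)"
  proof -
    have cov: "\<forall>F\<in>L2 (noise_space L). \<forall>G\<in>L2 (noise_space L).
        (\<integral>\<xi>. \<xi> F * \<xi> G \<partial>\<nu>) = (\<integral>z. F z * G z \<partial>noise_space L)"
      using wn unfolding white_noise_def by (elim conjE)
    show ?thesis by (rule cov[THEN bspec, THEN bspec]) (rule sol_fun_L2(1)[OF F lam])+
  qed
  also note sol_fun_L2(2)[OF F lam]
  finally show "(\<integral>\<Phi>. (\<Phi> ?f)\<^sup>2 \<partial>\<mu>) = (\<integral>\<alpha>. indicator {0..lam} \<alpha> * (exp (- (lam - \<alpha>) * m\<^sup>2) *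
     (\<Prod>i\<in>UNIV. cint (L i) (\<lambda>t. (heat1 ((lam - \<alpha>) / 2) (F i 0) t)\<^sup>2))) \<partial>lborel)" .
qed

text \<open>The two polarized second moments share their transverse factors, which split off; the
  difference of the time factors is given by \<open>heat1_polarization\<close>.\<close>

lemma reflected_correlation:
  fixes F :: "'n::finite \<Rightarrow> nat \<Rightarrow> real \<Rightarrow> real"
  assumes sq: "stochastic_quantization L m lam \<mu>" and F: "\<And>i. schwartz_family (L i) (F i)" and lam: "0 < lam"
    and c: "pos_circ (L t)"
  defines "f \<equiv> prod_fun (\<lambda>i. F i 0)"
  shows "(\<integral>\<Phi>. \<Phi> f * \<Phi> (f \<circ> reflect t) \<partial>\<mu>) =
    (\<integral>s. indicator {0..lam} s * (exp (- s * m\<^sup>2) * gauss_mean (sqrt (2 * s)) (conv (L t) (F t 0) (F t 0)) *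
       (\<Prod>i\<in>UNIV - {t}. cint (L i) (\<lambda>x. (heat1 (s / 2) (F i 0) x)\<^sup>2))) \<partial>lborel)"
proof -
  let ?R = "\<lambda>n x. (- 1) ^ n * F t n (- x)"
  have R: "schwartz_family (L t) ?R" by (rule schwartz_family_reflect[OF F])
  \<comment> \<open>polarization; \<open>f\<close> plus or minus its reflection is again a product, since only one factor changes\<close>
  define P where "P = (\<lambda>b. F(t := (\<lambda>n x. 1 * F t n x + b * ?R n x)))"
  have P: "schwartz_family (L i) (P b i)" for b i
    unfolding P_def using F schwartz_family_lincomb[OF F R, of 1 b] by simp
  have fr: "f \<circ> reflect t = prod_fun (\<lambda>i. (F(t := ?R)) i 0)"
    unfolding f_def prod_fun_reflect by (rule arg_cong[where f = prod_fun]) (simp add: fun_eq_iff)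
  have f_S: "f \<in> schwartz L" unfolding f_def by (rule prod_fun_schwartz[OF F])
  have fr_S: "f \<circ> reflect t \<in> schwartz L"
    unfolding fr by (rule prod_fun_schwartz) (use F R in auto)
  have Pf: "prod_fun (\<lambda>i. P b i 0) = (\<lambda>x. 1 * f x + b * (f \<circ> reflect t) x)" for b
  proof
    fix x
    have 1: "(\<lambda>i. P b i 0) = (\<lambda>i. F i 0)(t := (\<lambda>x. 1 * F t 0 x + b * F t 0 (- x)))"
      by (simp add: P_def fun_eq_iff)
    have 2: "f = prod_fun ((\<lambda>i. F i 0)(t := F t 0))" "f \<circ> reflect t = prod_fun ((\<lambda>i. F i 0)(t := (\<lambda>x. F t 0 (- x))))"
      unfolding f_def prod_fun_reflect by (simp_all add: fun_upd_idem)
    show "prod_fun (\<lambda>i. P b i 0) x = 1 * f x + b * (f \<circ> reflect t) x"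
      using prod_fun_upd_add[of "\<lambda>i. F i 0" t 1 "F t 0" b "\<lambda>x. F t 0 (- x)" x]
      unfolding 1 2(1)[symmetric] 2(2)[symmetric] .
  qed
  have sp: "space \<mu> = tempered L"
    using sq sets_eq_imp_space_eq[of \<mu> "tempered_sigma L"]
    unfolding stochastic_quantization_def tempered_sigma_def by (simp add: space_measure_of_conv)
  let ?e = "\<lambda>b \<alpha>. indicator {0..lam} \<alpha> * (exp (- (lam - \<alpha>) * m\<^sup>2) *
     (\<Prod>i\<in>UNIV. cint (L i) (\<lambda>t. (heat1 ((lam - \<alpha>) / 2) (P b i 0) t)\<^sup>2)))"
  let ?k = "\<lambda>s. indicator {0..lam} s * (exp (- s * m\<^sup>2) * gauss_mean (sqrt (2 * s)) (conv (L t) (F t 0) (F t 0)) *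
       (\<Prod>i\<in>UNIV - {t}. cint (L i) (\<lambda>x. (heat1 (s / 2) (F i 0) x)\<^sup>2)))"
  have e_int: "integrable lborel (?e b)" for b by (rule sol_fun_L2(3)[OF P lam])
  have "4 * (\<Phi> f * \<Phi> (f \<circ> reflect t)) = (\<Phi> (prod_fun (\<lambda>i. P 1 i 0)))\<^sup>2 - (\<Phi> (prod_fun (\<lambda>i. P (- 1) i 0)))\<^sup>2"
    if "\<Phi> \<in> space \<mu>" for \<Phi>
    unfolding Pf tempered_lincomb[OF that[unfolded sp] f_S fr_S] by (simp add: power2_eq_square algebra_simps)
  then have "(\<integral>\<Phi>. 4 * (\<Phi> f * \<Phi> (f \<circ> reflect t)) \<partial>\<mu>)
      = (\<integral>\<Phi>. (\<Phi> (prod_fun (\<lambda>i. P 1 i 0)))\<^sup>2 - (\<Phi> (prod_fun (\<lambda>i. P (- 1) i 0)))\<^sup>2 \<partial>\<mu>)"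
    by (intro Bochner_Integration.integral_cong) auto
  also have "\<dots> = (\<integral>\<alpha>. ?e 1 \<alpha> \<partial>lborel) - (\<integral>\<alpha>. ?e (- 1) \<alpha> \<partial>lborel)"
    using stochastic_quantization_second_moment[OF sq P lam]
    by (subst Bochner_Integration.integral_diff) auto
  also have "\<dots> = (\<integral>\<alpha>. ?e 1 \<alpha> - ?e (- 1) \<alpha> \<partial>lborel)"
    by (rule Bochner_Integration.integral_diff[OF e_int e_int, symmetric])
  \<comment> \<open>The new variable s = lam - \<alpha> is the stochastic time elapsed since the
    noise at \<alpha> acted; each of the two fields is smoothed for time s / 2.\<close>
  also have "\<dots> = (\<integral>\<alpha>. 4 * ?k (lam + (- 1) * \<alpha>) \<partial>lborel)"
  proof (rule Bochner_Integration.integral_cong[OF refl])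
    fix \<alpha>
    show "?e 1 \<alpha> - ?e (- 1) \<alpha> = 4 * ?k (lam + (- 1) * \<alpha>)"
    proof (cases "\<alpha> \<in> {0..lam}")
      case True
      define \<tau> where "\<tau> = (lam - \<alpha>) / 2"
      have \<tau>: "0 \<le> \<tau>" "lam - \<alpha> = 2 * \<tau>" using True by (auto simp: \<tau>_def)
      let ?Q = "\<Prod>i\<in>UNIV - {t}. cint (L i) (\<lambda>x. (heat1 \<tau> (F i 0) x)\<^sup>2)"
      have split: "(\<Prod>i\<in>UNIV. cint (L i) (\<lambda>t. (heat1 \<tau> (P b i 0) t)\<^sup>2))
          = cint (L t) (\<lambda>x. (heat1 \<tau> (\<lambda>x. 1 * F t 0 x + b * F t 0 (- x)) x)\<^sup>2) * ?Q" for b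
      proof -
        have "(\<Prod>i\<in>UNIV. cint (L i) (\<lambda>t. (heat1 \<tau> (P b i 0) t)\<^sup>2))
          = cint (L t) (\<lambda>x. (heat1 \<tau> (P b t 0) x)\<^sup>2) * (\<Prod>i\<in>UNIV - {t}. cint (L i) (\<lambda>x. (heat1 \<tau> (P b i 0) x)\<^sup>2))"
          by (rule prod.remove) auto
        then show ?thesis by (simp add: P_def)
      qed
      have ind: "lam + (- 1) * \<alpha> \<in> {0..lam}" using True by auto
      have s: "lam + (- 1) * \<alpha> = 2 * \<tau>" "2 * \<tau> / 2 = \<tau>" "2 * (2 * \<tau>) = 4 * \<tau>" using \<tau> by auto
      have "?e 1 \<alpha> - ?e (- 1) \<alpha> = exp (- (2 * \<tau>) * m\<^sup>2) *
          ((cint (L t) (\<lambda>x. (heat1 \<tau> (\<lambda>x. 1 * F t 0 x + 1 * F t 0 (- x)) x)\<^sup>2)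
           - cint (L t) (\<lambda>x. (heat1 \<tau> (\<lambda>x. 1 * F t 0 x + (- 1) * F t 0 (- x)) x)\<^sup>2)) * ?Q)"
        using True unfolding \<tau>_def[symmetric] unfolding split unfolding \<tau>(2) by (simp add: right_diff_distrib left_diff_distrib)
      also have "\<dots> = 4 * ?k (lam + (- 1) * \<alpha>)"
        unfolding heat1_polarization[OF c F \<tau>(1)] using ind unfolding s by simp
      finally show ?thesis .
    next
      case False
      then have "lam + (- 1) * \<alpha> \<notin> {0..lam}" by auto
      with False show ?thesis by simp
    qed
  qed
  also have "\<dots> = 4 * (\<integral>\<alpha>. ?k (lam + (- 1) * \<alpha>) \<partial>lborel)" by (rule integral_mult_right_zero)
  also have "(\<integral>\<alpha>. ?k (lam + (- 1) * \<alpha>) \<partial>lborel) = (\<integral>s. ?k s \<partial>lborel)"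
    using lborel_integral_real_affine[of "- 1" ?k lam] by simp
  finally show ?thesis
    unfolding integral_mult_right_zero mult_cancel_left by (simp only: numeral_neq_zero simp_thms)
qed

lemma positive_time_eq: "positive_time L t = {x. x $ t \<in> pos_time (L t)}"
  by (auto simp: positive_time_def pos_time_def lattice_shift_def split: option.split)

text \<open>The scalar in front of the Gaussian makes its square integrate to \<open>1\<close>.\<close>

definition spread :: "real option \<Rightarrow> nat \<Rightarrow> nat \<Rightarrow> real \<Rightarrow> real" where
  "spread c n = (case c of
     None \<Rightarrow> (\<lambda>k x. sqrt (2 * sqrt pi * real (Suc n)) *
       (poly (normal_poly (real (Suc n)) 1 k) x * normal_density 0 (real (Suc n)) x))
   | Some l \<Rightarrow> (\<lambda>k x. if k = 0 then 1 else 0))"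

lemma schwartz_family_spread: "schwartz_family c (spread c n)"
proof (cases c)
  case None
  have "schwartz_family None (\<lambda>k x. poly (normal_poly (real (Suc n)) 1 k) x * normal_density 0 (real (Suc n)) x)"
    by (rule schwartz_family_normal) simp
  from schwartz_family_lincomb[OF this this, of "sqrt (2 * sqrt pi * real (Suc n))" 0] show ?thesis
    by (simp add: None spread_def)
next
  case (Some l)
  show ?thesis unfolding Some spread_def schwartz_family_def by (auto simp: periodic1_def weight1_def)
qed

text \<open>The square of the density of deviation r is a multiple of the density of deviation r /
  sqrt 2, which integrates to 1.\<close>

lemma normal_density_square:
  assumes "0 < r"
  shows "(\<integral>x. (normal_density 0 r x)\<^sup>2 \<partial>lborel) = 1 / (2 * sqrt pi * r)"
proof -
  have r2: "0 < r / sqrt 2" using assms by simp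
  have "(normal_density 0 r x)\<^sup>2 = 1 / (2 * sqrt pi * r) * normal_density 0 (r / sqrt 2) x" for x
  proof -
    have "(normal_density 0 r x)\<^sup>2 = 1 / (2 * pi * r\<^sup>2) * exp (- x\<^sup>2 / r\<^sup>2)"
      using assms by (simp add: normal_density_def power_mult_distrib power_divide exp_double[symmetric] field_simps)
    moreover have "normal_density 0 (r / sqrt 2) x = 1 / (sqrt pi * r) * exp (- x\<^sup>2 / r\<^sup>2)"
      using assms by (simp add: normal_density_def power_divide real_sqrt_mult)
    moreover have "1 / (2 * pi * r\<^sup>2) = 1 / (2 * sqrt pi * r) * (1 / (sqrt pi * r))"
      by (simp add: power2_eq_square mult_ac)
    ultimately show ?thesis by simp
  qed
  then show ?thesis using integral_normal_density[OF r2] by simp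
qed

text \<open>Heat flow for time s / 2 adds s to the variance of the Gaussian, and the squared norm of
  a normal density is inversely proportional to its deviation. A constant on a circle does not
  change.\<close>

lemma spread_energy:
  assumes c: "pos_circ c" and s: "0 \<le> s"
  shows "cint c (\<lambda>x. (heat1 (s / 2) (spread c n 0) x)\<^sup>2)
    = (case c of None \<Rightarrow> real (Suc n) / sqrt ((real (Suc n))\<^sup>2 + s) | Some l \<Rightarrow> l)"
proof (cases c)
  case None
  define N a where "N = real (Suc n)" and "a = sqrt (2 * sqrt pi * N)"
  have N: "0 < N" by (simp add: N_def)
  have sp: "spread c n 0 = (\<lambda>x. a * normal_density 0 N x)"
    by (simp add: None spread_def N_def a_def)
  have "heat1 (s / 2) (spread c n 0) x = a * normal_density 0 (sqrt (N\<^sup>2 + s)) x" for x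
  proof (cases "s = 0")
    case True then show ?thesis using N by (simp add: heat1_def sp)
  next
    case False
    then have r: "0 < sqrt s" using s by simp
    have "heat1 (s / 2) (spread c n 0) x = (\<integral>y. a * (normal_density 0 (sqrt s) (x - y) * normal_density 0 N y) \<partial>lborel)"
      using False by (simp add: heat1_def sp mult.left_commute)
    also have "\<dots> = a * normal_density 0 (sqrt ((sqrt s)\<^sup>2 + N\<^sup>2)) x"
      by (simp only: integral_mult_right_zero normal_convolution(2)[OF r N])
    also have "(sqrt s)\<^sup>2 + N\<^sup>2 = N\<^sup>2 + s" using s by simp
    finally show ?thesis .
  qed
  moreover have "0 < sqrt (N\<^sup>2 + s)" using N s by (simp add: add_pos_nonneg)
  ultimately have "cint c (\<lambda>x. (heat1 (s / 2) (spread c n 0) x)\<^sup>2) = a\<^sup>2 * (1 / (2 * sqrt pi * sqrt (N\<^sup>2 + s)))"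
    using normal_density_square[of "sqrt (N\<^sup>2 + s)"] None by (simp add: cell1_def power_mult_distrib)
  also have "\<dots> = N / sqrt (N\<^sup>2 + s)" using N by (simp add: a_def)
  finally show ?thesis by (simp add: None N_def)
next
  case (Some l)
  have "heat1 (s / 2) (spread c n 0) x = 1" for x
    using s by (simp add: Some spread_def heat1_eq_gauss_mean gauss_mean_const)
  then show ?thesis using Some c by (simp add: cell1_def pos_circ_def less_imp_le)
qed

text \<open>For 0 \<le> s \<le> lam the transverse energies are at most their limits, so dominated
  convergence applies. A strictly negative limit forces a negative correlation already at some
  finite width, where f is a Schwartz function.\<close>

lemma stochastic_quantization_not_RP:
  fixes L :: "'n::finite \<rightharpoonup> real"
  assumes sq: "stochastic_quantization L m lam \<mu>" and lam: "0 < lam" and circ: "\<And>i. pos_circ (L i)"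
  shows "reflection_positivity_fails L t \<mu>"
proof -
  obtain U K where U: "schwartz_family (L t) U" "closed K" "\<And>x. U 0 x \<noteq> 0 \<Longrightarrow> x \<in> K" "K \<subseteq> pos_time (L t)"
    and neg: "(\<integral>s. indicator {0..lam} s * (exp (- s * m\<^sup>2) *
       gauss_mean (sqrt (2 * s)) (conv (L t) (U 0) (U 0))) \<partial>lborel) < 0"
    using time_profile_exists[OF circ[of t] lam, where m = m] by blast
  define F where "F = (\<lambda>n i. if i = t then U else spread (L i) n)"
  have F: "schwartz_family (L i) (F n i)" for n i using U(1) schwartz_family_spread by (simp add: F_def)
  let ?h = "\<lambda>s. indicator {0..lam} s * (exp (- s * m\<^sup>2) * gauss_mean (sqrt (2 * s)) (conv (L t) (U 0) (U 0)))"
  let ?\<rho> = "\<lambda>n s. \<Prod>i\<in>UNIV - {t}. (case L i of None \<Rightarrow> real (Suc n) / sqrt ((real (Suc n))\<^sup>2 + s) | Some l \<Rightarrow> l)"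
  let ?R = "\<Prod>i\<in>UNIV - {t}. (case L i of None \<Rightarrow> 1 | Some l \<Rightarrow> l)"
  have R: "0 < ?R" using circ by (intro prod_pos) (auto simp: pos_circ_def split: option.split)
  have corr: "(\<integral>\<Phi>. \<Phi> (prod_fun (\<lambda>i. F n i 0)) * \<Phi> (prod_fun (\<lambda>i. F n i 0) \<circ> reflect t) \<partial>\<mu>)
     = (\<integral>s. ?h s * ?\<rho> n s \<partial>lborel)" for n
    unfolding reflected_correlation[OF sq F lam circ]
  proof (rule Bochner_Integration.integral_cong[OF refl])
    fix s
    have "(\<Prod>i\<in>UNIV - {t}. cint (L i) (\<lambda>x. (heat1 (s / 2) (F n i 0) x)\<^sup>2)) = ?\<rho> n s" if "s \<in> {0..lam}"
      using that spread_energy[OF circ] by (intro prod.cong) (auto simp: F_def)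
    then show "indicator {0..lam} s * (exp (- s * m\<^sup>2) * gauss_mean (sqrt (2 * s)) (conv (L t) (F n t 0) (F n t 0)) *
       (\<Prod>i\<in>UNIV - {t}. cint (L i) (\<lambda>x. (heat1 (s / 2) (F n i 0) x)\<^sup>2))) = ?h s * ?\<rho> n s"
      by (cases "s \<in> {0..lam}") (auto simp: F_def)
  qed
  have cont: "continuous_on S (\<lambda>s. exp (- s * m\<^sup>2) * gauss_mean (sqrt (2 * s)) (conv (L t) (U 0) (U 0)))" for S
    by (intro continuous_intros continuous_on_compose2[OF gauss_mean_continuous[OF schwartz_family_conv[OF U(1) U(1)], of UNIV]]) auto
  have h_int: "integrable lborel ?h"
    using borel_integrable_atLeastAtMost'[OF cont, of 0 lam] by (simp add: set_integrable_def)
  have "(\<lambda>n. \<integral>s. ?h s * ?\<rho> n s \<partial>lborel) \<longlonglongrightarrow> (\<integral>s. ?h s * ?R \<partial>lborel)"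
  proof (rule integral_dominated_convergence[where w = "\<lambda>s. \<bar>?h s\<bar> * ?R"])
    show "integrable lborel (\<lambda>s. \<bar>?h s\<bar> * ?R)" by (intro integrable_mult_left integrable_abs h_int)
    show "(\<lambda>s. ?h s * ?R) \<in> borel_measurable lborel"
      by (rule borel_measurable_times[OF borel_measurable_integrable[OF h_int]]) simp
    have "(\<lambda>s. case L i of None \<Rightarrow> real (Suc n) / sqrt ((real (Suc n))\<^sup>2 + s) | Some l \<Rightarrow> l) \<in> borel_measurable lborel" for n i
      by (cases "L i") auto
    then show "(\<lambda>s. ?h s * ?\<rho> n s) \<in> borel_measurable lborel" for n
      by (intro borel_measurable_times[OF borel_measurable_integrable[OF h_int]] borel_measurable_prod)
    show "AE s in lborel. (\<lambda>n. ?h s * ?\<rho> n s) \<longlonglongrightarrow> ?h s * ?R"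
    proof (rule AE_I2)
      fix s
      have "(\<lambda>n. real (Suc n) / sqrt ((real (Suc n))\<^sup>2 + s)) \<longlonglongrightarrow> 1" by real_asymp
      then have "(\<lambda>n. case L i of None \<Rightarrow> real (Suc n) / sqrt ((real (Suc n))\<^sup>2 + s) | Some l \<Rightarrow> l)
          \<longlonglongrightarrow> (case L i of None \<Rightarrow> 1 | Some l \<Rightarrow> l)" for i
        by (cases "L i") auto
      then show "(\<lambda>n. ?h s * ?\<rho> n s) \<longlonglongrightarrow> ?h s * ?R" by (intro tendsto_mult tendsto_const tendsto_prod)
    qed
    show "AE s in lborel. norm (?h s * ?\<rho> n s) \<le> \<bar>?h s\<bar> * ?R" for n
    proof (rule AE_I2)
      fix s
      show "norm (?h s * ?\<rho> n s) \<le> \<bar>?h s\<bar> * ?R"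
      proof (cases "s \<in> {0..lam}")
        case True
        define N where "N = real (Suc n)"
        have N: "0 < N" by (simp add: N_def)
        have N_le: "N \<le> sqrt (N\<^sup>2 + s)" using True by (intro real_le_rsqrt) auto
        have pos: "0 < sqrt (N\<^sup>2 + s)" by (rule less_le_trans[OF N N_le])
        have le: "0 \<le> N / sqrt (N\<^sup>2 + s)" "N / sqrt (N\<^sup>2 + s) \<le> 1"
          using N N_le pos by (auto simp: pos_divide_le_eq)
        have fac: "0 \<le> (case L i of None \<Rightarrow> N / sqrt (N\<^sup>2 + s) | Some l \<Rightarrow> l) \<and>
            (case L i of None \<Rightarrow> N / sqrt (N\<^sup>2 + s) | Some l \<Rightarrow> l) \<le> (case L i of None \<Rightarrow> 1 | Some l \<Rightarrow> l)" for i
          using le circ[of i] by (cases "L i") (auto simp: pos_circ_def less_imp_le)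
        have "0 \<le> ?\<rho> n s" "?\<rho> n s \<le> ?R"
          unfolding N_def[symmetric] using fac by (blast intro: prod_nonneg prod_mono)+
        then show ?thesis by (simp add: abs_mult mult_left_mono)
      qed simp
    qed
  qed
  moreover have "(\<integral>s. ?h s * ?R \<partial>lborel) < 0"
    using neg R by (simp add: mult_neg_pos)
  ultimately have "\<forall>\<^sub>F n in sequentially. (\<integral>s. ?h s * ?\<rho> n s \<partial>lborel) < 0"
    by (rule order_tendstoD(2))
  then obtain n where n: "(\<integral>s. ?h s * ?\<rho> n s \<partial>lborel) < 0"
    by (auto simp: eventually_sequentially)
  define f where "f = prod_fun (\<lambda>i. F n i 0)"
  have f_S: "f \<in> schwartz L" unfolding f_def by (rule prod_fun_schwartz[OF F])
  \<comment> \<open>The algebra is built from complex test functions; the real f enters it with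
    imaginary part 0, on which \<Phi> vanishes by linearity.\<close>
  have zero_S: "(\<lambda>_. 0) \<in> schwartz L"
  proof -
    have "schwartz_family (L i) (\<lambda>_ _. 0)" for i by (auto simp: schwartz_family_def periodic1_def)
    from prod_fun_schwartz[of L "\<lambda>_ _ _. 0", OF this]
    have "prod_fun (\<lambda>_ _. 0) \<in> schwartz L" .
    moreover have "prod_fun (\<lambda>_ _. 0) = (\<lambda>_ :: real ^ 'n. 0)" by (simp add: prod_fun_def fun_eq_iff)
    ultimately show ?thesis by simp
  qed
  define A where "A = (\<lambda>\<Phi>. eval_complex \<Phi> (\<lambda>x. complex_of_real (f x)))"
  have "A \<in> positive_algebra L t"
    unfolding A_def
  proof (rule positive_algebra.field)
    show "(\<lambda>x. complex_of_real (f x)) \<in> schwartz_complex L"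
      using f_S zero_S by (simp add: schwartz_complex_def)
    have "closed {x :: real ^ 'n. x $ t \<in> K}"
      using continuous_closed_vimage[OF U(2), of "\<lambda>x :: real ^ 'n. x $ t"]
      by (auto simp: vimage_def intro!: continuous_intros)
    moreover have "{x. complex_of_real (f x) \<noteq> 0} \<subseteq> {x. x $ t \<in> K}"
      using U(3) by (auto simp: f_def prod_fun_split[of _ _ t] F_def)
    ultimately have "closure {x. complex_of_real (f x) \<noteq> 0} \<subseteq> {x. x $ t \<in> K}"
      by (rule closure_minimal[rotated])
    then show "closure {x. complex_of_real (f x) \<noteq> 0} \<subseteq> positive_time L t"
      unfolding positive_time_eq using U(4) by blast
  qed
  moreover have "(\<integral>\<Phi>. cnj (A \<Phi>) * Theta t A \<Phi> \<partial>\<mu>) < 0"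
  proof -
    have sp: "space \<mu> = tempered L"
      using sq sets_eq_imp_space_eq[of \<mu> "tempered_sigma L"]
      unfolding stochastic_quantization_def tempered_sigma_def by (simp add: space_measure_of_conv)
    have "cnj (A \<Phi>) * Theta t A \<Phi> = complex_of_real (\<Phi> f * \<Phi> (f \<circ> reflect t))" if "\<Phi> \<in> space \<mu>" for \<Phi>
    proof -
      have "\<Phi> (\<lambda>_. 0) = 0"
        using tempered_lincomb[OF that[unfolded sp] zero_S zero_S, of 0 0] by simp
      then show ?thesis
        by (simp add: A_def Theta_def eval_complex_def comp_def complex_eq_iff)
    qed
    then have "(\<integral>\<Phi>. cnj (A \<Phi>) * Theta t A \<Phi> \<partial>\<mu>) = (\<integral>\<Phi>. complex_of_real (\<Phi> f * \<Phi> (f \<circ> reflect t)) \<partial>\<mu>)"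
      by (intro Bochner_Integration.integral_cong) auto
    also have "\<dots> = complex_of_real (\<integral>s. ?h s * ?\<rho> n s \<partial>lborel)"
      unfolding integral_complex_of_real f_def corr ..
    finally show ?thesis using n by (simp add: less_complex_def)
  qed
  ultimately show ?thesis unfolding reflection_positivity_fails_def by blast
qed

theorem theorem3p1:
  fixes t :: "'n::finite" and lam m :: real
  assumes "0 < lam" and "0 \<le> m" and "CARD('n) \<in> {1, 2} \<longrightarrow> 0 < m"
  shows "(2 \<le> CARD('n) \<longrightarrow>
           (\<forall>\<mu>. stochastic_quantization Map.empty m lam \<mu> \<longrightarrow>
             reflection_positivity_fails Map.empty t \<mu>)) \<and>
         (CARD('n) = 1 \<and> 1 < 2 * lam * m\<^sup>2 \<longrightarrow>
           (\<forall>\<mu>. stochastic_quantization Map.empty m lam \<mu> \<longrightarrow>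
             reflection_positivity_fails Map.empty t \<mu>)) \<and>
         (2 \<le> CARD('n) \<or> CARD('n) = 1 \<and> 1 < 2 * lam * m\<^sup>2 \<longrightarrow>
           (\<forall>(J :: 'n set) (l :: 'n \<Rightarrow> real). (\<forall>j\<in>J. 0 < l j) \<longrightarrow>
             (\<forall>\<mu>. stochastic_quantization ((Some \<circ> l) |` J) m lam \<mu> \<longrightarrow>
               reflection_positivity_fails ((Some \<circ> l) |` J) t \<mu>)))"
proof -
  \<comment> \<open>All three claims are instances of one statement about an arbitrary L with
    positive circumferences; for \<open>Map.empty\<close> the positivity is vacuous.\<close>
  have main: "reflection_positivity_fails L t \<mu>"
    if "stochastic_quantization L m lam \<mu>" "\<And>i l. L i = Some l \<Longrightarrow> 0 < l" for L :: "'n \<rightharpoonup> real" and \<mu>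
    using that assms(1) by (intro stochastic_quantization_not_RP) (auto simp: pos_circ_def)
  have circ: "0 < b" if "\<forall>j\<in>J. 0 < l j" "((Some \<circ> l) |` J) i = Some b" for J i b and l :: "'n \<Rightarrow> real"
    using that by (auto simp: restrict_map_def split: if_splits)
  show ?thesis
    by (intro conjI impI allI; rule main) (auto intro: circ)
qed

end
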